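(* Let $k\ge1$ be an integer. The sequence $$\mathbb R\longrightarrow\mathcal U^{(0),k}(\Omega)\xrightarrow{\ \nabla\ }\mathcal U^{(1),k}(\Omega)\xrightarrow{\ \nabla\times\ }\mathcal U^{(2),k}(\Omega)\xrightarrow{\ \nabla\cdot\ }\mathcal U^{(3),k}(\Omega)\longrightarrow 0$$ is exact (in particular each differential operator maps each space into the next), where $\mathbb R\to\mathcal U^{(0),k}(\Omega)$ is the inclusion of the constants.
   Context: Finite pyramid: $\Omega=\{(\xi,\eta,\zeta)\in\mathbb R^3:\xi,\eta,\zeta\ge0,\ \xi\le1-\zeta,\ \eta\le1-\zeta\}$. Infinite pyramid: $\Omega_\infty=\{(x,y,z): 0\le x,y\le1,\ z\ge0\}$ (together with a point $\infty$). Map: $\phi:\Omega_\infty\to\Omega$, $\phi(x,y,z)=\left(\frac{x}{1+z},\frac{y}{1+z},\frac{z}{1+z}\right)$, $\phi(\infty)=(0,0,1)$, a diffeomorphism from $\Omega_\infty\setminus\{\infty\}$ onto $\Omega$ minus its apex. Pullbacks: 0-forms $\phi^*u=u\circ\phi$; 1-forms $\phi^*E=D\phi^T(E\circ\phi)$; 2-forms $\phi^*v=|D\phi|D\phi^{-1}(v\circ\phi)$; 3-forms $\phi^*q=|D\phi|(q\circ\phi)$, $|D\phi|$ being the Jacobian determinant; $(\phi^{-1})^*=(\phi^* )^{-1}$. $Q^{l,m,n}$: polynomials of degree at most $l,m,n$ in $x,y,z$; $Q^{l,m,n}_k=\{u/(1+z)^k:u\in Q^{l,m,n}\}$; $P^n_k[w,z]=\{u(w,z)/(1+z)^k:u$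 polynomial of total degree $\le n\}$; $\tilde P^{k-1}_{k+1}[w,1+z]=\frac{1}{(1+z)^{k+1}}\mathrm{span}\{w^a(1+z)^{k-1-a}:0\le a\le k-1\}$. Polynomial spaces with a negative degree are $\{0\}$. Subscripts $x,y$ on $r,s,t$ denote partial derivatives. Spaces on $\Omega_\infty$ (the space on $\Omega$ is in each case $\mathcal U^{(s),k}(\Omega)=(\phi^{-1})^*\mathcal U^{(s),k}(\Omega_\infty)$, using the pullback of $s$-forms): $\mathcal U^{(0),k}(\Omega_\infty)$: all $u\in Q_k^{k,k,k-1}\oplus\mathrm{span}\{z^k/(1+z)^k\}$ whose restrictions to $y=0,1$ lie in $P_k^k[x,z]$ and to $x=0,1$ lie in $P_k^k[y,z]$. $\mathcal U^{(1),k}(\Omega_\infty)$: all $u\in Q_{k+1}^{k-1,k,k-1}\times Q_{k+1}^{k,k-1,k-1}\times Q_{k+1}^{k,k,k-2}\oplus\{\frac{z^{k-1}}{(1+z)^{k+1}}(r_xz,r_yz,-r)^T:r\in Q^{k,k}[x,y]\}$ such that on $y=0,1$ (with $w=x$) the tangential components $(u_1,u_3)\in(P^{k-1}_{k+1}[w,z])^2\oplus\tilde P^{k-1}_{k+1}[w,1+z](1+z,-w)^T$, and on $x=0,1$ (with $w=y$) $(u_2,u_3)$ lies in the same space. $\mathcal U^{(2),k}(\Omega_\infty)$: all $u\in Q_{k+2}^{k,k-1,k-2}\times Q_{k+2}^{k-1,k,k-2}\times Q_{k+2}^{k-1,k-1,k-1}\oplus\{\frac{z^{k-1}}{(1+z)^{k+2}}(0,2s,s_y(1+z))^T:s\in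 Q^{k-1,k}[x,y]\}\oplus\{\frac{z^{k-1}}{(1+z)^{k+2}}(2t,0,t_x(1+z))^T:t\in Q^{k,k-1}[x,y]\}$ whose normal components lie in $P^{k-1}_{k+2}[x,z]$ on $y=0,1$ and in $P^{k-1}_{k+2}[y,z]$ on $x=0,1$. $\mathcal U^{(3),k}(\Omega_\infty)=Q_{k+3}^{k-1,k-1,k-1}$. *)

theory Defs
  imports "HOL-Analysis.Analysis"
begin

text \<open>
  Scalar fields are functions \<open>real^3 \<Rightarrow> real\<close>, vector fields functions \<open>real^3 \<Rightarrow> real^3\<close>.
  A field on a set \<open>S\<close> is an element of \<open>extensional S\<close>, so that equality of fields is
  equality on \<open>S\<close>.

  The point \<open>\<infinity>\<close> of the infinite pyramid and its image, the apex, are left out: vector fields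
  in the spaces below are in general undefined there (the pullback involves the derivative of
  \<open>\<phi>\<close>), and a scalar field in the space of 0-forms is determined at the apex by continuity,
  because the functions of \<open>Q_frac k k (k-1) k\<close> tend to 0 and \<open>z^k/(1+z)^k\<close> tends to 1
  as \<open>z \<rightarrow> \<infinity>\<close>.
\<close>

definition pyramid :: "(real^3) set" where
  "pyramid = {p. 0 \<le> p$1 \<and> 0 \<le> p$2 \<and> 0 \<le> p$3 \<and> p$1 \<le> 1 - p$3 \<and> p$2 \<le> 1 - p$3}"

definition apex :: "real^3" where
  "apex = vector [0, 0, 1]"

definition Omega :: "(real^3) set" where
  "Omega = pyramid - {apex}"

definition Omega_inf :: "(real^3) set" where
  "Omega_inf = {p. 0 \<le> p$1 \<and> p$1 \<le> 1 \<and> 0 \<le> p$2 \<and> p$2 \<le> 1 \<and> 0 \<le> p$3}"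

definition phi :: "real^3 \<Rightarrow> real^3" where
  "phi p = vector [p$1 / (1 + p$3), p$2 / (1 + p$3), p$3 / (1 + p$3)]"

abbreviation Dphi :: "real^3 \<Rightarrow> real^3^3" where
  "Dphi p \<equiv> jacobian phi (at p)"

definition pull0 :: "(real^3 \<Rightarrow> real) \<Rightarrow> (real^3 \<Rightarrow> real)" where
  "pull0 u = restrict (\<lambda>p. u (phi p)) Omega_inf"

definition pull1 :: "(real^3 \<Rightarrow> real^3) \<Rightarrow> (real^3 \<Rightarrow> real^3)" where
  "pull1 E = restrict (\<lambda>p. transpose (Dphi p) *v E (phi p)) Omega_inf"

definition pull2 :: "(real^3 \<Rightarrow> real^3) \<Rightarrow> (real^3 \<Rightarrow> real^3)" where
  "pull2 v = restrict (\<lambda>p. det (Dphi p) *\<^sub>R (matrix_inv (Dphi p) *v v (phi p))) Omega_inf"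

definition pull3 :: "(real^3 \<Rightarrow> real) \<Rightarrow> (real^3 \<Rightarrow> real)" where
  "pull3 q = restrict (\<lambda>p. det (Dphi p) * q (phi p)) Omega_inf"

text \<open>
  Derivatives are taken within \<open>S\<close>, hence one-sided at boundary points that belong to \<open>S\<close>.
  The entry \<open>jacobian v F $ i $ j\<close> is the \<open>j\<close>-th partial derivative of the \<open>i\<close>-th component.
\<close>

definition grad_on :: "(real^3) set \<Rightarrow> (real^3 \<Rightarrow> real) \<Rightarrow> (real^3 \<Rightarrow> real^3)" where
  "grad_on S u = restrict (\<lambda>p. \<chi> i. frechet_derivative u (at p within S) (axis i 1)) S"

definition curl_on :: "(real^3) set \<Rightarrow> (real^3 \<Rightarrow> real^3) \<Rightarrow> (real^3 \<Rightarrow> real^3)" where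
  "curl_on S v = restrict (\<lambda>p. let D = jacobian v (at p within S) in
     vector [D$3$2 - D$2$3, D$1$3 - D$3$1, D$2$1 - D$1$2]) S"

definition div_on :: "(real^3) set \<Rightarrow> (real^3 \<Rightarrow> real^3) \<Rightarrow> (real^3 \<Rightarrow> real)" where
  "div_on S v = restrict (\<lambda>p. trace (jacobian v (at p within S))) S"

text \<open>
  Degree bounds are integers, so that a negative bound leaves only the empty sum and the
  space is \<open>{0}\<close>. These are functions on all of \<open>\<real>\<^sup>2\<close> or \<open>\<real>\<^sup>3\<close>; the rational ones
  are only ever used for \<open>z \<ge> 0\<close>.
\<close>

definition deg_le :: "int \<Rightarrow> nat set" where
  "deg_le n = {a. int a \<le> n}"

definition Q2 :: "int \<Rightarrow> int \<Rightarrow> (real \<Rightarrow> real \<Rightarrow> real) set" where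
  "Q2 l m = {r. \<exists>c :: nat \<Rightarrow> nat \<Rightarrow> real.
     r = (\<lambda>x y. \<Sum>a\<in>deg_le l. \<Sum>b\<in>deg_le m. c a b * x ^ a * y ^ b)}"

definition Q3 :: "int \<Rightarrow> int \<Rightarrow> int \<Rightarrow> (real^3 \<Rightarrow> real) set" where
  "Q3 l m n = {u. \<exists>c :: nat \<Rightarrow> nat \<Rightarrow> nat \<Rightarrow> real.
     u = (\<lambda>p. \<Sum>a\<in>deg_le l. \<Sum>b\<in>deg_le m. \<Sum>d\<in>deg_le n.
            c a b d * (p$1) ^ a * (p$2) ^ b * (p$3) ^ d)}"

definition Q_frac :: "int \<Rightarrow> int \<Rightarrow> int \<Rightarrow> nat \<Rightarrow> (real^3 \<Rightarrow> real) set" where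
  "Q_frac l m n k = {\<lambda>p. u p / (1 + p$3) ^ k | u. u \<in> Q3 l m n}"

definition P2 :: "int \<Rightarrow> (real \<Rightarrow> real \<Rightarrow> real) set" where
  "P2 n = {u. \<exists>c :: nat \<Rightarrow> nat \<Rightarrow> real.
     u = (\<lambda>w z. \<Sum>(a,b)\<in>{(a,b). int a + int b \<le> n}. c a b * w ^ a * z ^ b)}"

definition P_frac :: "int \<Rightarrow> nat \<Rightarrow> (real \<Rightarrow> real \<Rightarrow> real) set" where
  "P_frac n k = {\<lambda>w z. u w z / (1 + z) ^ k | u. u \<in> P2 n}"

text \<open>The space \<open>\<tilde>P\<close> with degree \<open>k - 1\<close> and weight \<open>k + 1\<close>, for \<open>k \<ge> 1\<close>.\<close>

definition P_tilde :: "nat \<Rightarrow> (real \<Rightarrow> real \<Rightarrow> real) set" where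
  "P_tilde k = {h. \<exists>c :: nat \<Rightarrow> real.
     h = (\<lambda>w z. (\<Sum>a = 0..k - 1. c a * w ^ a * (1 + z) ^ (k - 1 - a)) / (1 + z) ^ (k + 1))}"

definition tangential_space :: "nat \<Rightarrow> (real \<Rightarrow> real \<Rightarrow> real \<times> real) set" where
  "tangential_space k =
     {\<lambda>w z. (f w z + h w z * (1 + z), g w z - h w z * w) | f g h.
        f \<in> P_frac (int k - 1) (k + 1) \<and> g \<in> P_frac (int k - 1) (k + 1) \<and> h \<in> P_tilde k}"

definition dx :: "(real \<Rightarrow> real \<Rightarrow> real) \<Rightarrow> real \<Rightarrow> real \<Rightarrow> real" where
  "dx r x y = deriv (\<lambda>t. r t y) x"

definition dy :: "(real \<Rightarrow> real \<Rightarrow> real) \<Rightarrow> real \<Rightarrow> real \<Rightarrow> real" where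
  "dy r x y = deriv (\<lambda>t. r x t) y"

text \<open>
  \<open>on_strip f F\<close>: the function \<open>f\<close>, which carries the two coordinates of a vertical face of the
  infinite pyramid, is the restriction to that face of a member of \<open>F\<close>.
\<close>

definition on_strip :: "(real \<Rightarrow> real \<Rightarrow> 'b) \<Rightarrow> (real \<Rightarrow> real \<Rightarrow> 'b) set \<Rightarrow> bool" where
  "on_strip f F \<longleftrightarrow> (\<exists>g\<in>F. \<forall>w\<in>{0..1}. \<forall>z\<ge>0. f w z = g w z)"

text \<open>The direct sums of the definitions appear as sums of representatives.\<close>

definition U0_inf :: "nat \<Rightarrow> (real^3 \<Rightarrow> real) set" where
  "U0_inf k = {u \<in> extensional Omega_inf.
     (\<exists>q\<in>Q_frac (int k) (int k) (int k - 1) k. \<exists>c::real.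
        \<forall>p\<in>Omega_inf. u p = q p + c * ((p$3) ^ k / (1 + p$3) ^ k)) \<and>
     (\<forall>e\<in>{0, 1}. on_strip (\<lambda>x z. u (vector [x, e, z])) (P_frac (int k) k)) \<and>
     (\<forall>e\<in>{0, 1}. on_strip (\<lambda>y z. u (vector [e, y, z])) (P_frac (int k) k))}"

definition U1_inf :: "nat \<Rightarrow> (real^3 \<Rightarrow> real^3) set" where
  "U1_inf k = {u \<in> extensional Omega_inf.
     (\<exists>q1\<in>Q_frac (int k - 1) (int k) (int k - 1) (k + 1).
      \<exists>q2\<in>Q_frac (int k) (int k - 1) (int k - 1) (k + 1).
      \<exists>q3\<in>Q_frac (int k) (int k) (int k - 2) (k + 1).
      \<exists>r\<in>Q2 (int k) (int k).
        \<forall>p\<in>Omega_inf. u p = vector [q1 p, q2 p, q3 p] +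
          ((p$3) ^ (k - 1) / (1 + p$3) ^ (k + 1)) *\<^sub>R
            vector [dx r (p$1) (p$2) * p$3, dy r (p$1) (p$2) * p$3, - r (p$1) (p$2)]) \<and>
     (\<forall>e\<in>{0, 1}. on_strip (\<lambda>x z. (u (vector [x, e, z]) $ 1, u (vector [x, e, z]) $ 3))
        (tangential_space k)) \<and>
     (\<forall>e\<in>{0, 1}. on_strip (\<lambda>y z. (u (vector [e, y, z]) $ 2, u (vector [e, y, z]) $ 3))
        (tangential_space k))}"

definition U2_inf :: "nat \<Rightarrow> (real^3 \<Rightarrow> real^3) set" where
  "U2_inf k = {u \<in> extensional Omega_inf.
     (\<exists>q1\<in>Q_frac (int k) (int k - 1) (int k - 2) (k + 2).
      \<exists>q2\<in>Q_frac (int k - 1) (int k) (int k - 2) (k + 2).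
      \<exists>q3\<in>Q_frac (int k - 1) (int k - 1) (int k - 1) (k + 2).
      \<exists>s\<in>Q2 (int k - 1) (int k).
      \<exists>t\<in>Q2 (int k) (int k - 1).
        \<forall>p\<in>Omega_inf. u p = vector [q1 p, q2 p, q3 p] +
          ((p$3) ^ (k - 1) / (1 + p$3) ^ (k + 2)) *\<^sub>R
            vector [0, 2 * s (p$1) (p$2), dy s (p$1) (p$2) * (1 + p$3)] +
          ((p$3) ^ (k - 1) / (1 + p$3) ^ (k + 2)) *\<^sub>R
            vector [2 * t (p$1) (p$2), 0, dx t (p$1) (p$2) * (1 + p$3)]) \<and>
     (\<forall>e\<in>{0, 1}. on_strip (\<lambda>x z. u (vector [x, e, z]) $ 2) (P_frac (int k - 1) (k + 2))) \<and>
     (\<forall>e\<in>{0, 1}. on_strip (\<lambda>y z. u (vector [e, y, z]) $ 1) (P_frac (int k - 1) (k + 2)))}"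

definition U3_inf :: "nat \<Rightarrow> (real^3 \<Rightarrow> real) set" where
  "U3_inf k = {u \<in> extensional Omega_inf.
     \<exists>q\<in>Q_frac (int k - 1) (int k - 1) (int k - 1) (k + 3). \<forall>p\<in>Omega_inf. u p = q p}"

text \<open>
  The pullbacks are bijections between fields on \<open>Omega\<close> and fields on \<open>Omega_inf\<close>, so the image
  under the inverse pullback is the preimage under the pullback.
\<close>

definition U0 :: "nat \<Rightarrow> (real^3 \<Rightarrow> real) set" where
  "U0 k = {u \<in> extensional Omega. pull0 u \<in> U0_inf k}"

definition U1 :: "nat \<Rightarrow> (real^3 \<Rightarrow> real^3) set" where
  "U1 k = {u \<in> extensional Omega. pull1 u \<in> U1_inf k}"

definition U2 :: "nat \<Rightarrow> (real^3 \<Rightarrow> real^3) set" where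
  "U2 k = {u \<in> extensional Omega. pull2 u \<in> U2_inf k}"

definition U3 :: "nat \<Rightarrow> (real^3 \<Rightarrow> real) set" where
  "U3 k = {u \<in> extensional Omega. pull3 u \<in> U3_inf k}"

definition const_field :: "real \<Rightarrow> (real^3 \<Rightarrow> real)" where
  "const_field c = restrict (\<lambda>p. c) Omega"

text \<open>Exactness at \<open>B\<close> of \<open>A \<rightarrow> B \<rightarrow> C\<close>, where \<open>zero\<close> is the zero of \<open>C\<close>.\<close>

definition exact_at :: "'a set \<Rightarrow> ('a \<Rightarrow> 'b) \<Rightarrow> 'b set \<Rightarrow> ('b \<Rightarrow> 'c) \<Rightarrow> 'c set \<Rightarrow> 'c \<Rightarrow> bool" where
  "exact_at A f B g C zero \<longleftrightarrow>
     f ` A \<subseteq> B \<and> g ` B \<subseteq> C \<and> f ` A = {b \<in> B. g b = zero}"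

end

theory Submission
  imports Defs
begin

text \<open>
  Put \<open>s = 1 / (1 + z)\<close>. Since \<open>z^d / (1 + z)^m\<close> is a polynomial in \<open>s\<close>, every member of the four
  spaces on the infinite pyramid is a sum of terms that are homogeneous in \<open>s\<close>, with coefficients
  polynomial in \<open>x\<close> and \<open>y\<close>, when \<open>dz\<close> is counted with degree \<open>-1\<close>, that is, \<open>s^j dx\<close>, \<open>s^j dy\<close>
  and \<open>s^(j+1) dz\<close> have degree \<open>j\<close>. The face conditions, too, decouple into one
  condition for each degree, and the exterior derivative preserves the degree. In degree \<open>j > 0\<close>
  a closed form \<open>s^j \<omega> + s^(j+1) dz \<and> \<eta>\<close>, with \<open>\<omega>\<close> and \<open>\<eta>\<close> forms in \<open>x\<close> and \<open>y\<close>, is the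
  derivative of \<open>- s^j \<eta> / j\<close>, and this primitive again satisfies the degree bounds and the
  face conditions. On the finite pyramid \<open>s = 1 - \<zeta>\<close>, \<open>x = \<xi> / s\<close> and \<open>y = \<eta> / s\<close>, so that
  gradient, curl and divergence can be computed there on homogeneous terms.
\<close>

section \<open>Polynomial functions\<close>

text \<open>The degree is homogeneity under dilations of the finite pyramid about its apex: x and y
  are constant along the rays from the apex, and s is proportional to the distance on each ray. By
  Cartan's formula, contraction with the radial field s d/ds inverts the exterior derivative on
  closed forms up to the factor j; this is the origin of the primitive. In the given spaces an
  m-form has degree at least m, and every form of degree exactly m is closed. This explains the
  extra summands: constants for m = 0, the terms d(s r) for m = 1, and for m = 2 the closed forms
  whose factor 2 is the degree. Degree 0, where j cannot be divided out, therefore contains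
  constants only, and they are the whole cohomology. The delicate point is the face conditions. That
  differentiation respects them rests on Euler's identity: (n + 1) f - x f' has no term
  x^(n+1).\<close>

definition Pol :: "nat \<Rightarrow> (real \<Rightarrow> real) set" where
  "Pol n = {poly p | p. degree p \<le> n}"

lemma PolI: "degree p \<le> n \<Longrightarrow> poly p \<in> Pol n"
  unfolding Pol_def by blast

lemma PolE:
  assumes "f \<in> Pol n"
  obtains p where "f = poly p" "degree p \<le> n"
  using assms unfolding Pol_def by blast

lemma Pol_mono: "m \<le> n \<Longrightarrow> f \<in> Pol m \<Longrightarrow> f \<in> Pol n"
  unfolding Pol_def by auto

lemma Pol_zero [simp]: "(\<lambda>x. 0) \<in> Pol n"
  using PolI[of 0 n] by (simp add: poly_0[abs_def])

lemma Pol_add: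
  assumes "f \<in> Pol n" "g \<in> Pol n"
  shows "(\<lambda>x. f x + g x) \<in> Pol n"
proof -
  obtain p q where "f = poly p" "degree p \<le> n" "g = poly q" "degree q \<le> n"
    using assms by (metis PolE)
  then show ?thesis
    using PolI[of "p + q" n] by (simp add: degree_add_le poly_add[abs_def])
qed

lemma Pol_cmult:
  assumes "f \<in> Pol n"
  shows "(\<lambda>x. c * f x) \<in> Pol n"
proof -
  obtain p where "f = poly p" "degree p \<le> n"
    using assms by (metis PolE)
  then show ?thesis
    using PolI[of "smult c p" n] degree_smult_le[of c p] by (simp add: poly_smult[abs_def])
qed

lemma Pol_divc: "f \<in> Pol n \<Longrightarrow> (\<lambda>x. f x / c) \<in> Pol n"
  using Pol_cmult[of f n "1 / c"] by simp

lemma Pol_uminus: "f \<in> Pol n \<Longrightarrow> (\<lambda>x. - f x) \<in> Pol n"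
  using Pol_cmult[of f n "-1"] by simp

lemma Pol_diff: "f \<in> Pol n \<Longrightarrow> g \<in> Pol n \<Longrightarrow> (\<lambda>x. f x - g x) \<in> Pol n"
  using Pol_add[OF _ Pol_uminus] by fastforce

lemma Pol_mult_x:
  assumes "f \<in> Pol n"
  shows "(\<lambda>x. x * f x) \<in> Pol (Suc n)"
proof -
  obtain p where p: "f = poly p" "degree p \<le> n"
    using assms by (metis PolE)
  have "poly (pCons 0 p) = (\<lambda>x. x * f x)"
    using p by (auto simp: fun_eq_iff)
  moreover have "degree (pCons 0 p) \<le> Suc n"
    using p by (meson degree_pCons_le le_trans not_less_eq_eq)
  ultimately show ?thesis
    using PolI by metis
qed

lemma Pol_sum:
  assumes "\<And>i. i \<in> I \<Longrightarrow> f i \<in> Pol n"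
  shows "(\<lambda>x. \<Sum>i\<in>I. f i x) \<in> Pol n"
  using assms by (induction I rule: infinite_finite_induct) (auto intro: Pol_add)

lemma Pol_monom: "a \<le> n \<Longrightarrow> (\<lambda>x. c * x ^ a) \<in> Pol n"
  using PolI[of "monom c a" n] degree_monom_le[of c a] by (simp add: poly_monom[abs_def])

lemma Pol_coeffs:
  assumes "f \<in> Pol n"
  obtains c where "f = (\<lambda>x. \<Sum>a\<le>n. c a * x ^ a)"
proof -
  obtain p where p: "f = poly p" "degree p \<le> n"
    using assms by (metis PolE)
  have "poly p x = (\<Sum>a\<le>n. coeff p a * x ^ a)" for x
    unfolding poly_altdef using p(2)
    by (intro sum.mono_neutral_left) (auto simp: coeff_eq_0)
  then show ?thesis
    using p(1) that[of "coeff p"] by (auto simp: fun_eq_iff)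
qed

lemma Pol_drop_top:
  assumes "f \<in> Pol (Suc n)"
  obtains c where "(\<lambda>x. f x - c * x ^ Suc n) \<in> Pol n"
proof -
  obtain c where c: "f = (\<lambda>x. \<Sum>a\<le>Suc n. c a * x ^ a)"
    using Pol_coeffs[OF assms] by metis
  have "(\<lambda>x. f x - c (Suc n) * x ^ Suc n) = (\<lambda>x. \<Sum>a\<le>n. c a * x ^ a)"
    unfolding c by auto
  moreover have "\<dots> \<in> Pol n"
    by (intro Pol_sum Pol_monom) auto
  ultimately show ?thesis
    using that by metis
qed

lemma Pol_eq_on_interval:
  assumes "f \<in> Pol n" "g \<in> Pol m" "\<And>x. 0 \<le> x \<Longrightarrow> x \<le> 1 \<Longrightarrow> f x = g x"
  shows "f = g"
proof -
  obtain p q where pq: "f = poly p" "g = poly q"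
    using assms by (metis PolE)
  have "{0..1} \<subseteq> {x. poly (p - q) x = 0}"
    using assms(3) pq by auto
  then have "infinite {x. poly (p - q) x = 0}"
    using infinite_Icc[of "0::real" 1] infinite_super by (metis zero_less_one)
  then have "p - q = 0"
    using poly_roots_finite by blast
  then show ?thesis
    using pq by simp
qed

lemma Pol_deriv:
  assumes "f \<in> Pol (Suc n)"
  shows "deriv f \<in> Pol n"
proof -
  obtain p where p: "f = poly p" "degree p \<le> Suc n"
    using assms by (metis PolE)
  have "deriv f = poly (pderiv p)"
    unfolding p(1) by (auto simp: fun_eq_iff intro!: DERIV_imp_deriv poly_DERIV)
  then show ?thesis
    using p(2) by (auto simp: degree_pderiv intro: PolI)
qed

text \<open>Euler's operator multiplies x^i by n + 1 - i and so annihilates the only possible term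
  above the bound.\<close>

lemma Pol_euler:
  assumes "f \<in> Pol (Suc n)"
  shows "(\<lambda>x. (real n + 1) * f x - x * deriv f x) \<in> Pol n"
proof -
  obtain p where p: "f = poly p" "degree p \<le> Suc n"
    using assms by (metis PolE)
  let ?q = "smult (real n + 1) p - pCons 0 (pderiv p)"
  have d: "deriv f = poly (pderiv p)"
    unfolding p(1) by (auto simp: fun_eq_iff intro!: DERIV_imp_deriv poly_DERIV)
  have c: "coeff ?q i = (real n + 1 - real i) * coeff p i" for i
    by (cases i) (auto simp: coeff_pderiv algebra_simps)
  have z: "coeff ?q i = 0" if "i > n" for i
    using that p(2) unfolding c by (cases "i = Suc n") (auto simp: coeff_eq_0)
  have "degree ?q \<le> n"
    using z by (simp add: degree_le)
  moreover have "(\<lambda>x. (real n + 1) * f x - x * deriv f x) = poly ?q"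
    using d unfolding p(1) by (simp add: fun_eq_iff)
  ultimately show ?thesis
    using PolI by metis
qed

lemma Pol_DERIV: "f \<in> Pol n \<Longrightarrow> (f has_field_derivative deriv f x) (at x)"
  by (metis DERIV_deriv_iff_field_differentiable PolE poly_DERIV field_differentiable_def)

text \<open>Lets the curl inherit the face condition. Since \<open>w\<close> may have degree n + 2,
  neither summand of the conclusion obeys the bound by itself; writing w = g - x p turns the sum
  into Euler's expression for \<open>p\<close> plus the derivative of g.\<close>

lemma Pol_boundary_curl:
  assumes p: "p \<in> Pol (Suc n)" and g: "(\<lambda>x. x * p x + w x) \<in> Pol (Suc n)"
  shows "(\<lambda>x. (real n + 2) * p x + deriv w x) \<in> Pol n"
proof -
  let ?g = "\<lambda>x. x * p x + w x"
  have "(w has_field_derivative deriv ?g x - (p x + x * deriv p x)) (at x)" for x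
  proof -
    have "((\<lambda>x. ?g x - x * p x) has_field_derivative deriv ?g x - (p x + x * deriv p x)) (at x)"
      by (rule derivative_eq_intros Pol_DERIV[OF p] Pol_DERIV[OF g] refl)+ simp
    then show ?thesis
      by simp
  qed
  then have "deriv w = (\<lambda>x. deriv ?g x - (p x + x * deriv p x))"
    by (auto intro: DERIV_imp_deriv)
  then have "(\<lambda>x. (real n + 2) * p x + deriv w x) = (\<lambda>x. ((real n + 1) * p x - x * deriv p x) + deriv ?g x)"
    by (simp add: algebra_simps)
  also have "\<dots> \<in> Pol n"
    by (intro Pol_add Pol_euler p Pol_deriv g)
  finally show ?thesis .
qed

text \<open>The half-open interval is the range of s = 1 / (1 + z) for z \<ge> 0.\<close>

lemma Pol_eq_zero_on_half_open:
  assumes "f \<in> Pol n" "\<And>x. 0 < x \<Longrightarrow> x \<le> 1 \<Longrightarrow> f x = 0"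
  shows "f = (\<lambda>x. 0)"
proof -
  obtain p where p: "f = poly p"
    using assms by (metis PolE)
  have "{0<..1} \<subseteq> {x. poly p x = 0}"
    using assms(2) p by auto
  then have "infinite {x. poly p x = 0}"
    using infinite_Ioc[of "0::real" 1] infinite_super by (metis zero_less_one)
  then have "p = 0"
    using poly_roots_finite by blast
  then show ?thesis
    using p by auto
qed

lemma power_sum_coeffs_zero:
  fixes c :: "nat \<Rightarrow> real"
  assumes "\<And>s. 0 < s \<Longrightarrow> s \<le> 1 \<Longrightarrow> (\<Sum>i\<le>n. c i * s ^ i) = 0" "i \<le> n"
  shows "c i = 0"
proof -
  have "(\<lambda>s. \<Sum>i\<le>n. c i * s ^ i) \<in> Pol n"
    by (intro Pol_sum Pol_monom) auto
  then have "(\<lambda>s. \<Sum>i\<le>n. c i * s ^ i) = (\<lambda>s. 0)"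
    by (rule Pol_eq_zero_on_half_open) (use assms(1) in auto)
  then show ?thesis
    using polyfun_eq_0[of c n] assms(2) by (auto dest: fun_cong)
qed

section \<open>Polynomials in two variables with separate degree bounds\<close>

lemma finite_deg_le [simp]: "finite (deg_le n)"
  by (rule finite_subset[of _ "{..nat n}"]) (auto simp: deg_le_def)

lemma Q2_zero [simp]: "(\<lambda>x y. 0) \<in> Q2 l m"
  unfolding Q2_def by (auto intro!: exI[of _ "\<lambda>a b. 0"])

lemma Q2_add:
  assumes "f \<in> Q2 l m" "g \<in> Q2 l m"
  shows "(\<lambda>x y. f x y + g x y) \<in> Q2 l m"
proof -
  obtain c d where "f = (\<lambda>x y. \<Sum>a\<in>deg_le l. \<Sum>b\<in>deg_le m. c a b * x ^ a * y ^ b)"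
    "g = (\<lambda>x y. \<Sum>a\<in>deg_le l. \<Sum>b\<in>deg_le m. d a b * x ^ a * y ^ b)"
    using assms unfolding Q2_def by blast
  then show ?thesis
    unfolding Q2_def
    by (auto intro!: exI[of _ "\<lambda>a b. c a b + d a b"] simp: fun_eq_iff algebra_simps sum.distrib)
qed

lemma Q2_cmult:
  assumes "f \<in> Q2 l m"
  shows "(\<lambda>x y. c * f x y) \<in> Q2 l m"
proof -
  obtain d where "f = (\<lambda>x y. \<Sum>a\<in>deg_le l. \<Sum>b\<in>deg_le m. d a b * x ^ a * y ^ b)"
    using assms unfolding Q2_def by blast
  then show ?thesis
    unfolding Q2_def
    by (auto intro!: exI[of _ "\<lambda>a b. c * d a b"] simp: fun_eq_iff algebra_simps sum_distrib_left)
qed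

lemma Q2_divc: "f \<in> Q2 l m \<Longrightarrow> (\<lambda>x y. f x y / c) \<in> Q2 l m"
  using Q2_cmult[of f l m "1 / c"] by simp

lemma Q2_uminus: "f \<in> Q2 l m \<Longrightarrow> (\<lambda>x y. - f x y) \<in> Q2 l m"
  using Q2_cmult[of f l m "-1"] by simp

lemma Q2_diff: "f \<in> Q2 l m \<Longrightarrow> g \<in> Q2 l m \<Longrightarrow> (\<lambda>x y. f x y - g x y) \<in> Q2 l m"
  using Q2_add[of f l m "\<lambda>x y. - g x y"] Q2_uminus by auto

lemma Q2_sum:
  assumes "\<And>i. i \<in> I \<Longrightarrow> f i \<in> Q2 l m"
  shows "(\<lambda>x y. \<Sum>i\<in>I. f i x y) \<in> Q2 l m"
  using assms by (induction I rule: infinite_finite_induct) (auto intro: Q2_add)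

lemma Q2_monom:
  assumes "int a \<le> l" "int b \<le> m"
  shows "(\<lambda>x y. c * x ^ a * y ^ b) \<in> Q2 l m"
proof -
  let ?d = "\<lambda>a' b'. if a' = a then if b' = b then c else 0 else 0"
  have ab: "a \<in> deg_le l" "b \<in> deg_le m"
    using assms by (auto simp: deg_le_def)
  have "(\<Sum>b'\<in>deg_le m. ?d a' b' * x ^ a' * y ^ b') = (if a' = a then c * x ^ a * y ^ b else 0)"
    for a' and x y :: real
    using ab(2) by (auto simp: if_distrib[of "\<lambda>u. u * _"] cong: if_cong)
  then have "(\<Sum>a'\<in>deg_le l. \<Sum>b'\<in>deg_le m. ?d a' b' * x ^ a' * y ^ b') = c * x ^ a * y ^ b" for x y
    using ab(1) by simp
  then show ?thesis
    unfolding Q2_def by (auto intro!: exI[of _ ?d])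
qed

lemma Q2_induct [consumes 1, case_names zero add monom]:
  assumes "f \<in> Q2 l m"
    and zero: "P (\<lambda>x y. 0)"
    and add: "\<And>f g. f \<in> Q2 l m \<Longrightarrow> g \<in> Q2 l m \<Longrightarrow> P f \<Longrightarrow> P g \<Longrightarrow> P (\<lambda>x y. f x y + g x y)"
    and monom: "\<And>c a b. int a \<le> l \<Longrightarrow> int b \<le> m \<Longrightarrow> P (\<lambda>x y. c * x ^ a * y ^ b)"
  shows "P f"
proof -
  obtain d where f: "f = (\<lambda>x y. \<Sum>a\<in>deg_le l. \<Sum>b\<in>deg_le m. d a b * x ^ a * y ^ b)"
    using assms unfolding Q2_def by blast
  \<comment> \<open>Membership is carried along because \<open>add\<close> asks for it. The
    statement is applied to the outer sum and again to the inner one.\<close>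
  have sumP: "(\<lambda>x y. \<Sum>i\<in>I. g i x y) \<in> Q2 l m \<and> P (\<lambda>x y. \<Sum>i\<in>I. g i x y)"
    if "finite I" "\<And>i. i \<in> I \<Longrightarrow> g i \<in> Q2 l m \<and> P (g i)" for I and g :: "nat \<Rightarrow> real \<Rightarrow> real \<Rightarrow> real"
    using that
  proof (induction I rule: finite_induct)
    case (insert i I)
    then show ?case
      using add[of "g i" "\<lambda>x y. \<Sum>i\<in>I. g i x y"] Q2_add[of "g i" l m "\<lambda>x y. \<Sum>i\<in>I. g i x y"] by auto
  qed (auto simp: zero)
  show ?thesis
    unfolding f by (intro sumP[THEN conjunct2] sumP finite_deg_le conjI Q2_monom monom)
      (auto simp: deg_le_def)
qed

lemma Q2_mono:
  assumes "f \<in> Q2 l m" "l \<le> l'" "m \<le> m'"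
  shows "f \<in> Q2 l' m'"
  using assms(1) by (induction rule: Q2_induct) (use assms in \<open>auto intro: Q2_add Q2_monom\<close>)

lemma Q2_mult_x:
  assumes "f \<in> Q2 l m"
  shows "(\<lambda>x y. x * f x y) \<in> Q2 (l + 1) m"
  using assms
proof (induction rule: Q2_induct)
  case (monom c a b)
  then show ?case
    using Q2_monom[of "Suc a" "l + 1" b m c] by (simp add: algebra_simps)
qed (auto simp: algebra_simps intro: Q2_add)

lemma Q2_mult_y:
  assumes "f \<in> Q2 l m"
  shows "(\<lambda>x y. y * f x y) \<in> Q2 l (m + 1)"
  using assms
proof (induction rule: Q2_induct)
  case (monom c a b)
  then show ?case
    using Q2_monom[of a l "Suc b" "m + 1" c] by (simp add: algebra_simps)
qed (auto simp: algebra_simps intro: Q2_add)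

lemma Q2_DERIV_x:
  assumes "f \<in> Q2 l m"
  shows "((\<lambda>x. f x y) has_field_derivative dx f x y) (at x)"
proof -
  have "(\<lambda>x. f x y) field_differentiable at x"
    using assms by (induction rule: Q2_induct) (auto intro!: derivative_intros)
  then show ?thesis
    unfolding dx_def by (simp add: DERIV_deriv_iff_field_differentiable)
qed

lemma Q2_DERIV_y:
  assumes "f \<in> Q2 l m"
  shows "((\<lambda>y. f x y) has_field_derivative dy f x y) (at y)"
proof -
  have "(\<lambda>y. f x y) field_differentiable at y"
    using assms by (induction rule: Q2_induct) (auto intro!: derivative_intros)
  then show ?thesis
    unfolding dy_def by (simp add: DERIV_deriv_iff_field_differentiable)
qed

lemma dx_eqI: "(\<And>x y. ((\<lambda>x. f x y) has_field_derivative g x y) (at x)) \<Longrightarrow> dx f = g"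
  unfolding dx_def fun_eq_iff by (auto intro: DERIV_imp_deriv)

lemma dy_eqI: "(\<And>x y. ((\<lambda>y. f x y) has_field_derivative g x y) (at y)) \<Longrightarrow> dy f = g"
  unfolding dy_def fun_eq_iff by (auto intro: DERIV_imp_deriv)

lemma dx_zero [simp]: "dx (\<lambda>x y. c) = (\<lambda>x y. 0)"
  and dy_zero [simp]: "dy (\<lambda>x y. c) = (\<lambda>x y. 0)"
  by (auto intro!: dx_eqI dy_eqI)

lemma dx_add:
  "f \<in> Q2 l m \<Longrightarrow> g \<in> Q2 l' m' \<Longrightarrow> dx (\<lambda>x y. f x y + g x y) = (\<lambda>x y. dx f x y + dx g x y)"
  by (auto intro!: dx_eqI derivative_intros Q2_DERIV_x)

lemma dy_add:
  "f \<in> Q2 l m \<Longrightarrow> g \<in> Q2 l' m' \<Longrightarrow> dy (\<lambda>x y. f x y + g x y) = (\<lambda>x y. dy f x y + dy g x y)"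
  by (auto intro!: dy_eqI derivative_intros Q2_DERIV_y)

lemma dx_cmult: "f \<in> Q2 l m \<Longrightarrow> dx (\<lambda>x y. c * f x y) = (\<lambda>x y. c * dx f x y)"
  by (auto intro!: dx_eqI derivative_eq_intros Q2_DERIV_x)

lemma dy_cmult: "f \<in> Q2 l m \<Longrightarrow> dy (\<lambda>x y. c * f x y) = (\<lambda>x y. c * dy f x y)"
  by (auto intro!: dy_eqI derivative_eq_intros Q2_DERIV_y)

lemma dx_uminus: "f \<in> Q2 l m \<Longrightarrow> dx (\<lambda>x y. - f x y) = (\<lambda>x y. - dx f x y)"
  by (auto intro!: dx_eqI derivative_intros Q2_DERIV_x)

lemma dy_uminus: "f \<in> Q2 l m \<Longrightarrow> dy (\<lambda>x y. - f x y) = (\<lambda>x y. - dy f x y)"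
  by (auto intro!: dy_eqI derivative_intros Q2_DERIV_y)

lemma dx_monom: "dx (\<lambda>x y. c * x ^ a * y ^ b) = (\<lambda>x y. c * real a * x ^ (a - 1) * y ^ b)"
  by (auto intro!: dx_eqI derivative_eq_intros)

lemma dy_monom: "dy (\<lambda>x y. c * x ^ a * y ^ b) = (\<lambda>x y. c * real b * x ^ a * y ^ (b - 1))"
  by (auto intro!: dy_eqI derivative_eq_intros)

lemma Q2_dx:
  assumes "f \<in> Q2 l m"
  shows "dx f \<in> Q2 (l - 1) m"
  using assms
proof (induction rule: Q2_induct)
  case (monom c a b)
  then show ?case
    using Q2_monom[of "a - 1" "l - 1" b m "c * real a"] unfolding dx_monom by (cases a) auto
qed (auto simp: dx_add intro: Q2_add)

lemma Q2_dy:
  assumes "f \<in> Q2 l m"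
  shows "dy f \<in> Q2 l (m - 1)"
  using assms
proof (induction rule: Q2_induct)
  case (monom c a b)
  then show ?case
    using Q2_monom[of a l "b - 1" "m - 1" "c * real b"] unfolding dy_monom by (cases b) auto
qed (auto simp: dy_add intro: Q2_add)

lemma dx_dy_commute:
  assumes "f \<in> Q2 l m"
  shows "dx (dy f) = dy (dx f)"
  using assms
proof (induction rule: Q2_induct)
  case (add f g)
  then show ?case
    by (simp add: dx_add[OF add(1,2)] dy_add[OF add(1,2)] dx_add[OF Q2_dy Q2_dy] dy_add[OF Q2_dx Q2_dx])
next
  case (monom c a b)
  then show ?case
    using dx_monom[of "c * real b" a "b - 1"] dy_monom[of "c * real a" "a - 1" b]
    unfolding dx_monom dy_monom by (simp add: algebra_simps)
qed auto

lemma Q2_has_derivative: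
  assumes "f \<in> Q2 l m" "(X has_derivative X') (at p within S)" "(Y has_derivative Y') (at p within S)"
  shows "((\<lambda>q. f (X q) (Y q)) has_derivative
    (\<lambda>h. dx f (X p) (Y p) * X' h + dy f (X p) (Y p) * Y' h)) (at p within S)"
  using assms(1)
proof (induction rule: Q2_induct)
  case (add f g)
  show ?case
    using has_derivative_add[OF add(3,4)]
    by (simp add: dx_add[OF add(1,2)] dy_add[OF add(1,2)] algebra_simps)
next
  case (monom c a b)
  show ?case
    unfolding dx_monom dy_monom
    by (auto intro!: derivative_eq_intros assms(2,3) simp: algebra_simps)
qed auto

lemma Q2_Pol_x:
  assumes "f \<in> Q2 (int n) m"
  shows "(\<lambda>x. f x e) \<in> Pol n"
  using assms
proof (induction rule: Q2_induct)
  case (monom c a b)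
  then show ?case
    using Pol_monom[of a n "c * e ^ b"] by (simp add: algebra_simps)
qed (auto intro: Pol_add)

lemma Q2_Pol_y:
  assumes "f \<in> Q2 l (int n)"
  shows "(\<lambda>y. f e y) \<in> Pol n"
  using assms
proof (induction rule: Q2_induct)
  case (monom c a b)
  then show ?case
    using Pol_monom[of b n "c * e ^ a"] by (simp add: algebra_simps)
qed (auto intro: Pol_add)

lemma Q2_zero_on_square:
  assumes "f \<in> Q2 l m" "\<And>x y. \<lbrakk>0 \<le> x; x \<le> 1; 0 \<le> y; y \<le> 1\<rbrakk> \<Longrightarrow> f x y = 0"
  shows "f = (\<lambda>x y. 0)"
proof -
  \<comment> \<open>\<open>Pol\<close> takes natural bounds; replacing a negative bound by 0 only
    enlarges the space.\<close>
  have f: "f \<in> Q2 (int (nat l)) (int (nat m))"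
    using assms(1) by (rule Q2_mono) auto
  have "f x y = 0" if "0 \<le> y" "y \<le> 1" for x y
    using Pol_eq_on_interval[OF Q2_Pol_x[OF f, of y] Pol_zero[of 0]] assms(2) that by (auto dest: fun_cong)
  then have "f x y = 0" for x y
    using Pol_eq_on_interval[OF Q2_Pol_y[OF f, of x] Pol_zero[of 0]] by (auto dest: fun_cong)
  then show ?thesis
    by auto
qed

lemma Q2_Pol_edge_x: "f \<in> Q2 l m \<Longrightarrow> (\<lambda>x. f x e) \<in> Pol (nat l)"
  by (rule Q2_Pol_x[where m = m]) (auto elim: Q2_mono)

lemma Q2_Pol_edge_y: "f \<in> Q2 l m \<Longrightarrow> (\<lambda>y. f e y) \<in> Pol (nat m)"
  by (rule Q2_Pol_y[where l = l]) (auto elim: Q2_mono)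

section \<open>Differentiation on the pyramid\<close>

lemma vec3_eq_iff: "(u::real^3) = v \<longleftrightarrow> u$1 = v$1 \<and> u$2 = v$2 \<and> u$3 = v$3"
  by (simp add: vec_eq_iff forall_3)

text \<open>The inverse of \<open>phi\<close>; on the pyramid its denominators vanish only at the
  apex.\<close>

definition psi :: "real^3 \<Rightarrow> real^3" where
  "psi p = vector [p$1 / (1 - p$3), p$2 / (1 - p$3), p$3 / (1 - p$3)]"

lemma Omega_height_less_1: "p \<in> Omega \<Longrightarrow> p$3 < 1"
  unfolding Omega_def pyramid_def apex_def by (auto simp: vec3_eq_iff)

lemma phi_in_Omega:
  assumes "p \<in> Omega_inf"
  shows "phi p \<in> Omega"
proof -
  have z: "p$3 \<ge> 0"
    using assms by (simp add: Omega_inf_def)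
  then have "1 - p$3 / (1 + p$3) = 1 / (1 + p$3)"
    by (simp add: field_simps)
  then show ?thesis
    using assms z unfolding Omega_def pyramid_def apex_def phi_def Omega_inf_def
    by (auto simp: vec3_eq_iff divide_right_mono)
qed

lemma psi_in_Omega_inf: "p \<in> Omega \<Longrightarrow> psi p \<in> Omega_inf"
  using Omega_height_less_1[of p]
  unfolding Omega_def pyramid_def psi_def Omega_inf_def
  by (auto simp: field_simps)

lemma one_plus_psi_3: "p$3 < 1 \<Longrightarrow> 1 + psi p $ 3 = 1 / (1 - p$3)"
  unfolding psi_def by (simp add: field_simps)

lemma phi_psi: "p \<in> Omega \<Longrightarrow> phi (psi p) = p"
  using Omega_height_less_1[of p] unfolding phi_def
  by (simp add: vec3_eq_iff one_plus_psi_3) (simp add: psi_def)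

lemma phi_image: "phi ` Omega_inf = Omega"
  using phi_in_Omega psi_in_Omega_inf phi_psi by force

lemma has_derivative_vector3:
  fixes f1 f2 f3 :: "real^3 \<Rightarrow> real"
  assumes "(f1 has_derivative D1) F" "(f2 has_derivative D2) F" "(f3 has_derivative D3) F"
  shows "((\<lambda>p. vector [f1 p, f2 p, f3 p] :: real^3) has_derivative (\<lambda>h. vector [D1 h, D2 h, D3 h])) F"
proof -
  have v: "(vector [a, b, c] :: real^3) = a *\<^sub>R axis 1 1 + b *\<^sub>R axis 2 1 + c *\<^sub>R axis 3 1" for a b c
    by (simp add: vec3_eq_iff axis_def)
  show ?thesis
    unfolding v by (intro derivative_intros assms)
qed

lemma phi_has_derivative:
  assumes "p$3 > -1"
  shows "(phi has_derivative (\<lambda>h. vector [h$1 / (1 + p$3) - p$1 / (1 + p$3)^2 * h$3,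
     h$2 / (1 + p$3) - p$2 / (1 + p$3)^2 * h$3, h$3 / (1 + p$3)^2])) (at p within S)"
  unfolding phi_def[abs_def]
  by (intro has_derivative_vector3; (rule derivative_eq_intros refl bounded_linear_imp_has_derivative bounded_linear_vec_nth | use assms in \<open>force simp: field_simps power2_eq_square\<close>)+)

text \<open>From each point of a product of nondegenerate intervals, a short step along any axis, in
  at least one of its two directions, stays inside.\<close>

lemma has_derivative_unique_Omega_inf:
  fixes f :: "real^3 \<Rightarrow> 'a::real_normed_vector"
  assumes "p \<in> Omega_inf"
    and "(f has_derivative D) (at p within Omega_inf)" "(f has_derivative D') (at p within Omega_inf)"
  shows "D = D'"
proof (rule frechet_derivative_unique_within[OF assms(2,3)])
  fix i :: "real^3" and e :: real
  assume i: "i \<in> Basis" and e: "0 < e"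
  then obtain j where j: "i = axis j 1"
    by (auto simp: Basis_vec_def)
  let ?d = "min (e / 2) (1 / 2)"
  have d: "0 < ?d" "?d < e" "?d \<le> 1 / 2"
    using e by auto
  show "\<exists>d. 0 < \<bar>d\<bar> \<and> \<bar>d\<bar> < e \<and> p + d *\<^sub>R i \<in> Omega_inf"
  \<comment> \<open>Step upwards from the lower half and in the unbounded z-direction, downwards
    otherwise; length at most 1/2 keeps the coordinate in its interval.\<close>
  proof (cases "p$j \<le> 1 / 2 \<or> j = 3")
    case True
    then have "p + ?d *\<^sub>R i \<in> Omega_inf"
      using d assms(1) exhaust_3[of j] unfolding j Omega_inf_def by (auto simp: axis_def)
    then show ?thesis
      using d by (intro exI[of _ ?d]) auto
  next
    case False
    then have "p + (- ?d) *\<^sub>R i \<in> Omega_inf"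
      using d assms(1) exhaust_3[of j] unfolding j Omega_inf_def by (auto simp: axis_def)
    then show ?thesis
      using d by (intro exI[of _ "- ?d"]) auto
  qed
qed

text \<open>
  The edges of the pyramid need not point along the coordinate axes, so uniqueness of the
  derivative is transported from the infinite pyramid.
\<close>

lemma has_derivative_unique_Omega:
  fixes f :: "real^3 \<Rightarrow> 'a::real_normed_vector"
  assumes "p \<in> Omega" "(f has_derivative D) (at p within Omega)" "(f has_derivative D') (at p within Omega)"
  shows "D = D'"
proof -
  define q where "q = psi p"
  define t where "t = 1 + q$3"
  define A :: "real^3 \<Rightarrow> real^3" where
    "A h = vector [h$1 / t - q$1 / t^2 * h$3, h$2 / t - q$2 / t^2 * h$3, h$3 / t^2]" for h
  \<comment> \<open>A right inverse of the derivative \<open>A\<close> of \<open>phi\<close> at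
    \<open>q\<close>, so that agreement of \<open>D\<close> and \<open>D'\<close> on the range of
    \<open>A\<close> is agreement everywhere.\<close>
  define B :: "real^3 \<Rightarrow> real^3" where
    "B h = vector [t * h$1 + t * q$1 * h$3, t * h$2 + t * q$2 * h$3, t^2 * h$3]" for h
  have q: "q \<in> Omega_inf" "phi q = p"
    using assms(1) by (auto simp: q_def psi_in_Omega_inf phi_psi)
  then have t: "t > 0"
    by (auto simp: Omega_inf_def t_def)
  then have A: "(phi has_derivative A) (at q within Omega_inf)"
    unfolding A_def[abs_def] t_def by (intro phi_has_derivative) auto
  \<comment> \<open>The chain rule needs a derivative of \<open>f\<close> within the image of
    \<open>Omega_inf\<close>, and this image is all of \<open>Omega\<close>.\<close>
  have "((\<lambda>x. f (phi x)) has_derivative (\<lambda>h. E (A h))) (at q within Omega_inf)"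
    if "(f has_derivative E) (at p within Omega)" for E
    by (rule has_derivative_in_compose[OF A]) (use that q in \<open>simp add: phi_image\<close>)
  then have "(\<lambda>h. D (A h)) = (\<lambda>h. D' (A h))"
    using has_derivative_unique_Omega_inf[OF q(1)] assms(2,3) by blast
  moreover have "A (B h) = h" for h
  proof -
    have "(t * a + t * b * c) / t - b / t^2 * (t^2 * c) = a" for a b c :: real
      using t by (simp add: field_simps)
    then show ?thesis
      using t by (simp add: vec3_eq_iff A_def B_def)
  qed
  ultimately have "D h = D' h" for h
    by (metis (no_types))
  then show ?thesis ..
qed

lemma frechet_derivative_Omega:
  assumes "p \<in> Omega" "(f has_derivative D) (at p within Omega)"
  shows "frechet_derivative f (at p within Omega) = D"
  using has_derivative_unique_Omega[OF assms(1)] assms(2) frechet_derivative_works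
  by (metis differentiableI)

lemma has_derivative_restrict:
  assumes "(f has_derivative D) (at p within S)" "p \<in> S"
  shows "(restrict f S has_derivative D) (at p within S)"
  using assms(1) by (rule has_derivative_transform[rotated -1]) (use assms(2) in auto)

lemma grad_on_Omega:
  assumes "\<And>p. p \<in> Omega \<Longrightarrow> (f has_derivative (\<lambda>h. g1 p * h$1 + g2 p * h$2 + g3 p * h$3)) (at p within Omega)"
  shows "grad_on Omega (restrict f Omega) = restrict (\<lambda>p. vector [g1 p, g2 p, g3 p]) Omega"
proof -
  have "frechet_derivative (restrict f Omega) (at p within Omega) =
      (\<lambda>h. g1 p * h$1 + g2 p * h$2 + g3 p * h$3)" if "p \<in> Omega" for p
    by (intro frechet_derivative_Omega has_derivative_restrict assms that)
  then show ?thesis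
    unfolding grad_on_def by (auto simp: restrict_def fun_eq_iff vec3_eq_iff axis_def)
qed

lemma jacobian_Omega:
  fixes f1 f2 f3 :: "real^3 \<Rightarrow> real"
  assumes "p \<in> Omega"
    and "(f1 has_derivative (\<lambda>h. a1 * h$1 + a2 * h$2 + a3 * h$3)) (at p within Omega)"
    and "(f2 has_derivative (\<lambda>h. b1 * h$1 + b2 * h$2 + b3 * h$3)) (at p within Omega)"
    and "(f3 has_derivative (\<lambda>h. c1 * h$1 + c2 * h$2 + c3 * h$3)) (at p within Omega)"
  shows "jacobian (restrict (\<lambda>p. vector [f1 p, f2 p, f3 p]) Omega :: real^3 \<Rightarrow> real^3) (at p within Omega) =
    vector [vector [a1, a2, a3], vector [b1, b2, b3], vector [c1, c2, c3]]"
proof -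
  have "frechet_derivative (restrict (\<lambda>p. vector [f1 p, f2 p, f3 p]) Omega :: real^3 \<Rightarrow> real^3) (at p within Omega)
    = (\<lambda>h. vector [a1 * h$1 + a2 * h$2 + a3 * h$3, b1 * h$1 + b2 * h$2 + b3 * h$3, c1 * h$1 + c2 * h$2 + c3 * h$3])"
    by (intro frechet_derivative_Omega has_derivative_restrict has_derivative_vector3 assms)
  then show ?thesis
    unfolding jacobian_def matrix_def by (simp add: vec_eq_iff forall_3 axis_def)
qed

text \<open>This is s^n f(x, y) in the coordinates of the finite pyramid, where s = 1 - \<zeta>: the
  typical function homogeneous of degree n about the apex.\<close>

definition lift :: "nat \<Rightarrow> (real \<Rightarrow> real \<Rightarrow> real) \<Rightarrow> real^3 \<Rightarrow> real" where
  "lift n f p = f (p$1 / (1 - p$3)) (p$2 / (1 - p$3)) * (1 - p$3) ^ n"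

text \<open>Here dx = (d\<xi> + x d\<zeta>) / s - with the analogous formula for dy - and ds = -
  d\<zeta>, so each partial derivative is again such a function divided by s. The quotient is not
  absorbed into the exponent, which would become -1 for \<open>n = 0\<close>.\<close>

lemma lift_has_derivative:
  assumes f: "f \<in> Q2 l m" and p: "p \<in> Omega"
  shows "(lift n f has_derivative (\<lambda>h.
    lift n (dx f) p / (1 - p$3) * h$1 + lift n (dy f) p / (1 - p$3) * h$2 +
    lift n (\<lambda>x y. x * dx f x y + y * dy f x y - real n * f x y) p / (1 - p$3) * h$3)) (at p within S)"
proof -
  let ?s = "1 - p$3" and ?x = "p$1 / (1 - p$3)" and ?y = "p$2 / (1 - p$3)"
  have s: "?s \<noteq> 0"
    using Omega_height_less_1[OF p] by auto
  have n: "((\<lambda>p::real^3. p$i) has_derivative (\<lambda>h. h$i)) (at p within S)" for i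
    by (intro bounded_linear_imp_has_derivative bounded_linear_vec_nth)
  have X: "((\<lambda>p::real^3. p$i / (1 - p$3)) has_derivative (\<lambda>h. h$i / ?s + p$i / ?s / ?s * h$3)) (at p within S)" for i
    by (rule derivative_eq_intros n refl | use s in \<open>simp add: field_simps\<close>)+
  have P: "((\<lambda>p::real^3. (1 - p$3) ^ n) has_derivative (\<lambda>h. - (real n * (?s ^ n / ?s) * h$3))) (at p within S)"
  proof -
    have "((\<lambda>p::real^3. 1 - p$3) has_derivative (\<lambda>h. 0 - h$3)) (at p within S)"
      by (intro derivative_intros n)
    then show ?thesis
      by (rule has_derivative_eq_rhs[OF has_derivative_power]) (use s in \<open>cases n; simp add: fun_eq_iff ac_simps\<close>)
  qed
  show ?thesis
    unfolding lift_def[abs_def]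
    by (rule has_derivative_eq_rhs[OF has_derivative_mult[OF Q2_has_derivative[OF f X X] P]])
      (simp add: fun_eq_iff algebra_simps add_divide_distrib diff_divide_distrib)
qed

section \<open>Graded fields and their derivatives\<close>

definition gsum :: "nat \<Rightarrow> (nat \<Rightarrow> real \<Rightarrow> real \<Rightarrow> real) \<Rightarrow> real^3 \<Rightarrow> real" where
  "gsum k f p = (\<Sum>i\<le>k. lift i (f i) p)"

lemma gsum_diff: "gsum k f p - gsum k g p = gsum k (\<lambda>i x y. f i x y - g i x y) p"
  unfolding gsum_def lift_def by (simp add: sum_subtractf algebra_simps)

lemma gsum_add: "gsum k f p + gsum k g p = gsum k (\<lambda>i x y. f i x y + g i x y) p"
  unfolding gsum_def lift_def by (simp add: sum.distrib algebra_simps)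

lemma gsum_has_derivative:
  assumes f: "\<And>i. f i \<in> Q2 l m" and p: "p \<in> Omega"
  shows "(gsum k f has_derivative (\<lambda>h.
    gsum k (\<lambda>i. dx (f i)) p / (1 - p$3) * h$1 + gsum k (\<lambda>i. dy (f i)) p / (1 - p$3) * h$2 +
    gsum k (\<lambda>i x y. x * dx (f i) x y + y * dy (f i) x y - real i * f i x y) p / (1 - p$3) * h$3))
    (at p within S)"
  unfolding gsum_def[abs_def]
  by (rule has_derivative_eq_rhs[OF has_derivative_sum[OF lift_has_derivative[OF f p]]])
    (simp add: sum.distrib sum_distrib_right sum_divide_distrib)

text \<open>Division by s lowers each exponent by one. The term of index 0 must vanish since it
  would leave s^(-1); the zero at \<open>Suc k\<close> lets the shifted sum run up to
  \<open>k\<close> again.\<close>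

lemma gsum_shift:
  assumes "p \<in> Omega" "f 0 = (\<lambda>x y. 0)" "f (Suc k) = (\<lambda>x y. 0)"
  shows "gsum k f p / (1 - p$3) = gsum k (\<lambda>i. f (Suc i)) p"
proof -
  have s: "1 - p$3 \<noteq> 0"
    using Omega_height_less_1[OF assms(1)] by auto
  have "gsum k f p = (\<Sum>i\<le>Suc k. lift i (f i) p)"
    unfolding gsum_def using assms(3) by (simp add: lift_def)
  also have "\<dots> = (\<Sum>i\<le>k. lift (Suc i) (f (Suc i)) p)"
    unfolding sum.atMost_Suc_shift using assms(2) by (simp add: lift_def)
  also have "\<dots> = (1 - p$3) * gsum k (\<lambda>i. f (Suc i)) p"
    unfolding gsum_def lift_def sum_distrib_left by (intro sum.cong) auto
  finally show ?thesis
    using s by simp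
qed

text \<open>The components of a curl are such differences. Each quotient separately may contain
  s^(-1); the terms of index 0 cancel only in the difference, because forms of lowest degree are
  closed.\<close>

lemma gsum_diff_shift:
  assumes "p \<in> Omega" "\<And>x y. f 0 x y = g 0 x y" "\<And>x y. f (Suc k) x y = g (Suc k) x y"
    and "\<And>i x y. f (Suc i) x y - g (Suc i) x y = h i x y"
  shows "gsum k f p / (1 - p$3) - gsum k g p / (1 - p$3) = gsum k h p"
proof -
  have "gsum k (\<lambda>i x y. f i x y - g i x y) p / (1 - p$3) = gsum k (\<lambda>i x y. f (Suc i) x y - g (Suc i) x y) p"
    by (rule gsum_shift) (use assms in auto)
  then show ?thesis
    using assms(4) by (simp add: gsum_diff flip: diff_divide_distrib)
qed

lemma lift_at_phi:
  assumes "p \<in> Omega_inf"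
  shows "lift n f (phi p) = f (p$1) (p$2) * (1 / (1 + p$3)) ^ n"
proof -
  have z: "p$3 \<ge> 0"
    using assms by (simp add: Omega_inf_def)
  then have "1 - phi p $ 3 = 1 / (1 + p$3)"
    by (simp add: phi_def field_simps)
  then show ?thesis
    using z by (simp add: lift_def) (simp add: phi_def)
qed

lemma gsum_eq_zero_coeffs:
  assumes f: "\<And>i. f i \<in> Q2 l m" and z: "\<And>p. p \<in> Omega \<Longrightarrow> gsum k f p = 0" and "i \<le> k"
  shows "f i = (\<lambda>x y. 0)"
proof (rule Q2_zero_on_square[OF f])
  fix x y :: real
  assume xy: "0 \<le> x" "x \<le> 1" "0 \<le> y" "y \<le> 1"
  have "(\<Sum>i\<le>k. f i x y * s ^ i) = 0" if s: "0 < s" "s \<le> 1" for s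
  proof -
    \<comment> \<open>The point above (x, y) at the height where 1 / (1 + z) = s.\<close>
    define p :: "real^3" where "p = vector [x, y, 1 / s - 1]"
    have p: "p \<in> Omega_inf"
      using xy s by (simp add: p_def Omega_inf_def)
    have "gsum k f (phi p) = 0"
      using z phi_in_Omega[OF p] by blast
    then show ?thesis
      using s unfolding gsum_def lift_at_phi[OF p] by (simp add: p_def)
  qed
  then show "f i x y = 0"
    using power_sum_coeffs_zero[where n = k and c = "\<lambda>i. f i x y"] \<open>i \<le> k\<close> by blast
qed

text \<open>
  The families give the coefficients of \<open>dx\<close>, \<open>dy\<close>, \<open>dz\<close> (for 1-forms) and of
  \<open>dy dz\<close>, \<open>dz dx\<close>, \<open>dx dy\<close> (for 2-forms) on the infinite pyramid. The mixed terms arise from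
  \<open>dx = d\<xi> / s + x d\<zeta> / s\<close>, \<open>dy = d\<eta> / s + y d\<zeta> / s\<close>, \<open>dz = d\<zeta> / s\<^sup>2\<close>. The families are
  shifted: index \<open>i\<close> holds the part of degree \<open>i\<close>, \<open>i + 1\<close>, \<open>i + 2\<close>, \<open>i + 3\<close> of a 0-, 1-, 2-,
  3-form, so that all exponents of \<open>s\<close> on the finite pyramid are equal to the index. Both scalar
  spaces use \<open>rep0\<close>.
\<close>

definition rep0 :: "nat \<Rightarrow> (nat \<Rightarrow> real \<Rightarrow> real \<Rightarrow> real) \<Rightarrow> real^3 \<Rightarrow> real" where
  "rep0 k f = restrict (gsum k f) Omega"

definition rep1 :: "nat \<Rightarrow> (nat \<Rightarrow> real \<Rightarrow> real \<Rightarrow> real) \<Rightarrow> (nat \<Rightarrow> real \<Rightarrow> real \<Rightarrow> real) \<Rightarrow>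
    (nat \<Rightarrow> real \<Rightarrow> real \<Rightarrow> real) \<Rightarrow> real^3 \<Rightarrow> real^3" where
  "rep1 k p q w = restrict (\<lambda>P. vector [gsum k p P, gsum k q P,
     gsum k (\<lambda>i x y. x * p i x y + y * q i x y + w i x y) P]) Omega"

definition rep2 :: "nat \<Rightarrow> (nat \<Rightarrow> real \<Rightarrow> real \<Rightarrow> real) \<Rightarrow> (nat \<Rightarrow> real \<Rightarrow> real \<Rightarrow> real) \<Rightarrow>
    (nat \<Rightarrow> real \<Rightarrow> real \<Rightarrow> real) \<Rightarrow> real^3 \<Rightarrow> real^3" where
  "rep2 k a b c = restrict (\<lambda>P. vector [gsum k (\<lambda>i x y. a i x y - x * c i x y) P,
     gsum k (\<lambda>i x y. b i x y - y * c i x y) P, gsum k c P]) Omega"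

text \<open>Degree 0 comes from \<open>z^k / (1 + z)^k\<close> alone, hence the constant
  \<open>f 0\<close>. On a face, total degree at most k in the numerator means degree at most j for
  the coefficient of s^j.\<close>

definition cochain0 :: "nat \<Rightarrow> (nat \<Rightarrow> real \<Rightarrow> real \<Rightarrow> real) \<Rightarrow> bool" where
  "cochain0 k f \<longleftrightarrow> (\<exists>c. f 0 = (\<lambda>x y. c)) \<and> (\<forall>j. f j \<in> Q2 (int k) (int k)) \<and>
     (\<forall>j>k. f j = (\<lambda>x y. 0)) \<and>
     (\<forall>j. \<forall>e\<in>{0, 1}. (\<lambda>x. f j x e) \<in> Pol j \<and> (\<lambda>y. f j e y) \<in> Pol j)"

text \<open>
  The component of lowest degree is the derivative of \<open>s r\<close>, where \<open>r = - w 0\<close>. On a face, the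
  coefficients of \<open>x^i dx\<close> and \<open>x^(i+1) dz\<close> come from \<open>P_tilde\<close> and cancel in \<open>x p + w\<close>.
\<close>

definition cochain1 :: "nat \<Rightarrow> (nat \<Rightarrow> real \<Rightarrow> real \<Rightarrow> real) \<Rightarrow> (nat \<Rightarrow> real \<Rightarrow> real \<Rightarrow> real) \<Rightarrow>
    (nat \<Rightarrow> real \<Rightarrow> real \<Rightarrow> real) \<Rightarrow> bool" where
  "cochain1 k p q w \<longleftrightarrow>
     (\<forall>i. p i \<in> Q2 (int k - 1) (int k) \<and> q i \<in> Q2 (int k) (int k - 1) \<and> w i \<in> Q2 (int k) (int k)) \<and>
     (\<forall>i>k. p i = (\<lambda>x y. 0) \<and> q i = (\<lambda>x y. 0)) \<and> (\<forall>i\<ge>k. w i = (\<lambda>x y. 0)) \<and>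
     p 0 = (\<lambda>x y. - dx (w 0) x y) \<and> q 0 = (\<lambda>x y. - dy (w 0) x y) \<and>
     (\<forall>i. \<forall>e\<in>{0, 1}. (\<lambda>x. p i x e) \<in> Pol i \<and> (\<lambda>x. x * p i x e + w i x e) \<in> Pol i \<and>
        (\<lambda>y. q i e y) \<in> Pol i \<and> (\<lambda>y. y * q i e y + w i e y) \<in> Pol i)"

text \<open>The special summands of the space of 2-forms enter as \<open>a 0 = 2 t\<close>, \<open>b 0 = 2 s\<close>.\<close>

definition cochain2 :: "nat \<Rightarrow> (nat \<Rightarrow> real \<Rightarrow> real \<Rightarrow> real) \<Rightarrow> (nat \<Rightarrow> real \<Rightarrow> real \<Rightarrow> real) \<Rightarrow>
    (nat \<Rightarrow> real \<Rightarrow> real \<Rightarrow> real) \<Rightarrow> bool" where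
  "cochain2 k a b c \<longleftrightarrow>
     (\<forall>i. a i \<in> Q2 (int k) (int k - 1) \<and> b i \<in> Q2 (int k - 1) (int k) \<and> c i \<in> Q2 (int k - 1) (int k - 1)) \<and>
     (\<forall>i\<ge>k. a i = (\<lambda>x y. 0) \<and> b i = (\<lambda>x y. 0)) \<and> (\<forall>i>k. c i = (\<lambda>x y. 0)) \<and>
     c 0 = (\<lambda>x y. (dx (a 0) x y + dy (b 0) x y) / 2) \<and>
     (\<forall>i. \<forall>e\<in>{0, 1}. (\<lambda>y. a i e y) \<in> Pol i \<and> (\<lambda>x. b i x e) \<in> Pol i)"

definition cochain3 :: "nat \<Rightarrow> (nat \<Rightarrow> real \<Rightarrow> real \<Rightarrow> real) \<Rightarrow> bool" where
  "cochain3 k f \<longleftrightarrow> (\<forall>i. f i \<in> Q2 (int k - 1) (int k - 1)) \<and> (\<forall>i\<ge>k. f i = (\<lambda>x y. 0))"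

text \<open>The exterior derivative on the infinite pyramid. As ds = - s^2 dz, differentiating s^j
  in z gives the factor -j; the part of a 1-form with index i + 1 has degree j = i + 2, which is
  index i among 2-forms.\<close>

definition curl1 where
  "curl1 q w = (\<lambda>i x y. (real i + 2) * q (Suc i) x y + dy (w (Suc i)) x y)"

definition curl2 where
  "curl2 p w = (\<lambda>i x y. - ((real i + 2) * p (Suc i) x y + dx (w (Suc i)) x y))"

definition curl3 where
  "curl3 p q = (\<lambda>i x y. dx (q (Suc i)) x y - dy (p (Suc i)) x y)"

text \<open>The index i + 1 of \<open>c\<close> has degree i + 3. At index -1 the same formula would
  be the relation that \<open>cochain2\<close> imposes on \<open>c 0\<close>.\<close>

definition dvg where
  "dvg a b c = (\<lambda>i x y. dx (a (Suc i)) x y + dy (b (Suc i)) x y - (real i + 3) * c (Suc i) x y)"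

lemma cochain1_Q2:
  assumes "cochain1 k p q w"
  shows "p i \<in> Q2 (int k - 1) (int k)" "q i \<in> Q2 (int k) (int k - 1)" "w i \<in> Q2 (int k) (int k)"
    and "(\<lambda>x y. x * p i x y + y * q i x y + w i x y) \<in> Q2 (int k) (int k)"
proof -
  show *: "p i \<in> Q2 (int k - 1) (int k)" "q i \<in> Q2 (int k) (int k - 1)" "w i \<in> Q2 (int k) (int k)"
    using assms unfolding cochain1_def by auto
  show "(\<lambda>x y. x * p i x y + y * q i x y + w i x y) \<in> Q2 (int k) (int k)"
    using Q2_mult_x[OF *(1)] Q2_mult_y[OF *(2)] *(3) by (intro Q2_add) auto
qed

lemma cochain2_Q2:
  assumes "cochain2 k a b c"
  shows "a i \<in> Q2 (int k) (int k - 1)" "b i \<in> Q2 (int k - 1) (int k)" "c i \<in> Q2 (int k - 1) (int k - 1)"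
    and "(\<lambda>x y. a i x y - x * c i x y) \<in> Q2 (int k) (int k)"
    and "(\<lambda>x y. b i x y - y * c i x y) \<in> Q2 (int k) (int k)"
proof -
  show *: "a i \<in> Q2 (int k) (int k - 1)" "b i \<in> Q2 (int k - 1) (int k)" "c i \<in> Q2 (int k - 1) (int k - 1)"
    using assms unfolding cochain2_def by auto
  show "(\<lambda>x y. a i x y - x * c i x y) \<in> Q2 (int k) (int k)"
    "(\<lambda>x y. b i x y - y * c i x y) \<in> Q2 (int k) (int k)"
    using Q2_mult_x[OF *(3)] Q2_mult_y[OF *(3)] *(1,2)
    by (auto intro!: Q2_diff elim: Q2_mono)
qed

text \<open>Since \<open>f 0\<close> is constant, all three derivative families vanish at index 0,
  and division by s merely shifts them.\<close>

lemma grad_rep0: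
  assumes f: "cochain0 k f"
  shows "grad_on Omega (rep0 k f) =
    rep1 k (\<lambda>i. dx (f (Suc i))) (\<lambda>i. dy (f (Suc i))) (\<lambda>i x y. - ((real i + 1) * f (Suc i) x y))"
proof -
  have Q: "f i \<in> Q2 (int k) (int k)" for i
    using f by (auto simp: cochain0_def)
  obtain c where c: "f 0 = (\<lambda>x y. c)"
    using f by (auto simp: cochain0_def)
  have z: "f (Suc k) = (\<lambda>x y. 0)"
    using f by (auto simp: cochain0_def)
  show ?thesis
    unfolding rep0_def rep1_def
    by (subst grad_on_Omega, erule gsum_has_derivative[OF Q], rule restrict_ext)
      (simp add: gsum_shift c z algebra_simps)
qed

lemma curl_rep1:
  assumes C: "cochain1 k p q w"
  shows "curl_on Omega (rep1 k p q w) = rep2 k (curl1 q w) (curl2 p w) (curl3 p q)"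
proof -
  let ?F = "\<lambda>i x y. x * p i x y + y * q i x y + w i x y"
  note Q = cochain1_Q2[OF C]
  have z: "p (Suc k) = (\<lambda>x y. 0)" "q (Suc k) = (\<lambda>x y. 0)" "w (Suc k) = (\<lambda>x y. 0)"
    and p0: "p 0 = (\<lambda>x y. - dx (w 0) x y)" and q0: "q 0 = (\<lambda>x y. - dy (w 0) x y)"
    using C by (auto simp: cochain1_def)
  have dxF: "dx (?F i) = (\<lambda>x y. p i x y + x * dx (p i) x y + y * dx (q i) x y + dx (w i) x y)" for i
    by (rule dx_eqI) (auto intro!: derivative_eq_intros Q2_DERIV_x Q)
  have dyF: "dy (?F i) = (\<lambda>x y. x * dy (p i) x y + q i x y + y * dy (q i) x y + dy (w i) x y)" for i
    by (rule dy_eqI) (auto intro!: derivative_eq_intros Q2_DERIV_y Q)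
  \<comment> \<open>A form of lowest degree is the derivative of a multiple of s, so its derivative
    has no dx dy-part.\<close>
  have c0: "dx (q 0) = dy (p 0)"
    unfolding p0 q0 dx_uminus[OF Q2_dy[OF Q(3)]] dy_uminus[OF Q2_dx[OF Q(3)]] dx_dy_commute[OF Q(3)] ..
  have "curl_on Omega (rep1 k p q w) P = rep2 k (curl1 q w) (curl2 p w) (curl3 p q) P" if P: "P \<in> Omega" for P
  proof -
    let ?s = "1 - P$3"
    \<comment> \<open>The product rule in the third component contributes \<open>q i\<close>, which
      together with \<open>real i * q i\<close> gives the factor i + 1, the degree. The terms with
      \<open>dy (q i)\<close> cancel; those with the factor x form the \<open>curl3\<close>
      part.\<close>
    have 1: "gsum k (\<lambda>i. dy (?F i)) P / ?s - gsum k (\<lambda>i x y. x * dx (q i) x y + y * dy (q i) x y - real i * q i x y) P / ?s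
      = gsum k (\<lambda>i x y. curl1 q w i x y - x * curl3 p q i x y) P"
      unfolding dyF by (rule gsum_diff_shift[OF P]) (simp_all add: c0 z fun_cong[OF fun_cong[OF q0]] curl1_def curl3_def algebra_simps)
    have 2: "gsum k (\<lambda>i x y. x * dx (p i) x y + y * dy (p i) x y - real i * p i x y) P / ?s - gsum k (\<lambda>i. dx (?F i)) P / ?s
      = gsum k (\<lambda>i x y. curl2 p w i x y - y * curl3 p q i x y) P"
      unfolding dxF by (rule gsum_diff_shift[OF P]) (simp_all add: c0 z fun_cong[OF fun_cong[OF p0]] curl2_def curl3_def algebra_simps)
    have 3: "gsum k (\<lambda>i. dx (q i)) P / ?s - gsum k (\<lambda>i. dy (p i)) P / ?s = gsum k (curl3 p q) P"
      by (rule gsum_diff_shift[OF P]) (simp_all add: c0 z curl3_def)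
    show ?thesis
      using P 1 2 3 unfolding curl_on_def rep1_def rep2_def
      by (simp add: jacobian_Omega[OF P gsum_has_derivative[OF Q(1) P] gsum_has_derivative[OF Q(2) P]
            gsum_has_derivative[OF Q(4) P]] Let_def)
  qed
  then show ?thesis
    unfolding curl_on_def rep2_def by (auto simp: restrict_def fun_eq_iff)
qed

lemma div_rep2:
  assumes C: "cochain2 k a b c"
  shows "div_on Omega (rep2 k a b c) = rep0 k (dvg a b c)"
proof -
  note Q = cochain2_Q2[OF C]
  have z: "a (Suc k) = (\<lambda>x y. 0)" "b (Suc k) = (\<lambda>x y. 0)" "c (Suc k) = (\<lambda>x y. 0)"
    and c0: "c 0 = (\<lambda>x y. (dx (a 0) x y + dy (b 0) x y) / 2)"
    using C by (auto simp: cochain2_def)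
  have da: "dx (\<lambda>x y. a i x y - x * c i x y) = (\<lambda>x y. dx (a i) x y - (c i x y + x * dx (c i) x y))" for i
    by (rule dx_eqI) (auto intro!: derivative_eq_intros Q2_DERIV_x Q)
  have db: "dy (\<lambda>x y. b i x y - y * c i x y) = (\<lambda>x y. dy (b i) x y - (c i x y + y * dy (c i) x y))" for i
    by (rule dy_eqI) (auto intro!: derivative_eq_intros Q2_DERIV_y Q)
  let ?A = "\<lambda>i x y. a i x y - x * c i x y" and ?B = "\<lambda>i x y. b i x y - y * c i x y"
  let ?C = "\<lambda>i x y. x * dx (c i) x y + y * dy (c i) x y - real i * c i x y"
  have "div_on Omega (rep2 k a b c) P = rep0 k (dvg a b c) P" if P: "P \<in> Omega" for P
  proof -
    let ?s = "1 - P$3"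
    have "gsum k (\<lambda>i. dx (?A i)) P / ?s + gsum k (\<lambda>i. dy (?B i)) P / ?s + gsum k ?C P / ?s =
      gsum k (\<lambda>i x y. dx (?A i) x y + dy (?B i) x y + ?C i x y) P / ?s"
      by (simp add: gsum_add flip: add_divide_distrib)
    also have "\<dots> = gsum k (dvg a b c) P"
    proof -
      have "(\<lambda>i x y. dx (?A (Suc i)) x y + dy (?B (Suc i)) x y + ?C (Suc i) x y) = dvg a b c"
        by (simp add: dvg_def da db algebra_simps)
      \<comment> \<open>The product rule in the first two components contributes \<open>c i\<close>
        twice with negative sign; at index 0 this is what the relation for \<open>c 0\<close>
        balances.\<close>
      moreover have "(\<lambda>x y. dx (?A 0) x y + dy (?B 0) x y + ?C 0 x y) = (\<lambda>x y. 0)"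
        unfolding da db by (auto simp: c0 fun_eq_iff)
      ultimately show ?thesis
        using gsum_shift[OF P, of "\<lambda>i x y. dx (?A i) x y + dy (?B i) x y + ?C i x y" k] by (simp add: z)
    qed
    finally show ?thesis
      using P unfolding div_on_def rep2_def rep0_def
      by (simp add: jacobian_Omega[OF P gsum_has_derivative[OF Q(4) P] gsum_has_derivative[OF Q(5) P]
            gsum_has_derivative[OF Q(3) P]] trace_def sum_3)
  qed
  then show ?thesis
    unfolding div_on_def rep0_def by (auto simp: restrict_def fun_eq_iff)
qed

section \<open>Exactness for coefficient families\<close>

text \<open>On a face the dz-part may keep degree i + 1. Its sum with x times the tangential
  derivative drops to degree i by Euler's identity, in accordance with the coupled face condition on
  1-forms.\<close>

lemma cochain1_grad:
  assumes f: "cochain0 k f"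
  shows "cochain1 k (\<lambda>i. dx (f (Suc i))) (\<lambda>i. dy (f (Suc i))) (\<lambda>i x y. - ((real i + 1) * f (Suc i) x y))"
proof -
  have Q: "f i \<in> Q2 (int k) (int k)" for i
    using f by (auto simp: cochain0_def)
  have z: "f j = (\<lambda>x y. 0)" if "k < j" for j
    using f that by (auto simp: cochain0_def)
  have edge: "(\<lambda>x. deriv g x) \<in> Pol i \<and> (\<lambda>x. x * deriv g x + - ((real i + 1) * g x)) \<in> Pol i"
    if "g \<in> Pol (Suc i)" for g i
    using Pol_deriv[OF that] Pol_uminus[OF Pol_euler[OF that]] by (simp add: algebra_simps)
  have E: "(\<lambda>x. f (Suc i) x e) \<in> Pol (Suc i)" "(\<lambda>y. f (Suc i) e y) \<in> Pol (Suc i)" if "e \<in> {0, 1}" for e i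
    using f that unfolding cochain0_def by blast+
  show ?thesis
    unfolding cochain1_def
  proof (intro conjI allI impI ballI)
    fix i and e :: real assume e: "e \<in> {0, 1}"
    show "(\<lambda>x. dx (f (Suc i)) x e) \<in> Pol i"
      "(\<lambda>x. x * dx (f (Suc i)) x e + - ((real i + 1) * f (Suc i) x e)) \<in> Pol i"
      using edge[OF E(1)[OF e]] unfolding dx_def by auto
    show "(\<lambda>y. dy (f (Suc i)) e y) \<in> Pol i"
      "(\<lambda>y. y * dy (f (Suc i)) e y + - ((real i + 1) * f (Suc i) e y)) \<in> Pol i"
      using edge[OF E(2)[OF e]] unfolding dy_def by auto
  qed (auto simp: z Q2_dx Q2_dy Q2_uminus Q2_cmult Q dx_uminus[OF Q] dy_uminus[OF Q])
qed

text \<open>The condition on \<open>curl3\<close> at index 0 is d d = 0 in degree 2, the mixed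
  derivatives of \<open>w\<close> cancelling. The face conditions concern the normal component,
  which is computed from tangential data on the face.\<close>

lemma cochain2_curl:
  assumes C: "cochain1 k p q w"
  shows "cochain2 k (curl1 q w) (curl2 p w) (curl3 p q)"
proof -
  note Q = cochain1_Q2[OF C]
  have z: "p (Suc i) = (\<lambda>x y. 0)" "q (Suc i) = (\<lambda>x y. 0)" "w (Suc i) = (\<lambda>x y. 0)" if "i \<ge> k" for i
    using C that by (auto simp: cochain1_def)
  have E: "(\<lambda>x. p i x e) \<in> Pol i" "(\<lambda>x. x * p i x e + w i x e) \<in> Pol i"
      "(\<lambda>y. q i e y) \<in> Pol i" "(\<lambda>y. y * q i e y + w i e y) \<in> Pol i" if "e \<in> {0, 1}" for e i
    using C that unfolding cochain1_def by blast+
  have dxq: "dx (q i) \<in> Q2 (int k - 1) (int k - 1)" and dyp: "dy (p i) \<in> Q2 (int k - 1) (int k - 1)" for i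
    using Q2_dx[OF Q(2)] Q2_dy[OF Q(1)] by auto
  show ?thesis
    unfolding cochain2_def
  proof (intro conjI allI impI ballI)
    fix i
    show "curl1 q w i \<in> Q2 (int k) (int k - 1)" "curl2 p w i \<in> Q2 (int k - 1) (int k)"
      unfolding curl1_def curl2_def
      by (intro Q2_add Q2_uminus Q2_cmult Q Q2_dx[OF Q(3)] Q2_dy[OF Q(3)])+
    show "curl3 p q i \<in> Q2 (int k - 1) (int k - 1)"
      unfolding curl3_def by (intro Q2_diff dxq dyp)
  next
    have c1: "dx (curl1 q w 0) = (\<lambda>x y. 2 * dx (q (Suc 0)) x y + dx (dy (w (Suc 0))) x y)"
      unfolding curl1_def
      by (rule dx_eqI) (auto intro!: derivative_eq_intros Q2_DERIV_x[OF Q(2)] Q2_DERIV_x[OF Q2_dy[OF Q(3)]])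
    have c2: "dy (curl2 p w 0) = (\<lambda>x y. - (2 * dy (p (Suc 0)) x y + dy (dx (w (Suc 0))) x y))"
      unfolding curl2_def
      by (rule dy_eqI) (auto intro!: derivative_eq_intros Q2_DERIV_y[OF Q(1)] Q2_DERIV_y[OF Q2_dx[OF Q(3)]])
    show "curl3 p q 0 = (\<lambda>x y. (dx (curl1 q w 0) x y + dy (curl2 p w 0) x y) / 2)"
      unfolding c1 c2 by (simp add: curl3_def dx_dy_commute[OF Q(3)] fun_eq_iff field_simps)
  next
    fix i and e :: real assume e: "e \<in> {0, 1}"
    show "(\<lambda>y. curl1 q w i e y) \<in> Pol i"
      using Pol_boundary_curl[OF E(3,4)[OF e]] unfolding curl1_def dy_def .
    show "(\<lambda>x. curl2 p w i x e) \<in> Pol i"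
      using Pol_uminus[OF Pol_boundary_curl[OF E(1,2)[OF e]]] unfolding curl2_def dx_def .
  qed (auto simp: z curl1_def curl2_def curl3_def)
qed

lemma cochain3_dvg:
  assumes C: "cochain2 k a b c"
  shows "cochain3 k (dvg a b c)"
proof -
  note Q = cochain2_Q2[OF C]
  have z: "a (Suc i) = (\<lambda>x y. 0)" "b (Suc i) = (\<lambda>x y. 0)" "c (Suc i) = (\<lambda>x y. 0)" if "i \<ge> k" for i
    using C that by (auto simp: cochain2_def)
  show ?thesis
    unfolding cochain3_def dvg_def
    using z by (auto intro!: Q2_add Q2_diff Q2_cmult Q Q2_dx[OF Q(1)] Q2_dy[OF Q(2)])
qed

lemma rep0_eq_zero:
  assumes "rep0 k f = restrict (\<lambda>p. 0) Omega" "\<And>i. f i \<in> Q2 l m" "i \<le> k"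
  shows "f i = (\<lambda>x y. 0)"
proof (rule gsum_eq_zero_coeffs[where f = f and k = k])
  show "gsum k f p = 0" if "p \<in> Omega" for p
    using fun_cong[OF assms(1), of p] that by (simp add: rep0_def)
qed (use assms in auto)

text \<open>Faithfulness of the representation, by which a vanishing field becomes equations between
  coefficients. The third component yields \<open>w\<close> only after \<open>p\<close> and
  \<open>q\<close> are known to vanish.\<close>

lemma rep1_eq_zero:
  assumes R: "rep1 k p q w = restrict (\<lambda>p. 0) Omega" and C: "cochain1 k p q w"
  shows "p i = (\<lambda>x y. 0)" "q i = (\<lambda>x y. 0)" "w i = (\<lambda>x y. 0)"
proof -
  let ?F = "\<lambda>i x y. x * p i x y + y * q i x y + w i x y"
  note Q = cochain1_Q2[OF C]
  have g: "gsum k p P = 0" "gsum k q P = 0" "gsum k ?F P = 0" if "P \<in> Omega" for P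
    using fun_cong[OF R, of P] that by (simp_all add: rep1_def vec3_eq_iff)
  have *: "p i = (\<lambda>x y. 0)" "q i = (\<lambda>x y. 0)" "?F i = (\<lambda>x y. 0)" if "i \<le> k" for i
    using gsum_eq_zero_coeffs[OF Q(1) g(1) that] gsum_eq_zero_coeffs[OF Q(2) g(2) that]
      gsum_eq_zero_coeffs[OF Q(4) g(3) that] by blast+
  have z: "p i = (\<lambda>x y. 0) \<and> q i = (\<lambda>x y. 0) \<and> w i = (\<lambda>x y. 0)" if "\<not> i \<le> k"
    using C that by (auto simp: cochain1_def)
  show "p i = (\<lambda>x y. 0)" "q i = (\<lambda>x y. 0)" 
    using *(1,2)[of i] z by blast+
  show "w i = (\<lambda>x y. 0)" 
    using *(3)[of i] *(1,2)[of i] z by (cases "i \<le> k") auto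
qed

lemma rep2_eq_zero:
  assumes R: "rep2 k a b c = restrict (\<lambda>p. 0) Omega" and C: "cochain2 k a b c"
  shows "a i = (\<lambda>x y. 0)" "b i = (\<lambda>x y. 0)" "c i = (\<lambda>x y. 0)"
proof -
  let ?A = "\<lambda>i x y. a i x y - x * c i x y" and ?B = "\<lambda>i x y. b i x y - y * c i x y"
  note Q = cochain2_Q2[OF C]
  have g: "gsum k ?A P = 0" "gsum k ?B P = 0" "gsum k c P = 0" if "P \<in> Omega" for P
    using fun_cong[OF R, of P] that by (simp_all add: rep2_def vec3_eq_iff)
  have *: "?A i = (\<lambda>x y. 0)" "?B i = (\<lambda>x y. 0)" "c i = (\<lambda>x y. 0)" if "i \<le> k" for i
    using gsum_eq_zero_coeffs[OF Q(4) g(1) that] gsum_eq_zero_coeffs[OF Q(5) g(2) that]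
      gsum_eq_zero_coeffs[OF Q(3) g(3) that] by blast+
  have z: "a i = (\<lambda>x y. 0) \<and> b i = (\<lambda>x y. 0) \<and> c i = (\<lambda>x y. 0)" if "\<not> i \<le> k"
    using C that by (auto simp: cochain2_def)
  show "c i = (\<lambda>x y. 0)"
    using *(3)[of i] z by blast
  show "a i = (\<lambda>x y. 0)" "b i = (\<lambda>x y. 0)"
    using *[of i] z by (cases "i \<le> k"; auto)+
qed

text \<open>The dz-coefficients alone decide: up to sign they are the \<open>f (Suc i)\<close> times
  their nonzero degree.\<close>

lemma grad_kernel:
  assumes f: "cochain0 k f" and g: "grad_on Omega (rep0 k f) = restrict (\<lambda>p. 0) Omega"
  shows "\<exists>c. rep0 k f = const_field c"
proof -
  obtain c where c: "f 0 = (\<lambda>x y. c)"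
    using f by (auto simp: cochain0_def)
  have "(\<lambda>x y. - ((real i + 1) * f (Suc i) x y)) = (\<lambda>x y. 0)" for i
    using rep1_eq_zero(3)[OF _ cochain1_grad[OF f]] g unfolding grad_rep0[OF f] by blast
  then have "f (Suc i) x y = 0" for i x y
    by (simp add: fun_eq_iff)
  then have z: "f i x y = 0" if "i \<noteq> 0" for i x y
    using that by (cases i) auto
  have "gsum k f p = c" for p
    unfolding gsum_def using z
    by (subst sum.remove[of _ 0]) (auto simp: lift_def c)
  then show ?thesis
    unfolding rep0_def const_field_def by (intro exI[of _ c] restrict_ext) simp
qed

lemma const_field_rep0:
  obtains f where "cochain0 k f" "const_field c = rep0 k f"
proof
  let ?f = "\<lambda>i (x::real) (y::real). if i = 0 then c else (0::real)"
  have "(\<lambda>x y. c) \<in> Q2 (int k) (int k)" and "(\<lambda>x. c) \<in> Pol 0"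
    using Q2_monom[of 0 "int k" 0 "int k" c] Pol_monom[of 0 0 c] by auto
  then show "cochain0 k ?f"
    by (auto simp: cochain0_def)
  have "gsum k ?f p = c" for p
    unfolding gsum_def by (subst sum.remove[of _ 0]) (auto simp: lift_def)
  then show "const_field c = rep0 k ?f"
    by (auto simp: rep0_def const_field_def)
qed

lemma grad_const_field: "grad_on Omega (const_field c) = restrict (\<lambda>p. 0) Omega"
proof -
  have "grad_on Omega (restrict (\<lambda>p. c) Omega) = restrict (\<lambda>p. vector [0, 0, 0]) Omega"
    by (rule grad_on_Omega) simp
  then show ?thesis
    by (simp add: const_field_def restrict_def fun_eq_iff vec3_eq_iff)
qed

lemma rep_zero:
  "rep0 k (\<lambda>i x y. 0) = restrict (\<lambda>p. 0) Omega"
  "rep2 k (\<lambda>i x y. 0) (\<lambda>i x y. 0) (\<lambda>i x y. 0) = restrict (\<lambda>p. 0) Omega"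
  by (auto simp: rep0_def rep2_def gsum_def lift_def restrict_def fun_eq_iff vec3_eq_iff)

lemma curl_grad:
  assumes f: "cochain0 k f"
  shows "curl_on Omega (grad_on Omega (rep0 k f)) = restrict (\<lambda>p. 0) Omega"
proof -
  have Q: "f i \<in> Q2 (int k) (int k)" for i
    using f by (auto simp: cochain0_def)
  let ?w = "\<lambda>i x y. - ((real i + 1) * f (Suc i) x y)"
  have dw: "dx (?w i) = (\<lambda>x y. - ((real i + 1) * dx (f (Suc i)) x y))"
    "dy (?w i) = (\<lambda>x y. - ((real i + 1) * dy (f (Suc i)) x y))" for i
    by (auto intro!: dx_eqI dy_eqI derivative_eq_intros Q2_DERIV_x Q2_DERIV_y Q)
  have "curl1 (\<lambda>i. dy (f (Suc i))) ?w = (\<lambda>i x y. 0)"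
    unfolding curl1_def dw by (simp add: algebra_simps)
  moreover have "curl2 (\<lambda>i. dx (f (Suc i))) ?w = (\<lambda>i x y. 0)"
    unfolding curl2_def dw by (simp add: algebra_simps)
  moreover have "curl3 (\<lambda>i. dx (f (Suc i))) (\<lambda>i. dy (f (Suc i))) = (\<lambda>i x y. 0)"
    unfolding curl3_def dx_dy_commute[OF Q] by simp
  ultimately show ?thesis
    unfolding grad_rep0[OF f] curl_rep1[OF cochain1_grad[OF f]] by (simp only: rep_zero)
qed

lemma div_curl:
  assumes C: "cochain1 k p q w"
  shows "div_on Omega (curl_on Omega (rep1 k p q w)) = restrict (\<lambda>p. 0) Omega"
proof -
  note Q = cochain1_Q2[OF C]
  have "dx (curl1 q w i) = (\<lambda>x y. (real i + 2) * dx (q (Suc i)) x y + dx (dy (w (Suc i))) x y)" for i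
    unfolding curl1_def
    by (rule dx_eqI) (auto intro!: derivative_eq_intros Q2_DERIV_x[OF Q(2)] Q2_DERIV_x[OF Q2_dy[OF Q(3)]])
  moreover have "dy (curl2 p w i) = (\<lambda>x y. - ((real i + 2) * dy (p (Suc i)) x y + dy (dx (w (Suc i))) x y))" for i
    unfolding curl2_def
    by (rule dy_eqI) (auto intro!: derivative_eq_intros Q2_DERIV_y[OF Q(1)] Q2_DERIV_y[OF Q2_dx[OF Q(3)]])
  ultimately show ?thesis
    unfolding curl_rep1[OF C] div_rep2[OF cochain2_curl[OF C]] rep_zero(1)[symmetric, of k]
    by (simp add: dvg_def curl3_def dx_dy_commute[OF Q(3)] algebra_simps)
qed

lemma curl_kernel:
  assumes C: "cochain1 k p q w" and z: "curl_on Omega (rep1 k p q w) = restrict (\<lambda>p. 0) Omega"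
  obtains f where "cochain0 k f" "rep1 k p q w = grad_on Omega (rep0 k f)"
proof
  note Q = cochain1_Q2[OF C]
  \<comment> \<open>Index \<open>i\<close> of a 1-form has degree i + 1, hence the divisor. The
    constant of integration is chosen to be 0.\<close>
  let ?f = "\<lambda>i. case i of 0 \<Rightarrow> (\<lambda>x y. 0) | Suc i \<Rightarrow> (\<lambda>x y. - (w i x y / (real i + 1)))"
  \<comment> \<open>One relation covers all indices: at 0 it is the condition in
    \<open>cochain1\<close>, above 0 the vanishing of the curl.\<close>
  have p: "- ((real i + 1) * p i x y) = dx (w i) x y" for i x y
  proof (cases i)
    case 0
    then show ?thesis
      using C by (auto simp: cochain1_def)
  next
    case (Suc j)
    have "curl2 p w j = (\<lambda>x y. 0)"
      using rep2_eq_zero[OF _ cochain2_curl[OF C]] z unfolding curl_rep1[OF C] by blast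
    then have "curl2 p w j x y = 0"
      by simp
    then have "(real j + 2) * p (Suc j) x y + dx (w (Suc j)) x y = 0"
      unfolding curl2_def by linarith
    moreover have "real (Suc j) + 1 = real j + 2"
      by simp
    ultimately show ?thesis
      unfolding Suc by (simp only: eq_neg_iff_add_eq_0 neg_eq_iff_add_eq_0)
  qed
  have q: "- ((real i + 1) * q i x y) = dy (w i) x y" for i x y
  proof (cases i)
    case 0
    then show ?thesis
      using C by (auto simp: cochain1_def)
  next
    case (Suc j)
    have "curl1 q w j = (\<lambda>x y. 0)"
      using rep2_eq_zero[OF _ cochain2_curl[OF C]] z unfolding curl_rep1[OF C] by blast
    then have "(real j + 2) * q (Suc j) x y + dy (w (Suc j)) x y = 0"
      by (simp add: curl1_def fun_eq_iff)
    moreover have "real (Suc j) + 1 = real j + 2"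
      by simp
    ultimately show ?thesis
      unfolding Suc by (simp only: eq_neg_iff_add_eq_0 neg_eq_iff_add_eq_0)
  qed
  \<comment> \<open>Subtracting x p from x p + w costs one degree. This is exactly the bound for a
    0-form, where the coefficient gets index i + 1.\<close>
  have E: "(\<lambda>x. w i x e) \<in> Pol (Suc i)" "(\<lambda>y. w i e y) \<in> Pol (Suc i)" if "e \<in> {0, 1}" for e i
  proof -
    have "(\<lambda>x. p i x e) \<in> Pol i" "(\<lambda>x. x * p i x e + w i x e) \<in> Pol i"
      "(\<lambda>y. q i e y) \<in> Pol i" "(\<lambda>y. y * q i e y + w i e y) \<in> Pol i"
      using C that unfolding cochain1_def by blast+
    note this(2,4)[THEN Pol_mono[rotated], of "Suc i"] this(1,3)[THEN Pol_mult_x]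
    then show "(\<lambda>x. w i x e) \<in> Pol (Suc i)" "(\<lambda>y. w i e y) \<in> Pol (Suc i)"
      using Pol_diff[of "\<lambda>x. x * p i x e + w i x e" "Suc i" "\<lambda>x. x * p i x e"]
        Pol_diff[of "\<lambda>y. y * q i e y + w i e y" "Suc i" "\<lambda>y. y * q i e y"] by auto
  qed
  show f: "cochain0 k ?f"
    unfolding cochain0_def
  proof (intro conjI allI impI ballI)
    show "\<exists>c. ?f 0 = (\<lambda>x y. c)"
      by auto
  next
    fix j show "?f j \<in> Q2 (int k) (int k)"
      by (auto split: nat.split intro!: Q2_uminus Q2_divc Q)
  next
    fix j assume "k < j"
    then show "?f j = (\<lambda>x y. 0)"
      using C by (auto simp: cochain1_def split: nat.split)
  next
    fix j and e :: real assume "e \<in> {0, 1}"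
    then show "(\<lambda>x. ?f j x e) \<in> Pol j" "(\<lambda>y. ?f j e y) \<in> Pol j"
      by (auto split: nat.split intro!: Pol_uminus Pol_divc E)
  qed
  have n: "real i + 1 \<noteq> 0" for i
    using of_nat_0_le_iff[of i] by linarith
  have "dx (?f (Suc i)) = p i" for i
  proof -
    have "dx (?f (Suc i)) = (\<lambda>x y. - (dx (w i) x y / (real i + 1)))"
      by (intro dx_eqI) (auto intro!: derivative_eq_intros Q2_DERIV_x[OF Q(3)])
    then show ?thesis
      using n[of i] by (simp flip: p)
  qed
  moreover have "dy (?f (Suc i)) = q i" for i
  proof -
    have "dy (?f (Suc i)) = (\<lambda>x y. - (dy (w i) x y / (real i + 1)))"
      by (intro dy_eqI) (auto intro!: derivative_eq_intros Q2_DERIV_y[OF Q(3)])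
    then show ?thesis
      using n[of i] by (simp flip: q)
  qed
  moreover have "- ((real i + 1) * ?f (Suc i) x y) = w i x y" for i x y
    by (simp add: field_simps)
  ultimately show "rep1 k p q w = grad_on Omega (rep0 k ?f)"
    unfolding grad_rep0[OF f] by presburger
qed

lemma div_kernel:
  assumes C: "cochain2 k a b c" and z: "div_on Omega (rep2 k a b c) = restrict (\<lambda>p. 0) Omega"
  obtains p q w where "cochain1 k p q w" "rep2 k a b c = curl_on Omega (rep1 k p q w)"
proof
  note Q = cochain2_Q2[OF C]
  \<comment> \<open>Up to powers of s, the dz-part of the 2-form is dz \<and> (b dx - a dy), so the
    primitive is (a dy - b dx) / (i + 2), without dz-part. Its degree i + 2 is index i + 1 among
    1-forms.\<close>
  let ?p = "\<lambda>i. case i of 0 \<Rightarrow> (\<lambda>x y. 0) | Suc i \<Rightarrow> (\<lambda>x y. - (b i x y / (real i + 2)))"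
  let ?q = "\<lambda>i. case i of 0 \<Rightarrow> (\<lambda>x y. 0) | Suc i \<Rightarrow> (\<lambda>x y. a i x y / (real i + 2))"
  let ?w = "\<lambda>(i::nat) (x::real) (y::real). 0 :: real"
  \<comment> \<open>Closedness expresses \<open>c\<close> through \<open>a\<close> and
    \<open>b\<close>, so a primitive that reproduces these two reproduces \<open>c\<close>. Index 0
    is the condition in \<open>cochain2\<close>.\<close>
  have c: "(real i + 2) * c i x y = dx (a i) x y + dy (b i) x y" for i x y
  proof (cases i)
    case 0
    then show ?thesis
      using C by (auto simp: cochain2_def)
  next
    case (Suc j)
    have zd: "rep0 k (dvg a b c) = restrict (\<lambda>p. 0) Omega"
      using z unfolding div_rep2[OF C] .
    have "dvg a b c j = (\<lambda>x y. 0)"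
    proof (cases "j \<le> k")
      case True
      show ?thesis
        by (rule rep0_eq_zero[OF zd _ True]) (use cochain3_dvg[OF C] in \<open>auto simp: cochain3_def\<close>)
    next
      case False
      then show ?thesis
        using cochain3_dvg[OF C] by (auto simp: cochain3_def)
    qed
    then have "dx (a i) x y + dy (b i) x y - (real j + 3) * c i x y = 0"
      by (simp add: dvg_def Suc fun_eq_iff)
    moreover have "real i + 2 = real j + 3"
      by (simp add: Suc)
    ultimately show ?thesis
      by simp
  qed
  have E: "(\<lambda>x. b i x e) \<in> Pol i" "(\<lambda>y. a i e y) \<in> Pol i" if "e \<in> {0, 1}" for e i
    using C that unfolding cochain2_def by blast+
  show C1: "cochain1 k ?p ?q ?w"
    unfolding cochain1_def
  proof (intro conjI allI impI ballI)
    fix i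
    show "?p i \<in> Q2 (int k - 1) (int k)" "?q i \<in> Q2 (int k) (int k - 1)"
      by (auto split: nat.split intro!: Q2_uminus Q2_divc Q)
  next
    fix i assume "k < i"
    then show "?p i = (\<lambda>x y. 0)" "?q i = (\<lambda>x y. 0)"
      using C by (auto simp: cochain2_def split: nat.split)
  next
    fix i and e :: real assume e: "e \<in> {0, 1}"
    \<comment> \<open>The index shift gains one degree, which pays for the factor x in the second
      face condition.\<close>
    have P: "(\<lambda>x. ?p i x e) \<in> Pol (i - 1)" "(\<lambda>y. ?q i e y) \<in> Pol (i - 1)"
      by (cases i; use E[OF e] in \<open>auto intro!: Pol_uminus Pol_divc\<close>)+
    then show "(\<lambda>x. ?p i x e) \<in> Pol i" "(\<lambda>y. ?q i e y) \<in> Pol i"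
      by (meson Pol_mono diff_le_self)+
    show "(\<lambda>x. x * ?p i x e + ?w i x e) \<in> Pol i" "(\<lambda>y. y * ?q i e y + ?w i e y) \<in> Pol i"
      using Pol_mult_x[OF P(1)] Pol_mult_x[OF P(2)] by (cases i; simp)+
  qed auto
  have n: "real i + 2 \<noteq> 0" for i
    using of_nat_0_le_iff[of i] by linarith
  have "curl1 ?q ?w i = a i" for i
    using n[of i] by (simp add: curl1_def fun_eq_iff field_simps)
  moreover have "curl2 ?p ?w i = b i" for i
    using n[of i] by (simp add: curl2_def fun_eq_iff field_simps)
  moreover have "curl3 ?p ?q i = c i" for i
  proof -
    have c1: "dx (?q (Suc i)) = (\<lambda>x y. dx (a i) x y / (real i + 2))"
      by (intro dx_eqI) (auto intro!: derivative_eq_intros Q2_DERIV_x[OF Q(1)])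
    have c2: "dy (?p (Suc i)) = (\<lambda>x y. - (dy (b i) x y / (real i + 2)))"
      by (intro dy_eqI) (auto intro!: derivative_eq_intros Q2_DERIV_y[OF Q(2)])
    have "dx (a i) x y / (real i + 2) - - (dy (b i) x y / (real i + 2)) = c i x y" for x y
    proof -
      have "dx (a i) x y / (real i + 2) - - (dy (b i) x y / (real i + 2)) = (real i + 2) * c i x y / (real i + 2)"
        unfolding c by (simp add: add_divide_distrib)
      then show ?thesis
        using n[of i] by simp
    qed
    then show ?thesis
      unfolding curl3_def c1 c2 by presburger
  qed
  ultimately show "rep2 k a b c = curl_on Omega (rep1 k ?p ?q ?w)"
    unfolding curl_rep1[OF C1] by presburger
qed

lemma div_surj:
  assumes C: "cochain3 k f"
  obtains a b c where "cochain2 k a b c" "rep0 k f = div_on Omega (rep2 k a b c)"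
proof
  let ?a = "\<lambda>(i::nat) (x::real) (y::real). 0 :: real"
  \<comment> \<open>Contraction of a 3-form leaves a dx dy-part only; index \<open>i\<close> has
    degree i + 3. With \<open>a\<close> and \<open>b\<close> zero, \<open>c 0\<close> is forced to
    be 0.\<close>
  let ?c = "\<lambda>i. case i of 0 \<Rightarrow> (\<lambda>x y. 0) | Suc i \<Rightarrow> (\<lambda>x y. - (f i x y / (real i + 3)))"
  show C2: "cochain2 k ?a ?a ?c"
    using C unfolding cochain2_def cochain3_def by (auto intro!: Q2_uminus Q2_divc split: nat.split)
  have n: "real i + 3 \<noteq> 0" for i
    using of_nat_0_le_iff[of i] by linarith
  have "dvg ?a ?a ?c i = f i" for i
    using n[of i] by (simp add: dvg_def fun_eq_iff field_simps)
  then show "rep0 k f = div_on Omega (rep2 k ?a ?a ?c)"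
    unfolding div_rep2[OF C2] by presburger
qed

section \<open>Expansion in inverse powers of the height\<close>

lemma power_shift:
  fixes z c :: real
  assumes "d < n"
  shows "z ^ d = (\<Sum>i<n. real (d choose i) * (- c) ^ (d - i) * (z + c) ^ i)"
proof -
  have "z ^ d = ((z + c) + (- c)) ^ d"
    by simp
  also have "\<dots> = (\<Sum>i\<le>d. real (d choose i) * (z + c) ^ i * (- c) ^ (d - i))"
    by (rule binomial_ring)
  also have "\<dots> = (\<Sum>i<n. real (d choose i) * (- c) ^ (d - i) * (z + c) ^ i)"
    using assms by (intro sum.mono_neutral_cong_left) (auto simp: not_le)
  finally show ?thesis .
qed

lemma power_sum_shift:
  fixes g :: "nat \<Rightarrow> real"
  shows "(\<Sum>d<n. g d * z ^ d) = (\<Sum>i<n. (\<Sum>d<n. real (d choose i) * (- c) ^ (d - i) * g d) * (z + c) ^ i)"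
proof -
  have "(\<Sum>d<n. g d * z ^ d) = (\<Sum>d<n. \<Sum>i<n. g d * (real (d choose i) * (- c) ^ (d - i) * (z + c) ^ i))"
    by (intro sum.cong refl) (simp add: power_shift[of _ n z c] sum_distrib_left)
  also have "\<dots> = (\<Sum>i<n. \<Sum>d<n. g d * (real (d choose i) * (- c) ^ (d - i) * (z + c) ^ i))"
    by (rule sum.swap)
  finally show ?thesis
    unfolding sum_distrib_right by (simp add: mult_ac)
qed

text \<open>Change of basis between powers of z and of 1 + z: \<open>c = 1\<close> expands,
  \<open>c = -1\<close> leads back.\<close>

lemma Q2_family_shift:
  assumes "\<And>d. G d \<in> Q2 l m"
  obtains F where "\<And>i. F i \<in> Q2 l m" "\<And>x y z. (\<Sum>d<n. G d x y * z ^ d) = (\<Sum>i<n. F i x y * (z + c) ^ i)"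
proof
  let ?F = "\<lambda>i x y. \<Sum>d<n. real (d choose i) * (- c) ^ (d - i) * G d x y"
  show "?F i \<in> Q2 l m" for i
    by (intro Q2_sum Q2_cmult assms)
  show "(\<Sum>d<n. G d x y * z ^ d) = (\<Sum>i<n. ?F i x y * (z + c) ^ i)" for x y z
    by (rule power_sum_shift)
qed

text \<open>Total degree survives the substitution: the new coefficient \<open>i\<close> collects
  only those \<open>d \<ge> i\<close>, and their degree is at most n - d \<le> n - i.\<close>

lemma Pol_family_shift:
  assumes "\<And>d. d \<le> n \<Longrightarrow> G d \<in> Pol (n - d)"
  obtains F where "\<And>i. i \<le> n \<Longrightarrow> F i \<in> Pol (n - i)"
    "\<And>w z. (\<Sum>d<Suc n. G d w * z ^ d) = (\<Sum>i<Suc n. F i w * (z + c) ^ i)"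
proof
  let ?F = "\<lambda>i w. \<Sum>d<Suc n. real (d choose i) * (- c) ^ (d - i) * G d w"
  show "?F i \<in> Pol (n - i)" if "i \<le> n" for i
  proof (rule Pol_sum)
    fix d assume "d \<in> {..<Suc n}"
    then have d: "d \<le> n"
      by auto
    show "(\<lambda>w. real (d choose i) * (- c) ^ (d - i) * G d w) \<in> Pol (n - i)"
    proof (cases "d < i")
      case False
      then show ?thesis
        using Pol_mono[OF _ assms[OF d], of "n - i"] by (intro Pol_cmult) auto
    qed (simp add: binomial_eq_0)
  qed
  show "(\<Sum>d<Suc n. G d w * z ^ d) = (\<Sum>i<Suc n. ?F i w * (z + c) ^ i)" for w z
    by (rule power_sum_shift)
qed

lemma deg_le_pred: "deg_le (int n - 1) = {..<n}"
  by (auto simp: deg_le_def)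

text \<open>The bound \<open>int n - 1\<close> with natural \<open>n\<close> includes the zero
  space, which occurs as degree k - 2 when k = 1.\<close>

lemma Q3_iff:
  "u \<in> Q3 l m (int n - 1) \<longleftrightarrow>
    (\<exists>G. (\<forall>d. G d \<in> Q2 l m) \<and> u = (\<lambda>p. \<Sum>d<n. G d (p$1) (p$2) * (p$3) ^ d))"
proof -
  have *: "(\<Sum>a\<in>deg_le l. \<Sum>b\<in>deg_le m. \<Sum>d\<in>deg_le (int n - 1). c a b d * x ^ a * y ^ b * z ^ d) =
      (\<Sum>d<n. (\<Sum>a\<in>deg_le l. \<Sum>b\<in>deg_le m. c a b d * x ^ a * y ^ b) * z ^ d)"
    for c :: "nat \<Rightarrow> nat \<Rightarrow> nat \<Rightarrow> real" and x y z
  proof -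
    have "(\<Sum>d<n. (\<Sum>a\<in>deg_le l. \<Sum>b\<in>deg_le m. c a b d * x ^ a * y ^ b) * z ^ d) =
      (\<Sum>d<n. \<Sum>a\<in>deg_le l. \<Sum>b\<in>deg_le m. c a b d * x ^ a * y ^ b * z ^ d)"
      by (simp add: sum_distrib_right)
    also have "\<dots> = (\<Sum>a\<in>deg_le l. \<Sum>d<n. \<Sum>b\<in>deg_le m. c a b d * x ^ a * y ^ b * z ^ d)"
      by (rule sum.swap)
    also have "\<dots> = (\<Sum>a\<in>deg_le l. \<Sum>b\<in>deg_le m. \<Sum>d<n. c a b d * x ^ a * y ^ b * z ^ d)"
      by (intro sum.cong refl sum.swap)
    finally show ?thesis
      by (simp add: deg_le_pred)
  qed
  show ?thesis
  proof
    assume "u \<in> Q3 l m (int n - 1)"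
    then obtain c where u: "u = (\<lambda>p. \<Sum>a\<in>deg_le l. \<Sum>b\<in>deg_le m. \<Sum>d\<in>deg_le (int n - 1).
      c a b d * (p$1) ^ a * (p$2) ^ b * (p$3) ^ d)"
      unfolding Q3_def by blast
    have "(\<lambda>x y. \<Sum>a\<in>deg_le l. \<Sum>b\<in>deg_le m. c a b d * x ^ a * y ^ b) \<in> Q2 l m" for d
      unfolding Q2_def by (intro CollectI exI[of _ "\<lambda>a b. c a b d"] refl)
    then show "\<exists>G. (\<forall>d. G d \<in> Q2 l m) \<and> u = (\<lambda>p. \<Sum>d<n. G d (p$1) (p$2) * (p$3) ^ d)"
      unfolding u *
      by (intro exI[of _ "\<lambda>d x y. \<Sum>a\<in>deg_le l. \<Sum>b\<in>deg_le m. c a b d * x ^ a * y ^ b"]) simp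
  next
    assume "\<exists>G. (\<forall>d. G d \<in> Q2 l m) \<and> u = (\<lambda>p. \<Sum>d<n. G d (p$1) (p$2) * (p$3) ^ d)"
    then obtain G where G: "\<forall>d. G d \<in> Q2 l m" and u: "u = (\<lambda>p. \<Sum>d<n. G d (p$1) (p$2) * (p$3) ^ d)"
      by blast
    have "\<exists>c. G d = (\<lambda>x y. \<Sum>a\<in>deg_le l. \<Sum>b\<in>deg_le m. c a b * x ^ a * y ^ b)" for d
      using G[rule_format, of d] unfolding Q2_def by (rule CollectD)
    then have "\<forall>d. \<exists>c. G d = (\<lambda>x y. \<Sum>a\<in>deg_le l. \<Sum>b\<in>deg_le m. c a b * x ^ a * y ^ b)"
      by (rule allI)
    from choice[OF this]
    obtain c where c: "\<And>d. G d = (\<lambda>x y. \<Sum>a\<in>deg_le l. \<Sum>b\<in>deg_le m. c d a b * x ^ a * y ^ b)"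
      by (elim exE) (rule that, erule spec)
    show "u \<in> Q3 l m (int n - 1)"
      unfolding Q3_def u c
      by (intro CollectI exI[of _ "\<lambda>a b d. c d a b"]) (simp only: *)
  qed
qed

lemma power_quotient:
  fixes t :: real
  assumes "t \<noteq> 0" "i \<le> n"
  shows "t ^ (n - i) / t ^ (n + m) = (1 / t) ^ (m + i)"
proof -
  have "t ^ (n + m) = t ^ (n - i) * t ^ (m + i)"
    using assms(2) by (simp flip: power_add)
  then show ?thesis
    using assms(1) by (simp add: power_one_over)
qed

text \<open>With t = 1 + z the exponents of s run from m + 1 to m + n. The exponent m is left to the
  extra summands of the spaces.\<close>

lemma sum_reverse_lessThan:
  fixes t :: real
  assumes "t \<noteq> 0"
  shows "(\<Sum>i<n. F i * t ^ i) / t ^ (n + m) = (\<Sum>i<n. F (n - Suc i) * (1 / t) ^ (m + Suc i))"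
proof -
  have "(\<Sum>i<n. F i * t ^ i) = (\<Sum>i<n. F (n - Suc i) * t ^ (n - Suc i))"
    by (rule sum.nat_diff_reindex[symmetric])
  then have "(\<Sum>i<n. F i * t ^ i) / t ^ (n + m) = (\<Sum>i<n. F (n - Suc i) * (t ^ (n - Suc i) / t ^ (n + m)))"
    by (simp add: sum_divide_distrib)
  also have "\<dots> = (\<Sum>i<n. F (n - Suc i) * (1 / t) ^ (m + Suc i))"
    by (intro sum.cong refl) (subst power_quotient, use assms in auto)
  finally show ?thesis .
qed

text \<open>The additional term i = n reaches the exponent m as well, as is the case in the face
  spaces.\<close>

lemma sum_reverse_atMost:
  fixes t :: real
  assumes "t \<noteq> 0"
  shows "(\<Sum>i<Suc n. F i * t ^ i) / t ^ (n + m) = (\<Sum>i\<le>n. F (n - i) * (1 / t) ^ (m + i))"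
proof -
  have "(\<Sum>i<Suc n. F i * t ^ i) = (\<Sum>i<Suc n. F (Suc n - Suc i) * t ^ (Suc n - Suc i))"
    by (rule sum.nat_diff_reindex[symmetric])
  also have "\<dots> = (\<Sum>i\<le>n. F (n - i) * t ^ (n - i))"
    by (simp add: lessThan_Suc_atMost)
  finally have "(\<Sum>i<Suc n. F i * t ^ i) / t ^ (n + m) = (\<Sum>i\<le>n. F (n - i) * (t ^ (n - i) / t ^ (n + m)))"
    by (simp add: sum_divide_distrib)
  also have "\<dots> = (\<Sum>i\<le>n. F (n - i) * (1 / t) ^ (m + i))"
    by (intro sum.cong refl) (subst power_quotient, use assms in auto)
  finally show ?thesis .
qed

text \<open>The coefficient of s^i in (1 - s)^n; it arises from z / (1 + z) = 1 - s.\<close>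

definition binom :: "nat \<Rightarrow> nat \<Rightarrow> real" where
  "binom n i = (- 1) ^ i * real (n choose i)"

lemma top_power_expansion:
  fixes z :: real
  assumes "z \<ge> 0" "n' \<le> n"
  shows "z ^ n' / (1 + z) ^ (n' + m) = (\<Sum>i\<le>n. binom n' i * (1 / (1 + z)) ^ (m + i))"
proof -
  let ?s = "1 / (1 + z)"
  have "z ^ n' / (1 + z) ^ (n' + m) = (z / (1 + z)) ^ n' * ?s ^ m"
    by (simp add: power_add power_divide)
  also have "z / (1 + z) = (- ?s) + 1"
    using assms(1) by (simp add: field_simps)
  also have "((- ?s) + 1) ^ n' = (\<Sum>i\<le>n'. real (n' choose i) * (- ?s) ^ i)"
    by (subst binomial_ring) simp
  also have "\<dots> = (\<Sum>i\<le>n. binom n' i * ?s ^ i)"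
    using assms(2) by (intro sum.mono_neutral_cong_left) (auto simp: binom_def power_minus' mult_ac power_minus[of ?s])
  finally show ?thesis
    unfolding sum_distrib_right by (simp add: power_add mult_ac)
qed

text \<open>Counterpart of \<open>gsum\<close> on the infinite pyramid. The offset \<open>m\<close>
  differs between components because the pullbacks multiply them by different powers of s.\<close>

definition ser :: "nat \<Rightarrow> nat \<Rightarrow> (nat \<Rightarrow> real \<Rightarrow> real \<Rightarrow> real) \<Rightarrow> real^3 \<Rightarrow> real" where
  "ser m n f p = (\<Sum>i\<le>n. f i (p$1) (p$2) * (1 / (1 + p$3)) ^ (m + i))"

text \<open>The fraction supplies the exponents m + 1 to m + n. The extra summand supplies s^m with
  coefficient \<open>g\<close> and otherwise only perturbs higher coefficients. In the third
  component of 2-forms \<open>n'\<close> is n - 1, elsewhere n.\<close>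

lemma Q_frac_expand:
  assumes q: "q \<in> Q_frac l l' (int n - 1) (n + m)" and g: "g \<in> Q2 l l'" and "n' \<le> n"
  obtains f where "\<And>i. f i \<in> Q2 l l'" "f 0 = g" "\<And>i. i > n \<Longrightarrow> f i = (\<lambda>x y. 0)"
    "\<And>p. p \<in> Omega_inf \<Longrightarrow> q p + g (p$1) (p$2) * ((p$3) ^ n' / (1 + p$3) ^ (n' + m)) = ser m n f p"
proof -
  obtain G where G: "\<And>d. G d \<in> Q2 l l'"
    and qG: "q = (\<lambda>p. (\<Sum>d<n. G d (p$1) (p$2) * (p$3) ^ d) / (1 + p$3) ^ (n + m))"
    using q unfolding Q_frac_def Q3_iff by blast
  obtain F where F: "\<And>i. F i \<in> Q2 l l'"
    and GF: "\<And>x y z. (\<Sum>d<n. G d x y * z ^ d) = (\<Sum>i<n. F i x y * (z + 1) ^ i)"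
    using Q2_family_shift[where G = G and n = n and c = 1, OF G] by blast
  let ?F = "\<lambda>i x y. if i = 0 \<or> i > n then 0 else F (n - i) x y"
  let ?f = "\<lambda>i x y. ?F i x y + binom n' i * g x y"
  have FQ: "?F i \<in> Q2 l l'" for i
    using F by (cases "i = 0 \<or> i > n") auto
  show ?thesis
  proof
    show "?f i \<in> Q2 l l'" for i
      by (intro Q2_add Q2_cmult g FQ)
    show "?f 0 = g"
      by (simp add: binom_def)
    show "?f i = (\<lambda>x y. 0)" if "i > n" for i
      using that assms(3) by (simp add: binom_def binomial_eq_0)
    fix p :: "real^3" assume "p \<in> Omega_inf"
    then have z: "p$3 \<ge> 0"
      by (simp add: Omega_inf_def)
    have "q p = (\<Sum>i<n. F i (p$1) (p$2) * (1 + p$3) ^ i) / (1 + p$3) ^ (n + m)"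
      by (simp add: qG GF add.commute)
    also have "\<dots> = (\<Sum>i<n. F (n - Suc i) (p$1) (p$2) * (1 / (1 + p$3)) ^ (m + Suc i))"
      by (rule sum_reverse_lessThan) (use z in auto)
    also have "\<dots> = (\<Sum>i\<le>n. ?F i (p$1) (p$2) * (1 / (1 + p$3)) ^ (m + i))"
      by (simp add: sum.atMost_shift)
    finally show "q p + g (p$1) (p$2) * ((p$3) ^ n' / (1 + p$3) ^ (n' + m)) = ser m n ?f p"
      unfolding ser_def top_power_expansion[OF z assms(3)]
      by (simp only: distrib_right sum.distrib sum_distrib_left mult.left_commute mult.assoc)
  qed
qed

lemma Q_frac_collect:
  assumes f: "\<And>i. f i \<in> Q2 l l'" and "n' \<le> n"
  obtains q where "q \<in> Q_frac l l' (int n - 1) (n + m)"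
    "\<And>p. p \<in> Omega_inf \<Longrightarrow> q p + f 0 (p$1) (p$2) * ((p$3) ^ n' / (1 + p$3) ^ (n' + m)) = ser m n f p"
proof -
  \<comment> \<open>The extra summand also puts multiples of \<open>f 0\<close> at higher exponents;
    they are taken away beforehand. The index is n - i because division by the weight reverses the
    order.\<close>
  let ?F = "\<lambda>i x y. f (n - i) x y - binom n' (n - i) * f 0 x y"
  have "?F i \<in> Q2 l l'" for i
    by (intro Q2_diff Q2_cmult f)
  then obtain G where G: "\<And>d. G d \<in> Q2 l l'"
    and FG: "\<And>x y z. (\<Sum>i<n. ?F i x y * z ^ i) = (\<Sum>d<n. G d x y * (z + (- 1)) ^ d)"
    using Q2_family_shift[where G = ?F and n = n and c = "-1"] by blast
  let ?q = "\<lambda>p::real^3. (\<Sum>d<n. G d (p$1) (p$2) * (p$3) ^ d) / (1 + p$3) ^ (n + m)"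
  show ?thesis
  proof
    show "?q \<in> Q_frac l l' (int n - 1) (n + m)"
      unfolding Q_frac_def
    proof (intro CollectI exI conjI)
      show "(\<lambda>p. \<Sum>d<n. G d (p$1) (p$2) * (p$3) ^ d) \<in> Q3 l l' (int n - 1)"
        unfolding Q3_iff using G by (intro exI[of _ G]) auto
    qed (rule refl)
    fix p :: "real^3" assume "p \<in> Omega_inf"
    then have z: "p$3 \<ge> 0"
      by (simp add: Omega_inf_def)
    have "?q p = (\<Sum>i<n. ?F i (p$1) (p$2) * (1 + p$3) ^ i) / (1 + p$3) ^ (n + m)"
      by (simp only: FG) simp
    also have "\<dots> = (\<Sum>i<n. ?F (n - Suc i) (p$1) (p$2) * (1 / (1 + p$3)) ^ (m + Suc i))"
      by (rule sum_reverse_lessThan) (use z in auto)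
    also have "\<dots> = (\<Sum>i<n. (f (Suc i) (p$1) (p$2) - binom n' (Suc i) * f 0 (p$1) (p$2)) * (1 / (1 + p$3)) ^ (m + Suc i))"
      by (intro sum.cong) auto
    also have "\<dots> = (\<Sum>i<n. f (Suc i) (p$1) (p$2) * (1 / (1 + p$3)) ^ (m + Suc i)) -
        f 0 (p$1) (p$2) * (\<Sum>i<n. binom n' (Suc i) * (1 / (1 + p$3)) ^ (m + Suc i))"
      by (simp only: left_diff_distrib sum_subtractf sum_distrib_left mult.assoc mult.left_commute)
    finally have "?q p = \<dots>" .
    moreover have "binom n' 0 = 1"
      by (simp add: binom_def)
    ultimately show "?q p + f 0 (p$1) (p$2) * ((p$3) ^ n' / (1 + p$3) ^ (n' + m)) = ser m n f p"
      unfolding ser_def top_power_expansion[OF z assms(2)] sum.atMost_shift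
      by (simp add: distrib_left del: power_Suc)
  qed
qed

section \<open>The face spaces, one power of s at a time\<close>

lemma P2_iff:
  "u \<in> P2 (int n) \<longleftrightarrow> (\<exists>G. (\<forall>b\<le>n. G b \<in> Pol (n - b)) \<and> u = (\<lambda>w z. \<Sum>b<Suc n. G b w * z ^ b))"
proof -
  have *: "(\<Sum>(a,b)\<in>{(a,b). int a + int b \<le> int n}. c a b * w ^ a * z ^ b) =
      (\<Sum>b<Suc n. (\<Sum>a\<le>n - b. c a b * w ^ a) * z ^ b)" for c :: "nat \<Rightarrow> nat \<Rightarrow> real" and w z
  proof -
    have "(\<Sum>b<Suc n. (\<Sum>a\<le>n - b. c a b * w ^ a) * z ^ b) =
      (\<Sum>(b,a)\<in>(SIGMA b:{..<Suc n}. {..n - b}). c a b * w ^ a * z ^ b)"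
      unfolding sum_distrib_right by (rule sum.Sigma) auto
    also have "\<dots> = (\<Sum>(a,b)\<in>{(a,b). int a + int b \<le> int n}. c a b * w ^ a * z ^ b)"
      by (rule sum.reindex_bij_witness[of _ prod.swap prod.swap]) auto
    finally show ?thesis ..
  qed
  show ?thesis
  proof
    assume "u \<in> P2 (int n)"
    then obtain c where "u = (\<lambda>w z. \<Sum>(a,b)\<in>{(a,b). int a + int b \<le> int n}. c a b * w ^ a * z ^ b)"
      unfolding P2_def by blast
    then show "\<exists>G. (\<forall>b\<le>n. G b \<in> Pol (n - b)) \<and> u = (\<lambda>w z. \<Sum>b<Suc n. G b w * z ^ b)"
      unfolding * by (intro exI[of _ "\<lambda>b w. \<Sum>a\<le>n - b. c a b * w ^ a"]) (auto intro!: Pol_sum Pol_monom)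
  next
    assume "\<exists>G. (\<forall>b\<le>n. G b \<in> Pol (n - b)) \<and> u = (\<lambda>w z. \<Sum>b<Suc n. G b w * z ^ b)"
    then obtain G where G: "\<forall>b\<le>n. G b \<in> Pol (n - b)" and u: "u = (\<lambda>w z. \<Sum>b<Suc n. G b w * z ^ b)"
      by blast
    have "\<forall>b. \<exists>c. b \<le> n \<longrightarrow> G b = (\<lambda>w. \<Sum>a\<le>n - b. c a * w ^ a)"
      using G by (metis Pol_coeffs)
    then obtain c where c: "\<And>b. b \<le> n \<Longrightarrow> G b = (\<lambda>w. \<Sum>a\<le>n - b. c b a * w ^ a)"
      by metis
    have "u = (\<lambda>w z. \<Sum>b<Suc n. (\<Sum>a\<le>n - b. c b a * w ^ a) * z ^ b)"
      unfolding u by (intro ext sum.cong) (auto simp: c)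
    then show "u \<in> P2 (int n)"
      unfolding P2_def by (intro CollectI exI[of _ "\<lambda>a b. c b a"]) (simp only: *)
  qed
qed

text \<open>Division turns (1 + z)^(n - i) into s^(m + i), and the coefficient there had degree at
  most i. So the bound on the total degree splits into one bound per power of s.\<close>

lemma P_frac_expand:
  assumes "u \<in> P_frac (int n) (n + m)"
  obtains g where "\<And>i. i \<le> n \<Longrightarrow> g i \<in> Pol i"
    "\<And>w z. z \<ge> 0 \<Longrightarrow> u w z = (\<Sum>i\<le>n. g i w * (1 / (1 + z)) ^ (m + i))"
proof -
  obtain G where G: "\<And>b. b \<le> n \<Longrightarrow> G b \<in> Pol (n - b)"
    and u: "u = (\<lambda>w z. (\<Sum>b<Suc n. G b w * z ^ b) / (1 + z) ^ (n + m))"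
    using assms unfolding P_frac_def P2_iff by blast
  obtain F where F: "\<And>i. i \<le> n \<Longrightarrow> F i \<in> Pol (n - i)"
    and GF: "\<And>w z. (\<Sum>b<Suc n. G b w * z ^ b) = (\<Sum>i<Suc n. F i w * (z + 1) ^ i)"
    using Pol_family_shift[where G = G and n = n and c = 1, OF G] by blast
  show ?thesis
  proof
    show "F (n - i) \<in> Pol i" if "i \<le> n" for i
      using F[of "n - i"] that by simp
    fix w z :: real assume z: "z \<ge> 0"
    have "u w z = (\<Sum>i<Suc n. F i w * (1 + z) ^ i) / (1 + z) ^ (n + m)"
      unfolding u GF by (simp only: add.commute)
    also have "\<dots> = (\<Sum>i\<le>n. F (n - i) w * (1 / (1 + z)) ^ (m + i))"
      by (rule sum_reverse_atMost) (use z in auto)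
    finally show "u w z = \<dots>" .
  qed
qed

lemma P_frac_collect:
  assumes "\<And>i. i \<le> n \<Longrightarrow> g i \<in> Pol i"
  obtains u where "u \<in> P_frac (int n) (n + m)"
    "\<And>w z. z \<ge> 0 \<Longrightarrow> u w z = (\<Sum>i\<le>n. g i w * (1 / (1 + z)) ^ (m + i))"
proof -
  obtain G where G: "\<And>d. d \<le> n \<Longrightarrow> G d \<in> Pol (n - d)"
    and gG: "\<And>w z. (\<Sum>i<Suc n. g (n - i) w * z ^ i) = (\<Sum>d<Suc n. G d w * (z + (- 1)) ^ d)"
    by (rule Pol_family_shift[where G = "\<lambda>i. g (n - i)" and n = n and c = "-1"]) (use assms in auto)
  let ?u = "\<lambda>w z. (\<Sum>d<Suc n. G d w * z ^ d) / (1 + z) ^ (n + m)"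
  show ?thesis
  proof
    show "?u \<in> P_frac (int n) (n + m)"
      unfolding P_frac_def
    proof (intro CollectI exI conjI)
      show "(\<lambda>w z. \<Sum>d<Suc n. G d w * z ^ d) \<in> P2 (int n)"
        unfolding P2_iff using G by (intro exI[of _ G]) auto
    qed (rule refl)
    fix w z :: real assume z: "z \<ge> 0"
    have "?u w z = (\<Sum>i<Suc n. g (n - i) w * (1 + z) ^ i) / (1 + z) ^ (n + m)"
      unfolding gG by simp
    also have "\<dots> = (\<Sum>i\<le>n. g (n - (n - i)) w * (1 / (1 + z)) ^ (m + i))"
      by (rule sum_reverse_atMost) (use z in auto)
    also have "\<dots> = (\<Sum>i\<le>n. g i w * (1 / (1 + z)) ^ (m + i))"
      by (intro sum.cong) auto
    finally show "?u w z = \<dots>" .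
  qed
qed

lemma strip_coeffs_unique:
  assumes "\<And>i. i \<le> n \<Longrightarrow> f i \<in> Pol (N i)" "\<And>i. i \<le> n \<Longrightarrow> g i \<in> Pol (M i)"
    and eq: "\<And>w z. 0 \<le> w \<Longrightarrow> w \<le> 1 \<Longrightarrow> z \<ge> 0 \<Longrightarrow>
      (\<Sum>i\<le>n. f i w * (1 / (1 + z)) ^ (m + i)) = (\<Sum>i\<le>n. g i w * (1 / (1 + z)) ^ (m + i))"
    and "i \<le> n"
  shows "f i = g i"
proof (rule Pol_eq_on_interval[OF assms(1,2)])
  fix w :: real assume w: "0 \<le> w" "w \<le> 1"
  have "(\<Sum>i\<le>n. (f i w - g i w) * s ^ i) = 0" if s: "0 < s" "s \<le> 1" for s
  proof -
    have "(\<Sum>i\<le>n. f i w * s ^ (m + i)) = (\<Sum>i\<le>n. g i w * s ^ (m + i))"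
      using eq[OF w, of "1 / s - 1"] s by simp
    then have "s ^ m * (\<Sum>i\<le>n. (f i w - g i w) * s ^ i) = 0"
      by (simp add: sum_distrib_left power_add algebra_simps sum_subtractf)
    then show ?thesis
      using s by simp
  qed
  then show "f i w = g i w"
    using power_sum_coeffs_zero[where n = n and c = "\<lambda>i. f i w - g i w"] \<open>i \<le> n\<close> by force
qed (use assms in auto)

text \<open>Coefficients of powers of s are unique as polynomials, so those of a representative in
  the face space must be the given ones.\<close>

lemma on_strip_P_frac_iff:
  assumes f: "\<And>i. i \<le> n \<Longrightarrow> f i \<in> Pol N"
    and h: "\<And>w z. 0 \<le> w \<Longrightarrow> w \<le> 1 \<Longrightarrow> z \<ge> 0 \<Longrightarrow> h w z = (\<Sum>i\<le>n. f i w * (1 / (1 + z)) ^ (m + i))"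
  shows "on_strip h (P_frac (int n) (n + m)) \<longleftrightarrow> (\<forall>i\<le>n. f i \<in> Pol i)"
proof
  assume "on_strip h (P_frac (int n) (n + m))"
  then obtain u where u: "u \<in> P_frac (int n) (n + m)" "\<And>w z. 0 \<le> w \<Longrightarrow> w \<le> 1 \<Longrightarrow> z \<ge> 0 \<Longrightarrow> h w z = u w z"
    unfolding on_strip_def by fastforce
  obtain g where g: "\<And>i. i \<le> n \<Longrightarrow> g i \<in> Pol i"
    "\<And>w z. z \<ge> 0 \<Longrightarrow> u w z = (\<Sum>i\<le>n. g i w * (1 / (1 + z)) ^ (m + i))"
    using P_frac_expand[OF u(1)] by metis
  have "f i = g i" if "i \<le> n" for i
    by (rule strip_coeffs_unique[where n = n and m = m and N = "\<lambda>_. N" and M = "\<lambda>i. i"])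
      (use f g u(2) h that in auto)
  then show "\<forall>i\<le>n. f i \<in> Pol i"
    using g(1) by auto
next
  assume "\<forall>i\<le>n. f i \<in> Pol i"
  then obtain u where "u \<in> P_frac (int n) (n + m)"
    "\<And>w z. z \<ge> 0 \<Longrightarrow> u w z = (\<Sum>i\<le>n. f i w * (1 / (1 + z)) ^ (m + i))"
    using P_frac_collect[of n f m] by blast
  then show "on_strip h (P_frac (int n) (n + m))"
    unfolding on_strip_def using h by (intro bexI[of _ u]) auto
qed

text \<open>Each w^a is tied to one power of s. After multiplication by 1 + z it stands at s^(1 +
  a), one degree above what the \<open>P_frac\<close> part of the tangential space allows
  there.\<close>

lemma P_tilde_expand:
  assumes "z \<ge> (0::real)"
  shows "(\<Sum>a\<le>n. c a * w ^ a * (1 + z) ^ (n - a)) / (1 + z) ^ (n + 2)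
    = (\<Sum>a\<le>n. c a * w ^ a * (1 / (1 + z)) ^ (2 + a))"
proof -
  have "(\<Sum>a\<le>n. c a * w ^ a * (1 + z) ^ (n - a)) / (1 + z) ^ (n + 2)
    = (\<Sum>a\<le>n. c a * w ^ a * ((1 + z) ^ (n - a) / (1 + z) ^ (n + 2)))"
    by (simp add: sum_divide_distrib)
  also have "\<dots> = (\<Sum>a\<le>n. c a * w ^ a * (1 / (1 + z)) ^ (2 + a))"
    by (intro sum.cong refl) (subst power_quotient, use assms in auto)
  finally show ?thesis .
qed

text \<open>One sequence \<open>c\<close> serves both components: the factor 1 + z lowers the
  exponent of s in the first, the factor -w raises the power of w in the second.\<close>

lemma tangential_space_expand:
  assumes "u \<in> tangential_space (Suc n)"
  obtains F G c where "\<And>i. i \<le> n \<Longrightarrow> F i \<in> Pol i" "\<And>i. i \<le> n \<Longrightarrow> G i \<in> Pol i"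
    "\<And>w z. z \<ge> 0 \<Longrightarrow> u w z =
      ((\<Sum>i\<le>n. F i w * (1 / (1 + z)) ^ (2 + i)) + (\<Sum>i\<le>n. c i * w ^ i * (1 / (1 + z)) ^ (1 + i)),
       \<Sum>i\<le>n. (G i w - c i * w ^ Suc i) * (1 / (1 + z)) ^ (2 + i))"
proof -
  obtain f g h where u: "u = (\<lambda>w z. (f w z + h w z * (1 + z), g w z - h w z * w))"
    and f: "f \<in> P_frac (int n) (n + 2)" and g: "g \<in> P_frac (int n) (n + 2)" and h: "h \<in> P_tilde (Suc n)"
    using assms unfolding tangential_space_def by auto
  obtain F where F: "\<And>i. i \<le> n \<Longrightarrow> F i \<in> Pol i"
    "\<And>w z. z \<ge> 0 \<Longrightarrow> f w z = (\<Sum>i\<le>n. F i w * (1 / (1 + z)) ^ (2 + i))"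
    using P_frac_expand[OF f] by blast
  obtain G where G: "\<And>i. i \<le> n \<Longrightarrow> G i \<in> Pol i"
    "\<And>w z. z \<ge> 0 \<Longrightarrow> g w z = (\<Sum>i\<le>n. G i w * (1 / (1 + z)) ^ (2 + i))"
    using P_frac_expand[OF g] by blast
  obtain c where c: "h = (\<lambda>w z. (\<Sum>a\<le>n. c a * w ^ a * (1 + z) ^ (n - a)) / (1 + z) ^ (n + 2))"
    using h unfolding P_tilde_def by (auto simp: atMost_atLeast0)
  show ?thesis
  proof (rule that[OF F(1) G(1)])
    fix w z :: real assume z: "z \<ge> 0"
    have h: "h w z = (\<Sum>a\<le>n. c a * w ^ a * (1 / (1 + z)) ^ (2 + a))"
      unfolding c by (rule P_tilde_expand[OF z])
    have "h w z * (1 + z) = (\<Sum>i\<le>n. c i * w ^ i * (1 / (1 + z)) ^ (1 + i))"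
      unfolding h sum_distrib_right using z by (intro sum.cong refl) simp
    moreover have "g w z - h w z * w = (\<Sum>i\<le>n. (G i w - c i * w ^ Suc i) * (1 / (1 + z)) ^ (2 + i))"
      unfolding h G(2)[OF z] sum_distrib_right sum_subtractf[symmetric]
      by (intro sum.cong refl) (unfold left_diff_distrib, simp only: power_Suc mult_ac)
    ultimately show "u w z =
      ((\<Sum>i\<le>n. F i w * (1 / (1 + z)) ^ (2 + i)) + (\<Sum>i\<le>n. c i * w ^ i * (1 / (1 + z)) ^ (1 + i)),
       \<Sum>i\<le>n. (G i w - c i * w ^ Suc i) * (1 / (1 + z)) ^ (2 + i))"
      by (simp only: u F(2)[OF z])
  qed
qed

lemma tangential_space_collect:
  assumes F: "\<And>i. i \<le> n \<Longrightarrow> F i \<in> Pol i" and G: "\<And>i. i \<le> n \<Longrightarrow> G i \<in> Pol i"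
  obtains u where "u \<in> tangential_space (Suc n)"
    "\<And>w z. z \<ge> 0 \<Longrightarrow> u w z =
      ((\<Sum>i\<le>n. F i w * (1 / (1 + z)) ^ (2 + i)) + (\<Sum>i\<le>n. c i * w ^ i * (1 / (1 + z)) ^ (1 + i)),
       \<Sum>i\<le>n. (G i w - c i * w ^ Suc i) * (1 / (1 + z)) ^ (2 + i))"
proof -
  obtain f where f: "f \<in> P_frac (int n) (n + 2)"
    "\<And>w z. z \<ge> 0 \<Longrightarrow> f w z = (\<Sum>i\<le>n. F i w * (1 / (1 + z)) ^ (2 + i))"
    using P_frac_collect[of n F 2, OF F] by blast
  obtain g where g: "g \<in> P_frac (int n) (n + 2)"
    "\<And>w z. z \<ge> 0 \<Longrightarrow> g w z = (\<Sum>i\<le>n. G i w * (1 / (1 + z)) ^ (2 + i))"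
    using P_frac_collect[of n G 2, OF G] by blast
  define h where "h = (\<lambda>w z. (\<Sum>a\<le>n. c a * w ^ a * (1 + z) ^ (n - a)) / (1 + z) ^ (n + 2))"
  have h: "h \<in> P_tilde (Suc n)"
    unfolding P_tilde_def h_def by (intro CollectI exI[of _ c]) (simp add: atMost_atLeast0)
  show ?thesis
  proof
    show "(\<lambda>w z. (f w z + h w z * (1 + z), g w z - h w z * w)) \<in> tangential_space (Suc n)"
      unfolding tangential_space_def using f(1) g(1) h
      by (intro CollectI exI[of _ f] exI[of _ g] exI[of _ h]) simp
    fix w z :: real assume z: "z \<ge> 0"
    have hz: "h w z = (\<Sum>a\<le>n. c a * w ^ a * (1 / (1 + z)) ^ (2 + a))"
      unfolding h_def by (rule P_tilde_expand[OF z])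
    have "h w z * (1 + z) = (\<Sum>i\<le>n. c i * w ^ i * (1 / (1 + z)) ^ (1 + i))"
      unfolding hz sum_distrib_right using z by (intro sum.cong refl) simp
    moreover have "g w z - h w z * w = (\<Sum>i\<le>n. (G i w - c i * w ^ Suc i) * (1 / (1 + z)) ^ (2 + i))"
      unfolding hz g(2)[OF z] sum_distrib_right sum_subtractf[symmetric]
      by (intro sum.cong refl) (unfold left_diff_distrib, simp only: power_Suc mult_ac)
    ultimately show "(f w z + h w z * (1 + z), g w z - h w z * w) =
      ((\<Sum>i\<le>n. F i w * (1 / (1 + z)) ^ (2 + i)) + (\<Sum>i\<le>n. c i * w ^ i * (1 / (1 + z)) ^ (1 + i)),
       \<Sum>i\<le>n. (G i w - c i * w ^ Suc i) * (1 / (1 + z)) ^ (2 + i))"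
      by (simp only: f(2)[OF z])
  qed
qed

lemma sum_merge_shift:
  fixes A B :: "nat \<Rightarrow> real"
  shows "(\<Sum>i\<le>n. A i * s ^ (2 + i)) + (\<Sum>i\<le>n. B i * s ^ (1 + i)) =
    (\<Sum>i\<le>Suc n. ((if i = 0 then 0 else A (i - 1)) + (if i \<le> n then B i else 0)) * s ^ (1 + i))"
proof -
  have "(\<Sum>i\<le>Suc n. (if i = 0 then 0 else A (i - 1)) * s ^ (1 + i)) = (\<Sum>i\<le>n. A i * s ^ (2 + i))"
    unfolding sum.atMost_Suc_shift by simp
  moreover have "(\<Sum>i\<le>Suc n. (if i \<le> n then B i else 0) * s ^ (1 + i)) = (\<Sum>i\<le>n. B i * s ^ (1 + i))"
    by (simp add: sum.atMost_Suc)
  ultimately show ?thesis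
    by (simp only: distrib_right sum.distrib)
qed

text \<open>Comparing coefficients, p_i = F_(i-1) + c_i x^i and w_i = G_i - c_i x^(i+1), with
  F_(i-1) of degree at most i - 1 and G_i of degree at most i. So c_i is the coefficient of x^i in
  p_i and cancels in x p_i + w_i. At index n + 1 there is no c, hence the sharper bound on
  \<open>p (Suc n)\<close>.\<close>

lemma on_strip_tangential_iff:
  assumes p: "\<And>i. i \<le> Suc n \<Longrightarrow> p i \<in> Pol N" and pn: "p (Suc n) \<in> Pol n"
    and w: "\<And>i. i \<le> n \<Longrightarrow> w i \<in> Pol N"
    and h: "\<And>x z. 0 \<le> x \<Longrightarrow> x \<le> 1 \<Longrightarrow> z \<ge> 0 \<Longrightarrow> h x z =
      (\<Sum>i\<le>Suc n. p i x * (1 / (1 + z)) ^ (1 + i), \<Sum>i\<le>n. w i x * (1 / (1 + z)) ^ (2 + i))"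
  shows "on_strip h (tangential_space (Suc n)) \<longleftrightarrow>
    (\<forall>i\<le>n. p i \<in> Pol i \<and> (\<lambda>x. x * p i x + w i x) \<in> Pol i)"
proof
  assume "on_strip h (tangential_space (Suc n))"
  then obtain u where u: "u \<in> tangential_space (Suc n)" "\<And>x z. 0 \<le> x \<Longrightarrow> x \<le> 1 \<Longrightarrow> z \<ge> 0 \<Longrightarrow> h x z = u x z"
    unfolding on_strip_def by fastforce
  obtain F G c where F: "\<And>i. i \<le> n \<Longrightarrow> F i \<in> Pol i" and G: "\<And>i. i \<le> n \<Longrightarrow> G i \<in> Pol i"
    and uF: "\<And>w z. z \<ge> 0 \<Longrightarrow> u w z =
      ((\<Sum>i\<le>n. F i w * (1 / (1 + z)) ^ (2 + i)) + (\<Sum>i\<le>n. c i * w ^ i * (1 / (1 + z)) ^ (1 + i)),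
       \<Sum>i\<le>n. (G i w - c i * w ^ Suc i) * (1 / (1 + z)) ^ (2 + i))"
    using tangential_space_expand[OF u(1)] by blast
  let ?g = "\<lambda>i x. (if i = 0 then 0 else F (i - 1) x) + (if i \<le> n then c i * x ^ i else 0)"
  have gP: "?g i \<in> Pol i" if "i \<le> Suc n" for i
  proof (rule Pol_add)
    show "(\<lambda>x. if i = 0 then 0 else F (i - 1) x) \<in> Pol i"
      using Pol_mono[of "i - 1" i "F (i - 1)"] F[of "i - 1"] that by (cases i) auto
    show "(\<lambda>x. if i \<le> n then c i * x ^ i else 0) \<in> Pol i"
      using Pol_monom[of i i "c i"] by (cases "i \<le> n") auto
  qed
  have pg: "p i = ?g i" if "i \<le> Suc n" for i
  proof (rule strip_coeffs_unique[where f = p and n = "Suc n" and m = 1 and N = "\<lambda>_. N" and M = "\<lambda>i. i"])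
    fix x z :: real assume xz: "0 \<le> x" "x \<le> 1" "z \<ge> 0"
    show "(\<Sum>i\<le>Suc n. p i x * (1 / (1 + z)) ^ (1 + i)) = (\<Sum>i\<le>Suc n. ?g i x * (1 / (1 + z)) ^ (1 + i))"
      using h[OF xz] u(2)[OF xz] uF[OF xz(3), of x] by (simp only: prod.inject sum_merge_shift)
  qed (use p gP that in auto)
  have wG: "w i = (\<lambda>x. G i x - c i * x ^ Suc i)" if "i \<le> n" for i
  proof (rule strip_coeffs_unique[where f = w and n = n and m = 2 and N = "\<lambda>_. N" and M = "\<lambda>i. Suc i"
      and g = "\<lambda>i x. G i x - c i * x ^ Suc i"])
    fix i assume "i \<le> n"
    then show "(\<lambda>x. G i x - c i * x ^ Suc i) \<in> Pol (Suc i)"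
      using Pol_mono[of i "Suc i"] G by (intro Pol_diff Pol_monom) auto
  next
    fix x z :: real assume xz: "0 \<le> x" "x \<le> 1" "z \<ge> 0"
    show "(\<Sum>i\<le>n. w i x * (1 / (1 + z)) ^ (2 + i)) =
        (\<Sum>i\<le>n. (G i x - c i * x ^ Suc i) * (1 / (1 + z)) ^ (2 + i))"
      using h[OF xz] u(2)[OF xz] uF[OF xz(3), of x] by (simp only: prod.inject)
  qed (use w that in auto)
  show "\<forall>i\<le>n. p i \<in> Pol i \<and> (\<lambda>x. x * p i x + w i x) \<in> Pol i"
  proof (intro allI impI conjI)
    fix i assume i: "i \<le> n"
    show "p i \<in> Pol i"
      using gP[of i] pg[of i] i by simp
    have "(\<lambda>x. x * p i x + w i x) = (\<lambda>x. x * (if i = 0 then 0 else F (i - 1) x) + G i x)"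
      using i pg[of i] wG[of i] by (simp add: algebra_simps)
    moreover have "(\<lambda>x. x * (if i = 0 then 0 else F (i - 1) x)) \<in> Pol i"
      using Pol_mult_x[OF F[of "i - 1"]] i by (cases i) auto
    ultimately show "(\<lambda>x. x * p i x + w i x) \<in> Pol i"
      using Pol_add G[OF i] by presburger
  qed
next
  assume A: "\<forall>i\<le>n. p i \<in> Pol i \<and> (\<lambda>x. x * p i x + w i x) \<in> Pol i"
  \<comment> \<open>At index 0 there is no F to take up a remainder, so p_0 must equal c_0
    exactly.\<close>
  have "\<exists>c. if i = 0 then (\<lambda>x. p i x - c * x ^ i) = (\<lambda>x. 0) else (\<lambda>x. p i x - c * x ^ i) \<in> Pol (i - 1)"
    if i: "i \<le> n" for i
  proof (cases i)
    case 0
    then obtain c where "p i = (\<lambda>x. \<Sum>a\<le>0. c a * x ^ a)"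
      using Pol_coeffs[of "p i" 0] A i by blast
    then show ?thesis
      using 0 by (auto intro!: exI[of _ "c 0"])
  next
    case (Suc j)
    then obtain c where "(\<lambda>x. p i x - c * x ^ i) \<in> Pol j"
      using Pol_drop_top[of "p i" j] A i by auto
    then show ?thesis
      using Suc by auto
  qed
  then obtain c where c: "\<And>i. i \<le> n \<Longrightarrow> if i = 0 then (\<lambda>x. p i x - c i * x ^ i) = (\<lambda>x. 0)
      else (\<lambda>x. p i x - c i * x ^ i) \<in> Pol (i - 1)"
    by metis
  \<comment> \<open>The offset is 2 here and 1 for \<open>p\<close>, hence \<open>Suc i\<close>; the
    last one, \<open>p (Suc n)\<close>, has no monomial to give up.\<close>
  let ?F = "\<lambda>i x. if i < n then p (Suc i) x - c (Suc i) * x ^ Suc i else p (Suc i) x"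
  let ?G = "\<lambda>i x. w i x + c i * x ^ Suc i"
  have F: "?F i \<in> Pol i" if "i \<le> n" for i
    using c[of "Suc i"] pn that by (cases "i < n") auto
  have G: "?G i \<in> Pol i" if "i \<le> n" for i
  proof -
    have "?G i = (\<lambda>x. (x * p i x + w i x) - x * (p i x - c i * x ^ i))"
      by (simp add: algebra_simps)
    moreover have "(\<lambda>x. x * (p i x - c i * x ^ i)) \<in> Pol i"
    proof (cases i)
      case 0
      then have "(\<lambda>x. p i x - c i * x ^ i) = (\<lambda>x. 0)"
        using c[OF that] by simp
      then have "p i x - c i * x ^ i = 0" for x
        by meson
      then show ?thesis
        by simp
    next
      case (Suc j)
      then show ?thesis
        using Pol_mult_x[of "\<lambda>x. p i x - c i * x ^ i" j] c[OF that] by simp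
    qed
    ultimately show ?thesis
      using A that Pol_diff by presburger
  qed
  obtain u where u: "u \<in> tangential_space (Suc n)"
    "\<And>w z. z \<ge> 0 \<Longrightarrow> u w z =
      ((\<Sum>i\<le>n. ?F i w * (1 / (1 + z)) ^ (2 + i)) + (\<Sum>i\<le>n. c i * w ^ i * (1 / (1 + z)) ^ (1 + i)),
       \<Sum>i\<le>n. (?G i w - c i * w ^ Suc i) * (1 / (1 + z)) ^ (2 + i))"
    using tangential_space_collect[of n ?F ?G, OF F G] by blast
  have pF: "p i x = (if i = 0 then 0 else ?F (i - 1) x) + (if i \<le> n then c i * x ^ i else 0)" if "i \<le> Suc n" for i x
  proof (cases i)
    case 0
    then have "(\<lambda>x. p i x - c i * x ^ i) = (\<lambda>x. 0)"
      using c[of i] by simp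
    then have "p i x - c i * x ^ i = 0"
      by meson
    then show ?thesis
      using 0 by simp
  qed (use that in auto)
  have "h x z = u x z" if xz: "0 \<le> x" "x \<le> 1" "z \<ge> 0" for x z
  proof -
    have "(\<Sum>i\<le>Suc n. p i x * (1 / (1 + z)) ^ (1 + i)) =
      (\<Sum>i\<le>Suc n. ((if i = 0 then 0 else ?F (i - 1) x) + (if i \<le> n then c i * x ^ i else 0)) * (1 / (1 + z)) ^ (1 + i))"
      by (intro sum.cong refl) (subst pF, auto)
    then show ?thesis
      unfolding h[OF xz] u(2)[OF xz(3)] sum_merge_shift by simp
  qed
  then show "on_strip h (tangential_space (Suc n))"
    unfolding on_strip_def using u(1) by (intro bexI[of _ u]) auto
qed

section \<open>The spaces in terms of coefficient families\<close>

lemma Omega_inf_edge: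
  assumes "0 \<le> w" "w \<le> (1::real)" "z \<ge> 0" "e \<in> {0, 1}"
  shows "(vector [w, e, z] :: real^3) \<in> Omega_inf" "(vector [e, w, z] :: real^3) \<in> Omega_inf"
  using assms by (auto simp: Omega_inf_def)

lemma ser_edge_iff:
  assumes f: "\<And>i. f i \<in> Q2 l l'" and u: "\<And>p. p \<in> Omega_inf \<Longrightarrow> u p = ser m n f p" and e: "e \<in> {0, 1}"
  shows "on_strip (\<lambda>x z. u (vector [x, e, z])) (P_frac (int n) (n + m)) \<longleftrightarrow> (\<forall>i\<le>n. (\<lambda>x. f i x e) \<in> Pol i)"
    and "on_strip (\<lambda>y z. u (vector [e, y, z])) (P_frac (int n) (n + m)) \<longleftrightarrow> (\<forall>i\<le>n. (\<lambda>y. f i e y) \<in> Pol i)"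
proof -
  show "on_strip (\<lambda>x z. u (vector [x, e, z])) (P_frac (int n) (n + m)) \<longleftrightarrow> (\<forall>i\<le>n. (\<lambda>x. f i x e) \<in> Pol i)"
    by (rule on_strip_P_frac_iff[OF Q2_Pol_edge_x[OF f]]) (subst u, use e in \<open>auto simp: Omega_inf_edge ser_def\<close>)
  show "on_strip (\<lambda>y z. u (vector [e, y, z])) (P_frac (int n) (n + m)) \<longleftrightarrow> (\<forall>i\<le>n. (\<lambda>y. f i e y) \<in> Pol i)"
    by (rule on_strip_P_frac_iff[OF Q2_Pol_edge_y[OF f]]) (subst u, use e in \<open>auto simp: Omega_inf_edge ser_def\<close>)
qed

lemma ser_drop_top: "f (Suc n) = (\<lambda>x y. 0) \<Longrightarrow> ser m (Suc n) f p = ser m n f p"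
  by (simp add: ser_def)

lemma U0_inf_iff:
  "u \<in> U0_inf k \<longleftrightarrow> u \<in> extensional Omega_inf \<and> (\<exists>f. cochain0 k f \<and> (\<forall>p\<in>Omega_inf. u p = ser 0 k f p))"
proof
  assume "u \<in> U0_inf k"
  then obtain q c where ext: "u \<in> extensional Omega_inf" and q: "q \<in> Q_frac (int k) (int k) (int k - 1) (k + 0)"
    and u: "\<And>p. p \<in> Omega_inf \<Longrightarrow> u p = q p + c * ((p$3) ^ k / (1 + p$3) ^ k)"
    and edges: "\<And>e. e \<in> {0, 1} \<Longrightarrow> on_strip (\<lambda>x z. u (vector [x, e, z])) (P_frac (int k) (k + 0))"
      "\<And>e. e \<in> {0, 1} \<Longrightarrow> on_strip (\<lambda>y z. u (vector [e, y, z])) (P_frac (int k) (k + 0))"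
    unfolding U0_inf_def by auto
  have c: "(\<lambda>x y. c) \<in> Q2 (int k) (int k)"
    using Q2_monom[of 0 "int k" 0 "int k" c] by simp
  obtain f where f: "\<And>i. f i \<in> Q2 (int k) (int k)" "f 0 = (\<lambda>x y. c)" "\<And>i. i > k \<Longrightarrow> f i = (\<lambda>x y. 0)"
    and qf: "\<And>p. p \<in> Omega_inf \<Longrightarrow> q p + c * ((p$3) ^ k / (1 + p$3) ^ (k + 0)) = ser 0 k f p"
    by (rule Q_frac_expand[OF q c order_refl]) (rule that)
  have uf: "u p = ser 0 k f p" if "p \<in> Omega_inf" for p
    using u[OF that] qf[OF that] by simp
  have "(\<lambda>x. f j x e) \<in> Pol j \<and> (\<lambda>y. f j e y) \<in> Pol j" if e: "e \<in> {0, 1}" for j e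
  proof (cases "j \<le> k")
    case True
    then show ?thesis
      using edges[OF e] ser_edge_iff[where u = u, OF f(1) uf e] by blast
  qed (use f(3) in auto)
  then have "cochain0 k f"
    using f unfolding cochain0_def by blast
  then show "u \<in> extensional Omega_inf \<and> (\<exists>f. cochain0 k f \<and> (\<forall>p\<in>Omega_inf. u p = ser 0 k f p))"
    using ext uf by blast
next
  assume "u \<in> extensional Omega_inf \<and> (\<exists>f. cochain0 k f \<and> (\<forall>p\<in>Omega_inf. u p = ser 0 k f p))"
  then obtain f where ext: "u \<in> extensional Omega_inf" and C: "cochain0 k f"
    and uf: "\<And>p. p \<in> Omega_inf \<Longrightarrow> u p = ser 0 k f p"
    by blast
  have f: "\<And>i. f i \<in> Q2 (int k) (int k)"
    using C by (auto simp: cochain0_def)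
  obtain c where c: "f 0 = (\<lambda>x y. c)"
    using C by (auto simp: cochain0_def)
  obtain q where q: "q \<in> Q_frac (int k) (int k) (int k - 1) (k + 0)"
    and qf: "\<And>p. p \<in> Omega_inf \<Longrightarrow> q p + f 0 (p$1) (p$2) * ((p$3) ^ k / (1 + p$3) ^ (k + 0)) = ser 0 k f p"
    by (rule Q_frac_collect[OF f order_refl]) (rule that)
  have edges: "on_strip (\<lambda>x z. u (vector [x, e, z])) (P_frac (int k) (k + 0))"
    "on_strip (\<lambda>y z. u (vector [e, y, z])) (P_frac (int k) (k + 0))" if e: "e \<in> {0, 1}" for e
    using C e ser_edge_iff[where u = u, OF f uf e] unfolding cochain0_def by blast+
  show "u \<in> U0_inf k"
    unfolding U0_inf_def
  proof (intro CollectI conjI ballI ext bexI exI)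
    show "u p = q p + c * ((p$3) ^ k / (1 + p$3) ^ k)" if "p \<in> Omega_inf" for p
      using uf[OF that] qf[OF that] by (simp add: c)
  qed (use q edges in auto)
qed

lemma U3_inf_iff:
  "u \<in> U3_inf k \<longleftrightarrow> u \<in> extensional Omega_inf \<and> (\<exists>f. cochain3 k f \<and> (\<forall>p\<in>Omega_inf. u p = ser 4 k f p))"
proof
  assume "u \<in> U3_inf k"
  then obtain q where ext: "u \<in> extensional Omega_inf" and q: "q \<in> Q_frac (int k - 1) (int k - 1) (int k - 1) (k + 3)"
    and u: "\<And>p. p \<in> Omega_inf \<Longrightarrow> u p = q p"
    unfolding U3_inf_def by auto
  \<comment> \<open>Without an extra summand the coefficient of s^3 is 0; dropping it leaves an
    expansion with offset 4.\<close>
  obtain f where f: "\<And>i. f i \<in> Q2 (int k - 1) (int k - 1)" "f 0 = (\<lambda>x y. 0)" "\<And>i. i > k \<Longrightarrow> f i = (\<lambda>x y. 0)"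
    and qf: "\<And>p. p \<in> Omega_inf \<Longrightarrow> q p + 0 * ((p$3) ^ k / (1 + p$3) ^ (k + 3)) = ser 3 k f p"
    by (rule Q_frac_expand[OF q Q2_zero order_refl]) (rule that)
  have "ser 3 k f p = ser 4 k (\<lambda>i. f (Suc i)) p" for p
  proof -
    have "ser 3 k f p = ser 3 (Suc k) f p"
      using f(3) by (simp add: ser_drop_top)
    also have "\<dots> = ser 4 k (\<lambda>i. f (Suc i)) p"
      unfolding ser_def sum.atMost_Suc_shift by (simp add: f(2) eval_nat_numeral)
    finally show ?thesis .
  qed
  then have "u p = ser 4 k (\<lambda>i. f (Suc i)) p" if "p \<in> Omega_inf" for p
    using u[OF that] qf[OF that] by simp
  moreover have "cochain3 k (\<lambda>i. f (Suc i))"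
    using f by (auto simp: cochain3_def)
  ultimately show "u \<in> extensional Omega_inf \<and> (\<exists>f. cochain3 k f \<and> (\<forall>p\<in>Omega_inf. u p = ser 4 k f p))"
    using ext by blast
next
  assume "u \<in> extensional Omega_inf \<and> (\<exists>f. cochain3 k f \<and> (\<forall>p\<in>Omega_inf. u p = ser 4 k f p))"
  then obtain f where ext: "u \<in> extensional Omega_inf" and C: "cochain3 k f"
    and uf: "\<And>p. p \<in> Omega_inf \<Longrightarrow> u p = ser 4 k f p"
    by blast
  let ?f = "\<lambda>i. case i of 0 \<Rightarrow> (\<lambda>x y. 0) | Suc i \<Rightarrow> f i"
  have f: "?f i \<in> Q2 (int k - 1) (int k - 1)" for i
    using C by (auto simp: cochain3_def split: nat.split)
  obtain q where q: "q \<in> Q_frac (int k - 1) (int k - 1) (int k - 1) (k + 3)"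
    and qf: "\<And>p. p \<in> Omega_inf \<Longrightarrow> q p + ?f 0 (p$1) (p$2) * ((p$3) ^ k / (1 + p$3) ^ (k + 3)) = ser 3 k ?f p"
    by (rule Q_frac_collect[OF f order_refl]) (rule that)
  have "ser 3 k ?f p = ser 4 k f p" for p
  proof -
    have "ser 3 k ?f p = ser 3 (Suc k) ?f p"
      using C by (subst ser_drop_top) (auto simp: cochain3_def)
    also have "\<dots> = ser 4 k f p"
      unfolding ser_def sum.atMost_Suc_shift by (simp add: eval_nat_numeral)
    finally show ?thesis .
  qed
  then show "u \<in> U3_inf k"
    unfolding U3_inf_def using ext q qf uf by (intro CollectI conjI bexI[of _ q]) auto
qed

text \<open>The extra summands start the three components with 2 t s^3, 2 s s^3 (the first s being
  the polynomial) and (t_x + s_y) s^2, which is the relation for \<open>c 0\<close>. Above these the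
  fractions supply k - 1, k - 1 and k further powers.\<close>

lemma U2_inf_iff:
  assumes "k \<ge> 1"
  shows "u \<in> U2_inf k \<longleftrightarrow> u \<in> extensional Omega_inf \<and> (\<exists>a b c. cochain2 k a b c \<and>
    (\<forall>p\<in>Omega_inf. u p = vector [ser 3 k a p, ser 3 k b p, ser 2 k c p]))"
proof -
  obtain n where k: "k = Suc n"
    using assms by (cases k) auto
  show ?thesis
  proof
    assume U: "u \<in> U2_inf k"
    have k': "k - 1 = n" "k + 2 = n + 3" "int k - 2 = int n - 1"
      by (auto simp: k)
    from U obtain q1 q2 q3 s t where ext: "u \<in> extensional Omega_inf"
      and q1: "q1 \<in> Q_frac (int k) (int k - 1) (int n - 1) (n + 3)"
      and q2: "q2 \<in> Q_frac (int k - 1) (int k) (int n - 1) (n + 3)"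
      and q3': "q3 \<in> Q_frac (int k - 1) (int k - 1) (int k - 1) (n + 3)"
      and s: "s \<in> Q2 (int k - 1) (int k)" and t: "t \<in> Q2 (int k) (int k - 1)"
      and u: "\<forall>p\<in>Omega_inf. u p = vector [q1 p, q2 p, q3 p] +
          ((p$3) ^ n / (1 + p$3) ^ (n + 3)) *\<^sub>R
            vector [0, 2 * s (p$1) (p$2), dy s (p$1) (p$2) * (1 + p$3)] +
          ((p$3) ^ n / (1 + p$3) ^ (n + 3)) *\<^sub>R
            vector [2 * t (p$1) (p$2), 0, dx t (p$1) (p$2) * (1 + p$3)]"
      and edges': "\<forall>e\<in>{0, 1}. on_strip (\<lambda>x z. u (vector [x, e, z]) $ 2) (P_frac (int k - 1) (n + 3))"
        "\<forall>e\<in>{0, 1}. on_strip (\<lambda>y z. u (vector [e, y, z]) $ 1) (P_frac (int k - 1) (n + 3))"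
      unfolding U2_inf_def k' by (elim CollectE conjE bexE) (rule that)
    have q3: "q3 \<in> Q_frac (int k - 1) (int k - 1) (int k - 1) (k + 2)"
      using q3' unfolding k' .
    have "int k - 1 = int n"
      by (simp add: k)
    note edges = edges'[unfolded this, rule_format]
    have t2: "(\<lambda>x y. 2 * t x y) \<in> Q2 (int k) (int k - 1)" and s2: "(\<lambda>x y. 2 * s x y) \<in> Q2 (int k - 1) (int k)"
      and st: "(\<lambda>x y. dx t x y + dy s x y) \<in> Q2 (int k - 1) (int k - 1)"
      using Q2_dx[OF t] Q2_dy[OF s] by (auto intro!: Q2_add Q2_cmult s t)
    obtain a where a: "\<And>i. a i \<in> Q2 (int k) (int k - 1)" "a 0 = (\<lambda>x y. 2 * t x y)" "\<And>i. i > n \<Longrightarrow> a i = (\<lambda>x y. 0)"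
      and qa: "\<And>p. p \<in> Omega_inf \<Longrightarrow> q1 p + 2 * t (p$1) (p$2) * ((p$3) ^ n / (1 + p$3) ^ (n + 3)) = ser 3 n a p"
      by (rule Q_frac_expand[OF q1 t2 order_refl]) (rule that)
    obtain b where b: "\<And>i. b i \<in> Q2 (int k - 1) (int k)" "b 0 = (\<lambda>x y. 2 * s x y)" "\<And>i. i > n \<Longrightarrow> b i = (\<lambda>x y. 0)"
      and qb: "\<And>p. p \<in> Omega_inf \<Longrightarrow> q2 p + 2 * s (p$1) (p$2) * ((p$3) ^ n / (1 + p$3) ^ (n + 3)) = ser 3 n b p"
      by (rule Q_frac_expand[OF q2 s2 order_refl]) (rule that)
    have "n \<le> k"
      by (simp add: k)
    then obtain c where c: "\<And>i. c i \<in> Q2 (int k - 1) (int k - 1)" "c 0 = (\<lambda>x y. dx t x y + dy s x y)" "\<And>i. i > k \<Longrightarrow> c i = (\<lambda>x y. 0)"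
      and qc: "\<And>p. p \<in> Omega_inf \<Longrightarrow> q3 p + (dx t (p$1) (p$2) + dy s (p$1) (p$2)) * ((p$3) ^ n / (1 + p$3) ^ (n + 2)) = ser 2 k c p"
      by (rule Q_frac_expand[OF q3 st]) (rule that)
    have uabc: "u p = vector [ser 3 n a p, ser 3 n b p, ser 2 k c p]" if p: "p \<in> Omega_inf" for p
    proof -
      have z: "1 + p$3 \<noteq> 0"
        using p by (auto simp: Omega_inf_def)
      \<comment> \<open>The factor 1 + z in the third component cancels one power of the denominator
        and moves the extra summand to offset 2.\<close>
      have e: "(p$3) ^ n / (1 + p$3) ^ (n + 3) * (1 + p$3) = (p$3) ^ n / (1 + p$3) ^ (n + 2)"
        using z by (simp add: eval_nat_numeral)
      have "A * (s' * T) + A * (t' * T) = (t' + s') * (A * T)" for A T s' t' :: real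
        by (simp add: algebra_simps)
      note h = this[of "(p$3) ^ n / (1 + p$3) ^ (n + 3)" "dy s (p$1) (p$2)" "1 + p$3" "dx t (p$1) (p$2)", unfolded e]
      show ?thesis
        unfolding bspec[OF u p] vec3_eq_iff qa[OF p, symmetric] qb[OF p, symmetric] qc[OF p, symmetric]
        by (intro conjI; use h in simp)
    qed
    have "(\<lambda>y. a i e y) \<in> Pol i \<and> (\<lambda>x. b i x e) \<in> Pol i" if e: "e \<in> {0, 1}" for i e
    proof (cases "i \<le> n")
      case True
      have "u p $ 1 = ser 3 n a p" "u p $ 2 = ser 3 n b p" if "p \<in> Omega_inf" for p
        using uabc[OF that] by simp_all
      then show ?thesis
        using edges[OF e] ser_edge_iff(2)[where u = "\<lambda>p. u p $ 1" and f = a and m = 3 and n = n, OF a(1) _ e]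
          ser_edge_iff(1)[where u = "\<lambda>p. u p $ 2" and f = b and m = 3 and n = n, OF b(1) _ e] True by blast
    qed (use a b in auto)
    then have "cochain2 k a b c"
      unfolding cochain2_def using a b c dx_cmult[OF t] dy_cmult[OF s] by (auto simp: k add_divide_distrib)
    moreover have "u p = vector [ser 3 k a p, ser 3 k b p, ser 2 k c p]" if "p \<in> Omega_inf" for p
      using uabc[OF that] a(3) b(3) by (simp add: k ser_drop_top)
    ultimately show "u \<in> extensional Omega_inf \<and> (\<exists>a b c. cochain2 k a b c \<and>
      (\<forall>p\<in>Omega_inf. u p = vector [ser 3 k a p, ser 3 k b p, ser 2 k c p]))"
      using ext by blast
  next
    assume "u \<in> extensional Omega_inf \<and> (\<exists>a b c. cochain2 k a b c \<and>
      (\<forall>p\<in>Omega_inf. u p = vector [ser 3 k a p, ser 3 k b p, ser 2 k c p]))"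
    then obtain a b c where ext: "u \<in> extensional Omega_inf" and C: "cochain2 k a b c"
      and u: "\<And>p. p \<in> Omega_inf \<Longrightarrow> u p = vector [ser 3 k a p, ser 3 k b p, ser 2 k c p]"
      by blast
    note Q = cochain2_Q2[OF C]
    have z: "a (Suc n) = (\<lambda>x y. 0)" "b (Suc n) = (\<lambda>x y. 0)"
      and c0: "c 0 = (\<lambda>x y. (dx (a 0) x y + dy (b 0) x y) / 2)"
      using C by (auto simp: cochain2_def k)
    obtain q1 where q1: "q1 \<in> Q_frac (int k) (int k - 1) (int n - 1) (n + 3)"
      and qa: "\<And>p. p \<in> Omega_inf \<Longrightarrow> q1 p + a 0 (p$1) (p$2) * ((p$3) ^ n / (1 + p$3) ^ (n + 3)) = ser 3 n a p"
      by (rule Q_frac_collect[OF Q(1) order_refl]) (rule that)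
    obtain q2 where q2: "q2 \<in> Q_frac (int k - 1) (int k) (int n - 1) (n + 3)"
      and qb: "\<And>p. p \<in> Omega_inf \<Longrightarrow> q2 p + b 0 (p$1) (p$2) * ((p$3) ^ n / (1 + p$3) ^ (n + 3)) = ser 3 n b p"
      by (rule Q_frac_collect[OF Q(2) order_refl]) (rule that)
    have "n \<le> k"
      by (simp add: k)
    with Q(3) obtain q3 where q3: "q3 \<in> Q_frac (int k - 1) (int k - 1) (int k - 1) (k + 2)"
      and qc: "\<And>p. p \<in> Omega_inf \<Longrightarrow> q3 p + c 0 (p$1) (p$2) * ((p$3) ^ n / (1 + p$3) ^ (n + 2)) = ser 2 k c p"
      by (rule Q_frac_collect) (rule that)
    let ?s = "\<lambda>x y. b 0 x y / 2" and ?t = "\<lambda>x y. a 0 x y / 2"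
    have st: "dy ?s = (\<lambda>x y. dy (b 0) x y / 2)" "dx ?t = (\<lambda>x y. dx (a 0) x y / 2)"
      using dy_cmult[OF Q(2), of "1 / 2"] dx_cmult[OF Q(1), of "1 / 2"] by simp_all
    have ud: "u p = vector [q1 p, q2 p, q3 p] +
          ((p$3) ^ (k - 1) / (1 + p$3) ^ (k + 2)) *\<^sub>R
            vector [0, 2 * ?s (p$1) (p$2), dy ?s (p$1) (p$2) * (1 + p$3)] +
          ((p$3) ^ (k - 1) / (1 + p$3) ^ (k + 2)) *\<^sub>R
            vector [2 * ?t (p$1) (p$2), 0, dx ?t (p$1) (p$2) * (1 + p$3)]" if p: "p \<in> Omega_inf" for p
    proof -
      have z': "1 + p$3 \<noteq> 0"
        using p by (auto simp: Omega_inf_def)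
      have e: "(p$3) ^ n / (1 + p$3) ^ (n + 3) * (1 + p$3) = (p$3) ^ n / (1 + p$3) ^ (n + 2)"
        using z' by (simp add: eval_nat_numeral)
      have k': "k - 1 = n" "k + 2 = n + 3"
        by (auto simp: k)
      have abn: "ser 3 k a p = ser 3 n a p" "ser 3 k b p = ser 3 n b p"
        using z by (simp_all add: k ser_drop_top)
      have "A * (s' / 2 * T) + A * (t' / 2 * T) = (t' + s') / 2 * (A * T)" for A T s' t' :: real
        by (simp add: algebra_simps)
      note h = this[of "(p$3) ^ n / (1 + p$3) ^ (n + 3)" "dy (b 0) (p$1) (p$2)" "1 + p$3" "dx (a 0) (p$1) (p$2)", unfolded e]
      show ?thesis
        unfolding u[OF p] k' vec3_eq_iff st abn qa[OF p, symmetric] qb[OF p, symmetric] qc[OF p, symmetric] c0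
        by (intro conjI; use h in simp)
    qed
    have edges: "on_strip (\<lambda>x z. u (vector [x, e, z]) $ 2) (P_frac (int n) (n + 3))"
      "on_strip (\<lambda>y z. u (vector [e, y, z]) $ 1) (P_frac (int n) (n + 3))" if e: "e \<in> {0, 1}" for e
    proof -
      have "u p $ 1 = ser 3 n a p" "u p $ 2 = ser 3 n b p" if "p \<in> Omega_inf" for p
        using u[OF that] z by (simp_all add: k ser_drop_top)
      moreover have "(\<lambda>y. a i e y) \<in> Pol i" "(\<lambda>x. b i x e) \<in> Pol i" for i
        using C e unfolding cochain2_def by blast+
      ultimately show "on_strip (\<lambda>x z. u (vector [x, e, z]) $ 2) (P_frac (int n) (n + 3))"
        "on_strip (\<lambda>y z. u (vector [e, y, z]) $ 1) (P_frac (int n) (n + 3))"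
        using ser_edge_iff(2)[where u = "\<lambda>p. u p $ 1" and f = a and m = 3 and n = n, OF Q(1) _ e]
          ser_edge_iff(1)[where u = "\<lambda>p. u p $ 2" and f = b and m = 3 and n = n, OF Q(2) _ e] by blast+
    qed
    show "u \<in> U2_inf k"
      unfolding U2_inf_def
    proof (intro CollectI conjI ballI ext bexI)
      show "u p = vector [q1 p, q2 p, q3 p] +
          ((p$3) ^ (k - 1) / (1 + p$3) ^ (k + 2)) *\<^sub>R
            vector [0, 2 * ?s (p$1) (p$2), dy ?s (p$1) (p$2) * (1 + p$3)] +
          ((p$3) ^ (k - 1) / (1 + p$3) ^ (k + 2)) *\<^sub>R
            vector [2 * ?t (p$1) (p$2), 0, dx ?t (p$1) (p$2) * (1 + p$3)]" if "p \<in> Omega_inf" for p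
        by (rule ud[OF that])
    next
      have k': "int k - 1 = int n" "k + 2 = n + 3" "int k - 2 = int n - 1"
        by (auto simp: k)
      show "on_strip (\<lambda>x z. u (vector [x, e, z]) $ 2) (P_frac (int k - 1) (k + 2))"
        "on_strip (\<lambda>y z. u (vector [e, y, z]) $ 1) (P_frac (int k - 1) (k + 2))" if "e \<in> {0, 1}" for e
        unfolding k' by (rule edges[OF that])+
      show "q1 \<in> Q_frac (int k) (int k - 1) (int k - 2) (k + 2)"
        "q2 \<in> Q_frac (int k - 1) (int k) (int k - 2) (k + 2)"
        using q1 q2 unfolding k'(2,3) .
    qed (use q3 Q in \<open>auto intro: Q2_divc\<close>)
  qed
qed

text \<open>The sharper bound at index n + 1 that \<open>on_strip_tangential_iff\<close> demands
  comes from the bidegrees, which limit \<open>p\<close> in x and \<open>q\<close> in y to degree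
  n.\<close>

lemma U1_edge_iff:
  fixes u :: "real^3 \<Rightarrow> real^3"
  assumes p: "\<And>i. p i \<in> Q2 (int n) (int (Suc n))" and q: "\<And>i. q i \<in> Q2 (int (Suc n)) (int n)"
    and w: "\<And>i. w i \<in> Q2 (int (Suc n)) (int (Suc n))" and e: "e \<in> {0, 1}"
    and u: "\<And>P. P \<in> Omega_inf \<Longrightarrow> u P = vector [ser 1 (Suc n) p P, ser 1 (Suc n) q P, ser 2 n w P]"
  shows "on_strip (\<lambda>x z. (u (vector [x, e, z]) $ 1, u (vector [x, e, z]) $ 3)) (tangential_space (Suc n)) \<longleftrightarrow>
      (\<forall>i\<le>n. (\<lambda>x. p i x e) \<in> Pol i \<and> (\<lambda>x. x * p i x e + w i x e) \<in> Pol i)"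
    and "on_strip (\<lambda>y z. (u (vector [e, y, z]) $ 2, u (vector [e, y, z]) $ 3)) (tangential_space (Suc n)) \<longleftrightarrow>
      (\<forall>i\<le>n. (\<lambda>y. q i e y) \<in> Pol i \<and> (\<lambda>y. y * q i e y + w i e y) \<in> Pol i)"
proof -
  have P: "(\<lambda>x. p i x e) \<in> Pol n" "(\<lambda>y. q i e y) \<in> Pol n"
    "(\<lambda>x. p i x e) \<in> Pol (Suc n)" "(\<lambda>y. q i e y) \<in> Pol (Suc n)"
    "(\<lambda>x. w i x e) \<in> Pol (Suc n)" "(\<lambda>y. w i e y) \<in> Pol (Suc n)" for i
    using Q2_Pol_x[OF p] Q2_Pol_y[OF q] Q2_Pol_x[OF w] Q2_Pol_y[OF w] by (auto intro: Pol_mono[of n "Suc n"])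
  show "on_strip (\<lambda>x z. (u (vector [x, e, z]) $ 1, u (vector [x, e, z]) $ 3)) (tangential_space (Suc n)) \<longleftrightarrow>
      (\<forall>i\<le>n. (\<lambda>x. p i x e) \<in> Pol i \<and> (\<lambda>x. x * p i x e + w i x e) \<in> Pol i)"
  proof (rule on_strip_tangential_iff[OF P(3) P(1) P(5)])
    fix x z :: real assume "0 \<le> x" "x \<le> 1" "0 \<le> z"
    note v = u[OF Omega_inf_edge(1)[OF this e]]
    show "(u (vector [x, e, z]) $ 1, u (vector [x, e, z]) $ 3) =
      (\<Sum>i\<le>Suc n. p i x e * (1 / (1 + z)) ^ (1 + i), \<Sum>i\<le>n. w i x e * (1 / (1 + z)) ^ (2 + i))"
      unfolding v by (simp only: vector_3 ser_def)
  qed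
  show "on_strip (\<lambda>y z. (u (vector [e, y, z]) $ 2, u (vector [e, y, z]) $ 3)) (tangential_space (Suc n)) \<longleftrightarrow>
      (\<forall>i\<le>n. (\<lambda>y. q i e y) \<in> Pol i \<and> (\<lambda>y. y * q i e y + w i e y) \<in> Pol i)"
  proof (rule on_strip_tangential_iff[OF P(4) P(2) P(6)])
    fix y z :: real assume "0 \<le> y" "y \<le> 1" "0 \<le> z"
    note v = u[OF Omega_inf_edge(2)[OF this e]]
    show "(u (vector [e, y, z]) $ 2, u (vector [e, y, z]) $ 3) =
      (\<Sum>i\<le>Suc n. q i e y * (1 / (1 + z)) ^ (1 + i), \<Sum>i\<le>n. w i e y * (1 / (1 + z)) ^ (2 + i))"
      unfolding v by (simp only: vector_3 ser_def)
  qed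
qed

text \<open>The factor z beside r_x and r_y raises z^(k-1) to z^k, so these two start at s while -r
  starts at s^2. Together the leading terms are d(s r).\<close>

lemma U1_inf_iff:
  assumes "k \<ge> 1"
  shows "u \<in> U1_inf k \<longleftrightarrow> u \<in> extensional Omega_inf \<and> (\<exists>p q w. cochain1 k p q w \<and>
    (\<forall>P\<in>Omega_inf. u P = vector [ser 1 k p P, ser 1 k q P, ser 2 k w P]))"
proof -
  obtain n where k: "k = Suc n"
    using assms by (cases k) auto
  have k': "k - 1 = n" "k + 1 = n + 2" "int k - 2 = int n - 1" and kn: "int k - 1 = int n"
    by (auto simp: k)
  show ?thesis
  proof
    assume U: "u \<in> U1_inf k"
    from U obtain q1 q2 q3 r where ext: "u \<in> extensional Omega_inf"
      and q1: "q1 \<in> Q_frac (int k - 1) (int k) (int k - 1) (k + 1)"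
      and q2: "q2 \<in> Q_frac (int k) (int k - 1) (int k - 1) (k + 1)"
      and q3: "q3 \<in> Q_frac (int k) (int k) (int k - 2) (k + 1)"
      and r: "r \<in> Q2 (int k) (int k)"
      and u: "\<forall>p\<in>Omega_inf. u p = vector [q1 p, q2 p, q3 p] +
          ((p$3) ^ (k - 1) / (1 + p$3) ^ (k + 1)) *\<^sub>R
            vector [dx r (p$1) (p$2) * p$3, dy r (p$1) (p$2) * p$3, - r (p$1) (p$2)]"
      and edges: "\<forall>e\<in>{0, 1}. on_strip (\<lambda>x z. (u (vector [x, e, z]) $ 1, u (vector [x, e, z]) $ 3)) (tangential_space k)"
        "\<forall>e\<in>{0, 1}. on_strip (\<lambda>y z. (u (vector [e, y, z]) $ 2, u (vector [e, y, z]) $ 3)) (tangential_space k)"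
      unfolding U1_inf_def by (elim CollectE conjE bexE) (rule that)
    have q3': "q3 \<in> Q_frac (int k) (int k) (int n - 1) (n + 2)"
      using q3 unfolding k' .
    obtain p where p: "\<And>i. p i \<in> Q2 (int k - 1) (int k)" "p 0 = dx r" "\<And>i. i > k \<Longrightarrow> p i = (\<lambda>x y. 0)"
      and qp: "\<And>P. P \<in> Omega_inf \<Longrightarrow> q1 P + dx r (P$1) (P$2) * ((P$3) ^ k / (1 + P$3) ^ (k + 1)) = ser 1 k p P"
      by (rule Q_frac_expand[OF q1 Q2_dx[OF r] order_refl]) (rule that)
    obtain q where q: "\<And>i. q i \<in> Q2 (int k) (int k - 1)" "q 0 = dy r" "\<And>i. i > k \<Longrightarrow> q i = (\<lambda>x y. 0)"
      and qq: "\<And>P. P \<in> Omega_inf \<Longrightarrow> q2 P + dy r (P$1) (P$2) * ((P$3) ^ k / (1 + P$3) ^ (k + 1)) = ser 1 k q P"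
      by (rule Q_frac_expand[OF q2 Q2_dy[OF r] order_refl]) (rule that)
    obtain w where w: "\<And>i. w i \<in> Q2 (int k) (int k)" "w 0 = (\<lambda>x y. - r x y)" "\<And>i. i > n \<Longrightarrow> w i = (\<lambda>x y. 0)"
      and qw: "\<And>P. P \<in> Omega_inf \<Longrightarrow> q3 P + - r (P$1) (P$2) * ((P$3) ^ n / (1 + P$3) ^ (n + 2)) = ser 2 n w P"
      by (rule Q_frac_expand[OF q3' Q2_uminus[OF r] order_refl]) (rule that)
    have upqw: "u P = vector [ser 1 k p P, ser 1 k q P, ser 2 n w P]" if P: "P \<in> Omega_inf" for P
      unfolding bspec[OF u P] vec3_eq_iff qp[OF P, symmetric] qq[OF P, symmetric] qw[OF P, symmetric]
      by (simp add: k mult_ac)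
    have edge: "(\<lambda>x. p i x e) \<in> Pol i \<and> (\<lambda>x. x * p i x e + w i x e) \<in> Pol i \<and>
        (\<lambda>y. q i e y) \<in> Pol i \<and> (\<lambda>y. y * q i e y + w i e y) \<in> Pol i" if e: "e \<in> {0, 1}" for e i
    proof (cases "i \<le> n")
      case True
      then show ?thesis
        using U1_edge_iff[OF p(1)[unfolded kn, unfolded k] q(1)[unfolded kn, unfolded k] w(1)[unfolded k] e
            upqw[unfolded k]] edges[unfolded k] e by blast
    next
      \<comment> \<open>From index k on, \<open>w\<close> vanishes and the bidegree bound k - 1
        already implies the face conditions.\<close>
      case False
      then have "w i = (\<lambda>x y. 0)"
        using w(3) by auto
      moreover have "(\<lambda>x. p i x e) \<in> Pol (i - 1)" "(\<lambda>y. q i e y) \<in> Pol (i - 1)" "i = Suc (i - 1)"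
        using False Pol_mono[OF _ Q2_Pol_x[OF p(1)[unfolded kn]], of "i - 1"]
          Pol_mono[OF _ Q2_Pol_y[OF q(1)[unfolded kn]], of "i - 1"] by auto
      ultimately show ?thesis
        using Pol_mult_x[of _ "i - 1"] Pol_mono[of "i - 1" i] by auto
    qed
    have "cochain1 k p q w"
      unfolding cochain1_def
    proof (intro conjI allI impI ballI)
      show "p 0 = (\<lambda>x y. - dx (w 0) x y)" "q 0 = (\<lambda>x y. - dy (w 0) x y)"
        unfolding p(2) q(2) w(2) dx_uminus[OF r] dy_uminus[OF r] by simp_all
    qed (use p q w edge in \<open>auto simp: k\<close>)
    moreover have "u P = vector [ser 1 k p P, ser 1 k q P, ser 2 k w P]" if "P \<in> Omega_inf" for P
      using upqw[OF that] w(3) by (simp add: k ser_drop_top)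
    ultimately show "u \<in> extensional Omega_inf \<and> (\<exists>p q w. cochain1 k p q w \<and>
      (\<forall>P\<in>Omega_inf. u P = vector [ser 1 k p P, ser 1 k q P, ser 2 k w P]))"
      using ext by blast
  next
    assume "u \<in> extensional Omega_inf \<and> (\<exists>p q w. cochain1 k p q w \<and>
      (\<forall>P\<in>Omega_inf. u P = vector [ser 1 k p P, ser 1 k q P, ser 2 k w P]))"
    then obtain p q w where ext: "u \<in> extensional Omega_inf" and C: "cochain1 k p q w"
      and u: "\<And>P. P \<in> Omega_inf \<Longrightarrow> u P = vector [ser 1 k p P, ser 1 k q P, ser 2 k w P]"
      by blast
    note Q = cochain1_Q2[OF C]
    have z: "w (Suc n) = (\<lambda>x y. 0)" and p0: "p 0 = (\<lambda>x y. - dx (w 0) x y)" and q0: "q 0 = (\<lambda>x y. - dy (w 0) x y)"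
      using C by (auto simp: cochain1_def k)
    obtain q1 where q1: "q1 \<in> Q_frac (int k - 1) (int k) (int k - 1) (k + 1)"
      and qp: "\<And>P. P \<in> Omega_inf \<Longrightarrow> q1 P + p 0 (P$1) (P$2) * ((P$3) ^ k / (1 + P$3) ^ (k + 1)) = ser 1 k p P"
      by (rule Q_frac_collect[OF Q(1) order_refl]) (rule that)
    obtain q2 where q2: "q2 \<in> Q_frac (int k) (int k - 1) (int k - 1) (k + 1)"
      and qq: "\<And>P. P \<in> Omega_inf \<Longrightarrow> q2 P + q 0 (P$1) (P$2) * ((P$3) ^ k / (1 + P$3) ^ (k + 1)) = ser 1 k q P"
      by (rule Q_frac_collect[OF Q(2) order_refl]) (rule that)
    obtain q3 where q3: "q3 \<in> Q_frac (int k) (int k) (int n - 1) (n + 2)"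
      and qw: "\<And>P. P \<in> Omega_inf \<Longrightarrow> q3 P + w 0 (P$1) (P$2) * ((P$3) ^ n / (1 + P$3) ^ (n + 2)) = ser 2 n w P"
      by (rule Q_frac_collect[OF Q(3) order_refl]) (rule that)
    have u': "u P = vector [ser 1 k p P, ser 1 k q P, ser 2 n w P]" if "P \<in> Omega_inf" for P
      using u[OF that] z by (simp add: k ser_drop_top)
    let ?r = "\<lambda>x y. - w 0 x y"
    have dr: "dx ?r = p 0" "dy ?r = q 0"
      unfolding p0 q0 dx_uminus[OF Q(3)] dy_uminus[OF Q(3)] by simp_all
    have edge: "(\<lambda>x. p i x e) \<in> Pol i \<and> (\<lambda>x. x * p i x e + w i x e) \<in> Pol i \<and>
        (\<lambda>y. q i e y) \<in> Pol i \<and> (\<lambda>y. y * q i e y + w i e y) \<in> Pol i" if "e \<in> {0, 1}" for e i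
      using C that unfolding cochain1_def by blast
    show "u \<in> U1_inf k"
      unfolding U1_inf_def
    proof (intro CollectI conjI ballI ext bexI)
      show "u P = vector [q1 P, q2 P, q3 P] +
          ((P$3) ^ (k - 1) / (1 + P$3) ^ (k + 1)) *\<^sub>R
            vector [dx ?r (P$1) (P$2) * P$3, dy ?r (P$1) (P$2) * P$3, - ?r (P$1) (P$2)]" if P: "P \<in> Omega_inf" for P
        unfolding u'[OF P] dr vec3_eq_iff qp[OF P, symmetric] qq[OF P, symmetric] qw[OF P, symmetric]
        by (simp add: k mult_ac)
    next
      show "on_strip (\<lambda>x z. (u (vector [x, e, z]) $ 1, u (vector [x, e, z]) $ 3)) (tangential_space k)"
        "on_strip (\<lambda>y z. (u (vector [e, y, z]) $ 2, u (vector [e, y, z]) $ 3)) (tangential_space k)" if e: "e \<in> {0, 1}" for e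
        using U1_edge_iff[OF Q(1)[unfolded kn, unfolded k] Q(2)[unfolded kn, unfolded k] Q(3)[unfolded k] e
            u'[unfolded k]] edge[OF e] unfolding k by blast+
      show "q3 \<in> Q_frac (int k) (int k) (int k - 2) (k + 1)"
        using q3 unfolding k' .
    qed (use q1 q2 Q in \<open>auto intro: Q2_uminus\<close>)
  qed
qed

section \<open>Pullbacks and the spaces on the finite pyramid\<close>

lemma Dphi_eq:
  assumes "p \<in> Omega_inf"
  defines "s \<equiv> 1 / (1 + p$3)"
  shows "Dphi p = vector [vector [s, 0, - (p$1 * s^2)], vector [0, s, - (p$2 * s^2)], vector [0, 0, s^2]]"
proof -
  let ?D = "\<lambda>h::real^3. vector [h$1 / (1 + p$3) - p$1 / (1 + p$3)^2 * h$3,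
     h$2 / (1 + p$3) - p$2 / (1 + p$3)^2 * h$3, h$3 / (1 + p$3)^2] :: real^3"
  have "(phi has_derivative ?D) (at p)"
    using assms(1) by (intro phi_has_derivative) (auto simp: Omega_inf_def)
  then have "frechet_derivative phi (at p) = ?D"
    by (rule frechet_derivative_at[symmetric])
  then show ?thesis
    unfolding jacobian_def matrix_def s_def by (simp add: vec_eq_iff forall_3 axis_def power_one_over)
qed

lemma det_Dphi:
  assumes "p \<in> Omega_inf"
  shows "det (Dphi p) = (1 / (1 + p$3)) ^ 4"
  unfolding Dphi_eq[OF assms] det_3 by (simp add: eval_nat_numeral)

lemma invertible_Dphi:
  assumes "p \<in> Omega_inf"
  shows "invertible (Dphi p)"
  using assms unfolding invertible_det_nz det_Dphi[OF assms] by (auto simp: Omega_inf_def)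

lemma matrix_inv_inverse:
  assumes "invertible A"
  shows "A ** matrix_inv A = mat 1" "matrix_inv A ** A = mat 1"
  using someI_ex[OF assms[unfolded invertible_def]] unfolding matrix_inv_def by auto

lemma extensional_Omega_eqI:
  assumes "u \<in> extensional Omega" "v \<in> extensional Omega" "\<And>p. p \<in> Omega_inf \<Longrightarrow> u (phi p) = v (phi p)"
  shows "u = v"
proof (rule extensionalityI[OF assms(1,2)])
  fix P assume "P \<in> Omega"
  then show "u P = v P"
    using assms(3)[OF psi_in_Omega_inf] by (simp add: phi_psi)
qed

text \<open>The spaces on \<open>Omega\<close> are preimages under pullbacks, so injectivity is what
  identifies a field once its pullback is known to be that of a family.\<close>

lemma pull0_inject:
  assumes "u \<in> extensional Omega" "v \<in> extensional Omega" "pull0 u = pull0 v"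
  shows "u = v"
proof (rule extensional_Omega_eqI[OF assms(1,2)])
  fix p assume "p \<in> Omega_inf"
  then show "u (phi p) = v (phi p)"
    using fun_cong[OF assms(3), of p] by (simp add: pull0_def)
qed

lemma pull1_inject:
  assumes "u \<in> extensional Omega" "v \<in> extensional Omega" "pull1 u = pull1 v"
  shows "u = v"
proof (rule extensional_Omega_eqI[OF assms(1,2)])
  fix p assume p: "p \<in> Omega_inf"
  then have "transpose (Dphi p) *v u (phi p) = transpose (Dphi p) *v v (phi p)"
    using fun_cong[OF assms(3), of p] by (simp add: pull1_def)
  then show "u (phi p) = v (phi p)"
    by (rule injD[OF inj_matrix_vector_mult[OF transpose_invertible[OF invertible_Dphi[OF p]]]])
qed

lemma pull2_inject:
  assumes "u \<in> extensional Omega" "v \<in> extensional Omega" "pull2 u = pull2 v"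
  shows "u = v"
proof (rule extensional_Omega_eqI[OF assms(1,2)])
  fix p assume p: "p \<in> Omega_inf"
  have "det (Dphi p) \<noteq> 0"
    using invertible_Dphi[OF p] by (simp add: invertible_det_nz)
  then have "matrix_inv (Dphi p) *v u (phi p) = matrix_inv (Dphi p) *v v (phi p)"
    using fun_cong[OF assms(3), of p] p by (simp add: pull2_def)
  then have "Dphi p *v (matrix_inv (Dphi p) *v u (phi p)) = Dphi p *v (matrix_inv (Dphi p) *v v (phi p))"
    by simp
  then show "u (phi p) = v (phi p)"
    by (simp add: matrix_vector_mul_assoc matrix_inv_inverse[OF invertible_Dphi[OF p]])
qed

lemma pull3_inject:
  assumes "u \<in> extensional Omega" "v \<in> extensional Omega" "pull3 u = pull3 v"
  shows "u = v"
proof (rule extensional_Omega_eqI[OF assms(1,2)])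
  fix p assume p: "p \<in> Omega_inf"
  have "det (Dphi p) \<noteq> 0"
    using invertible_Dphi[OF p] by (simp add: invertible_det_nz)
  then show "u (phi p) = v (phi p)"
    using fun_cong[OF assms(3), of p] p by (simp add: pull3_def)
qed

lemma gsum_at_phi: "p \<in> Omega_inf \<Longrightarrow> gsum k f (phi p) = ser 0 k f p"
  by (simp add: gsum_def ser_def lift_at_phi)

lemma ser_scale: "(1 / (1 + p$3)) ^ m * ser 0 k f p = ser m k f p"
  by (simp add: ser_def sum_distrib_left power_add mult_ac)

lemma pull0_rep0:
  "pull0 (rep0 k f) = restrict (ser 0 k f) Omega_inf"
  unfolding pull0_def rep0_def
  by (rule restrict_ext) (simp add: phi_in_Omega gsum_at_phi)

lemma pull3_rep0:
  "pull3 (rep0 k f) = restrict (ser 4 k f) Omega_inf"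
  unfolding pull3_def rep0_def
  by (rule restrict_ext) (simp add: phi_in_Omega gsum_at_phi det_Dphi flip: ser_scale[of _ 4])

text \<open>The transposed Jacobian subtracts multiples of the first two components from the third;
  the mixed terms in \<open>rep1\<close> compensate exactly for this.\<close>

lemma pull1_rep1:
  "pull1 (rep1 k p q w) = restrict (\<lambda>P. vector [ser 1 k p P, ser 1 k q P, ser 2 k w P]) Omega_inf"
  unfolding pull1_def
proof (rule restrict_ext)
  fix P assume P: "P \<in> Omega_inf"
  define s where "s = 1 / (1 + P$3)"
  have "rep1 k p q w (phi P) = vector [ser 0 k p P, ser 0 k q P,
      P$1 * ser 0 k p P + P$2 * ser 0 k q P + ser 0 k w P]"
  proof -
    have "ser 0 k (\<lambda>i x y. x * p i x y + y * q i x y + w i x y) P =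
        P$1 * ser 0 k p P + P$2 * ser 0 k q P + ser 0 k w P"
      unfolding ser_def sum_distrib_left sum.distrib[symmetric] by (simp add: algebra_simps)
    then show ?thesis
      unfolding rep1_def using P by (simp add: phi_in_Omega gsum_at_phi)
  qed
  then show "transpose (Dphi P) *v rep1 k p q w (phi P) = vector [ser 1 k p P, ser 1 k q P, ser 2 k w P]"
    unfolding Dphi_eq[OF P] ser_scale[of P 1, symmetric] ser_scale[of P 2, symmetric] s_def[symmetric]
    by (simp add: vec3_eq_iff matrix_vector_mult_def sum_3 transpose_def algebra_simps)
qed

lemma pull2_rep2:
  "pull2 (rep2 k a b c) = restrict (\<lambda>P. vector [ser 3 k a P, ser 3 k b P, ser 2 k c P]) Omega_inf"
  unfolding pull2_def
proof (rule restrict_ext)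
  fix P assume P: "P \<in> Omega_inf"
  define s where "s = 1 / (1 + P$3)"
  let ?J = "Dphi P"
  let ?v = "vector [ser 3 k a P, ser 3 k b P, ser 2 k c P] :: real^3"
  have r: "rep2 k a b c (phi P) = vector [ser 0 k a P - P$1 * ser 0 k c P, ser 0 k b P - P$2 * ser 0 k c P, ser 0 k c P]"
  proof -
    have "ser 0 k (\<lambda>i x y. a i x y - x * c i x y) P = ser 0 k a P - P$1 * ser 0 k c P"
      "ser 0 k (\<lambda>i x y. b i x y - y * c i x y) P = ser 0 k b P - P$2 * ser 0 k c P"
      unfolding ser_def sum_distrib_left sum_subtractf[symmetric] by (simp_all add: algebra_simps)
    then show ?thesis
      unfolding rep2_def using P by (simp add: phi_in_Omega gsum_at_phi)
  qed
  \<comment> \<open>Applying the Jacobian to the claimed result avoids computing its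
    inverse.\<close>
  have "?J *v ?v = det ?J *\<^sub>R rep2 k a b c (phi P)"
    unfolding det_Dphi[OF P] unfolding Dphi_eq[OF P] ser_scale[of P 3, symmetric] ser_scale[of P 2, symmetric] s_def[symmetric] r
    by (simp add: vec3_eq_iff matrix_vector_mult_def sum_3 algebra_simps eval_nat_numeral)
  then have "det ?J *\<^sub>R (matrix_inv ?J *v rep2 k a b c (phi P)) = matrix_inv ?J *v (?J *v ?v)"
    by (simp add: matrix_vector_mult_scaleR)
  also have "\<dots> = ?v"
    by (simp add: matrix_vector_mul_assoc matrix_inv_inverse[OF invertible_Dphi[OF P]])
  finally show "det ?J *\<^sub>R (matrix_inv ?J *v rep2 k a b c (phi P)) = ?v" .
qed

lemma restrict_eq_iff:
  "u \<in> extensional A \<and> (\<forall>p\<in>A. u p = f p) \<longleftrightarrow> u = restrict f A"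
  by (auto intro: extensionalityI)

lemma U0_eq: "U0 k = {rep0 k f | f. cochain0 k f}"
proof -
  have "pull0 u \<in> U0_inf k \<longleftrightarrow> (\<exists>f. cochain0 k f \<and> pull0 u = pull0 (rep0 k f))" for u
    unfolding U0_inf_iff pull0_rep0 restrict_eq_iff[symmetric] by blast
  moreover have "rep0 k f \<in> extensional Omega" for f
    by (simp add: rep0_def)
  ultimately show ?thesis
    unfolding U0_def using pull0_inject by blast
qed

lemma U1_eq:
  assumes "k \<ge> 1"
  shows "U1 k = {rep1 k p q w | p q w. cochain1 k p q w}"
proof -
  have "pull1 u \<in> U1_inf k \<longleftrightarrow> (\<exists>p q w. cochain1 k p q w \<and> pull1 u = pull1 (rep1 k p q w))" for u
    unfolding U1_inf_iff[OF assms] pull1_rep1 restrict_eq_iff[symmetric] by blast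
  moreover have "rep1 k p q w \<in> extensional Omega" for p q w
    by (simp add: rep1_def)
  ultimately show ?thesis
    unfolding U1_def using pull1_inject by blast
qed

lemma U2_eq:
  assumes "k \<ge> 1"
  shows "U2 k = {rep2 k a b c | a b c. cochain2 k a b c}"
proof -
  have "pull2 u \<in> U2_inf k \<longleftrightarrow> (\<exists>a b c. cochain2 k a b c \<and> pull2 u = pull2 (rep2 k a b c))" for u
    unfolding U2_inf_iff[OF assms] pull2_rep2 restrict_eq_iff[symmetric] by blast
  moreover have "rep2 k a b c \<in> extensional Omega" for a b c
    by (simp add: rep2_def)
  ultimately show ?thesis
    unfolding U2_def using pull2_inject by blast
qed

lemma U3_eq: "U3 k = {rep0 k f | f. cochain3 k f}"
proof -
  have "pull3 u \<in> U3_inf k \<longleftrightarrow> (\<exists>f. cochain3 k f \<and> pull3 u = pull3 (rep0 k f))" for u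
    unfolding U3_inf_iff pull3_rep0 restrict_eq_iff[symmetric] by blast
  moreover have "rep0 k f \<in> extensional Omega" for f
    by (simp add: rep0_def)
  ultimately show ?thesis
    unfolding U3_def using pull3_inject by blast
qed

section \<open>Differentiability and the exact sequence\<close>

lemma differentiable_on_restrict:
  assumes "\<And>p. p \<in> S \<Longrightarrow> \<exists>D. (f has_derivative D) (at p within S)"
  shows "restrict f S differentiable_on S"
  unfolding differentiable_on_def differentiable_def using assms has_derivative_restrict by blast

text \<open>Where no derivative exists, \<open>frechet_derivative\<close> is an arbitrary choice;
  differentiability ensures that gradient, curl and divergence have their usual meaning.\<close>

lemma rep0_differentiable:
  assumes "\<And>i. f i \<in> Q2 l m"
  shows "rep0 k f differentiable_on Omega"
  unfolding rep0_def by (rule differentiable_on_restrict) (rule exI, erule gsum_has_derivative[OF assms])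

lemma rep1_differentiable:
  assumes "cochain1 k p q w"
  shows "rep1 k p q w differentiable_on Omega"
  unfolding rep1_def
proof (rule differentiable_on_restrict)
  note Q = cochain1_Q2[OF assms]
  fix P assume P: "P \<in> Omega"
  show "\<exists>D. ((\<lambda>P. vector [gsum k p P, gsum k q P,
      gsum k (\<lambda>i x y. x * p i x y + y * q i x y + w i x y) P] :: real^3) has_derivative D) (at P within Omega)"
    by (rule exI, rule has_derivative_vector3[OF gsum_has_derivative[OF Q(1) P]
          gsum_has_derivative[OF Q(2) P] gsum_has_derivative[OF Q(4) P]])
qed

lemma rep2_differentiable:
  assumes "cochain2 k a b c"
  shows "rep2 k a b c differentiable_on Omega"
  unfolding rep2_def
proof (rule differentiable_on_restrict)
  note Q = cochain2_Q2[OF assms]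
  fix P assume P: "P \<in> Omega"
  show "\<exists>D. ((\<lambda>P. vector [gsum k (\<lambda>i x y. a i x y - x * c i x y) P,
      gsum k (\<lambda>i x y. b i x y - y * c i x y) P, gsum k c P] :: real^3) has_derivative D) (at P within Omega)"
    by (rule exI, rule has_derivative_vector3[OF gsum_has_derivative[OF Q(4) P]
          gsum_has_derivative[OF Q(5) P] gsum_has_derivative[OF Q(3) P]])
qed

theorem theorem7p2:
  fixes k :: nat
  assumes "k \<ge> 1"
  shows "(\<forall>u\<in>U0 k. u differentiable_on Omega) \<and>
         (\<forall>u\<in>U1 k. u differentiable_on Omega) \<and>
         (\<forall>u\<in>U2 k. u differentiable_on Omega) \<and>
         exact_at UNIV const_field (U0 k) (grad_on Omega) (U1 k) (restrict (\<lambda>p. 0) Omega) \<and>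
         exact_at (U0 k) (grad_on Omega) (U1 k) (curl_on Omega) (U2 k) (restrict (\<lambda>p. 0) Omega) \<and>
         exact_at (U1 k) (curl_on Omega) (U2 k) (div_on Omega) (U3 k) (restrict (\<lambda>p. 0) Omega) \<and>
         div_on Omega ` U2 k = U3 k"
proof (intro conjI)
  note U = U0_eq[of k] U1_eq[OF assms] U2_eq[OF assms] U3_eq[of k]
  have grad: "grad_on Omega ` U0 k \<subseteq> U1 k"
    unfolding U using grad_rep0 cochain1_grad by blast
  have curl: "curl_on Omega ` U1 k \<subseteq> U2 k"
    unfolding U using curl_rep1 cochain2_curl by blast
  have dvg: "div_on Omega ` U2 k \<subseteq> U3 k"
    unfolding U using div_rep2 cochain3_dvg by blast
  have const: "range const_field \<subseteq> U0 k"
    unfolding U using const_field_rep0[of k] by blast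
  show "\<forall>u\<in>U0 k. u differentiable_on Omega"
    unfolding U by (auto simp: cochain0_def intro: rep0_differentiable)
  show "\<forall>u\<in>U1 k. u differentiable_on Omega"
    unfolding U by (auto intro: rep1_differentiable)
  show "\<forall>u\<in>U2 k. u differentiable_on Omega"
    unfolding U by (auto intro: rep2_differentiable)
  have "{u \<in> U0 k. grad_on Omega u = restrict (\<lambda>p. 0) Omega} \<subseteq> range const_field"
    unfolding U using grad_kernel by blast
  then show "exact_at UNIV const_field (U0 k) (grad_on Omega) (U1 k) (restrict (\<lambda>p. 0) Omega)"
    unfolding exact_at_def using const grad grad_const_field by blast
  have "{u \<in> U1 k. curl_on Omega u = restrict (\<lambda>p. 0) Omega} \<subseteq> grad_on Omega ` U0 k"
  proof clarify
    fix u assume "u \<in> U1 k" and z: "curl_on Omega u = restrict (\<lambda>p. 0) Omega"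
    then obtain p q w where u: "u = rep1 k p q w" and C: "cochain1 k p q w"
      unfolding U by blast
    obtain f where "cochain0 k f" "rep1 k p q w = grad_on Omega (rep0 k f)"
      by (rule curl_kernel[OF C z[unfolded u]])
    then show "u \<in> grad_on Omega ` U0 k"
      unfolding U u by blast
  qed
  moreover have "\<forall>u\<in>U0 k. curl_on Omega (grad_on Omega u) = restrict (\<lambda>p. 0) Omega"
    unfolding U using curl_grad by blast
  ultimately show "exact_at (U0 k) (grad_on Omega) (U1 k) (curl_on Omega) (U2 k) (restrict (\<lambda>p. 0) Omega)"
    unfolding exact_at_def using grad curl by blast
  have "{u \<in> U2 k. div_on Omega u = restrict (\<lambda>p. 0) Omega} \<subseteq> curl_on Omega ` U1 k"
  proof clarify
    fix u assume "u \<in> U2 k" and z: "div_on Omega u = restrict (\<lambda>p. 0) Omega"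
    then obtain a b c where u: "u = rep2 k a b c" and C: "cochain2 k a b c"
      unfolding U by blast
    obtain p q w where "cochain1 k p q w" "rep2 k a b c = curl_on Omega (rep1 k p q w)"
      by (rule div_kernel[OF C z[unfolded u]])
    then show "u \<in> curl_on Omega ` U1 k"
      unfolding U u by blast
  qed
  moreover have "\<forall>u\<in>U1 k. div_on Omega (curl_on Omega u) = restrict (\<lambda>p. 0) Omega"
    unfolding U using div_curl by blast
  ultimately show "exact_at (U1 k) (curl_on Omega) (U2 k) (div_on Omega) (U3 k) (restrict (\<lambda>p. 0) Omega)"
    unfolding exact_at_def using curl dvg by blast
  have "U3 k \<subseteq> div_on Omega ` U2 k"
  proof
    fix u assume "u \<in> U3 k"
    then obtain f where "u = rep0 k f" and f: "cochain3 k f"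
      unfolding U by blast
    moreover obtain a b c where "cochain2 k a b c" "rep0 k f = div_on Omega (rep2 k a b c)"
      by (rule div_surj[OF f])
    ultimately show "u \<in> div_on Omega ` U2 k"
      unfolding U by blast
  qed
  then show "div_on Omega ` U2 k = U3 k"
    using dvg by blast
qed

end
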